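(* The marked Poisson measure $\pi_{\tilde\sigma}$ is quasiinvariant with respect to the group $\mathfrak{G}$, and for any $g\in\mathfrak{G}$ we have, for $\pi_{\tilde\sigma}$-a.e. $\omega\in\Omega_X^{\mathbb{R}_+}$, $$\frac{d(g^*\pi_{\tilde\sigma})}{d\pi_{\tilde\sigma}}(\omega)=\prod_{(x,s)\in\omega}p_g^{\tilde\sigma}(x,s),$$ where $p_g^{\tilde\sigma}=\dfrac{d(g^*\tilde\sigma)}{d\tilde\sigma}$ is the Radon--Nikodym density (in the explicit version given in the context).
   Context: Setting. $\mathbb{R}_+:=(0,+\infty)$ and $\lambda$ is Lebesgue measure on $\mathbb{R}_+$. $X$ is a connected, oriented, non-compact $C^\infty$ Riemannian manifold with Riemannian volume $m$. $\mathcal{B}_c(X)$ and $\mathcal{O}_c(X)$ denote the families of Borel, resp. open, subsets of $X$ with compact closure; $\Lambda_{mk}:=\Lambda\times\mathbb{R}_+$ for $\Lambda\subset X$; $\mathcal{B}_c(X\times\mathbb{R}_+)$ is the family of Borel subsets of $X\times\mathbb{R}_+$ whose projection on $X$ belongs to $\mathcal{B}_c(X)$. The measure $\tilde\sigma$ on $X\times\mathbb{R}_+$ is $\tilde\sigma(dx,ds)=q(x,s)\,\lambda(ds)\,m(dx)$, $q(x,s)=\rho(x)p(x,s)$, where $\sigma(dx)=\rho(x)m(dx)$ is a nonatomic Radon measure with $\rho>0$ $m$-a.e., and for $m$-a.e. $x$, $p(x,\cdot)>0$ $\lambda$-a.e. and $p(x,s)\lambda(ds)$ is a finite measure. It is assumed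 that $\tilde\sigma$ is infinite and that $\int_{\Lambda_{mk}}\max\{1,s\}\,q(x,s)\,\lambda(ds)m(dx)<\infty$ for every $\Lambda\in\mathcal{B}_c(X)$ (in particular $\tilde\sigma(\Lambda_{mk})<\infty$). Marked configuration space. $\Omega_X^{\mathbb{R}_+}$ is the set of all $\omega\subset X\times\mathbb{R}_+$ such that (a) distinct points $(x,s),(x',s')\in\omega$ have $x\ne x'$, and (b) the projection of $\omega$ on $X$ is a locally finite subset of $X$. $\mathcal{B}(\Omega_X^{\mathbb{R}_+})$ is the smallest $\sigma$-algebra making all maps $\omega\mapsto N_B(\omega):=\#(\omega\cap B)$, $B\in\mathcal{B}_c(X\times\mathbb{R}_+)$, measurable. Marked Poisson measure. $\pi_{\tilde\sigma}$ is the unique probability measure on $\mathcal{B}(\Omega_X^{\mathbb{R}_+})$ such that for each $\Lambda\in\mathcal{O}_c(X)$ its image under $\omega\mapsto\omega\cap\Lambda_{mk}$ is $e^{-\tilde\sigma(\Lambda_{mk})}\sum_{n\ge0}\frac1{n!}\tilde\sigma_{\Lambda,n}$, where $\tilde\sigma_{\Lambda,0}$ is the unit mass at $\varnothing$ and $\tilde\sigma_{\Lambda,n}$ is the image of $\tilde\sigma^{\otimes n}$ on $\Lambda_{mk}^n$ under $((x_1,s_1),\dots,(x_n,s_n))\mapsto\{(x_1,s_1),\dots,(x_n,s_n)\}$ (defined where the $x_i$ are pairwise distinct, i.e. $\tilde\sigma^{\otimes n}$-a.e.). Group. $\mathrm{Diff}_0(X)$ is the group of diffeomorphisms of $X$ equal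 to the identity outside a compact set; $\mathbb{R}_+^X$ is the group (pointwise multiplication) of $C^\infty$ maps $\theta:X\to\mathbb{R}_+$ equal to $1$ outside a compact set. $\mathfrak{G}$ is the semidirect product: the set $\mathrm{Diff}_0(X)\times\mathbb{R}_+^X$ with $(\psi_1,\theta_1)(\psi_2,\theta_2)=(\psi_1\circ\psi_2,\theta_1(\theta_2\circ\psi_1^{-1}))$. It acts on $X\times\mathbb{R}_+$ by $g(x,s)=(\psi(x),\theta(\psi(x))s)$ for $g=(\psi,\theta)$, and on $\Omega_X^{\mathbb{R}_+}$ by $g(\omega)=\{g(x,s):(x,s)\in\omega\}$. $g^*\mu:=\mu\circ g^{-1}$ denotes the image measure. Quasiinvariance means that $g^*\mu$ and $\mu$ are equivalent for all $g\in\mathfrak{G}$. Version of the density. For $g=(\psi,\theta)$, $p_g^{\tilde\sigma}(x,s)=\frac{q(\psi^{-1}(x),\theta(x)^{-1}s)}{q(x,s)\theta(x)}J_m^\psi(x)$ if $0<q(x,s)<\infty$ and $0<q(\psi^{-1}(x),\theta(x)^{-1}s)<\infty$, and $p_g^{\tilde\sigma}(x,s)=1$ otherwise, where $J_m^\psi=d(\psi^*m)/dm$. For each $\omega$ only finitely many factors of the product differ from $1$. *)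

theory Defs
  imports "HOL-Probability.Probability" "HOL-Algebra.Group"
begin

section \<open>Smooth maps between open subsets of Euclidean spaces\<close>

text \<open>Meaningful for open \<open>S\<close> only.\<close>

primrec Ck_on :: "nat \<Rightarrow> 'e::real_normed_vector set \<Rightarrow> ('e \<Rightarrow> 'f::real_normed_vector) \<Rightarrow> bool" where
  "Ck_on 0 S f \<longleftrightarrow> continuous_on S f"
| "Ck_on (Suc k) S f \<longleftrightarrow>
     (\<forall>x\<in>S. f differentiable (at x)) \<and> (\<forall>v. Ck_on k S (\<lambda>x. frechet_derivative f (at x) v))"

definition smooth_on :: "'e::real_normed_vector set \<Rightarrow> ('e \<Rightarrow> 'f::real_normed_vector) \<Rightarrow> bool" where
  "smooth_on S f \<longleftrightarrow> (\<forall>k. Ck_on k S f)"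

section \<open>Oriented Riemannian manifolds\<close>

text \<open>
  The underlying set of the manifold \<open>X\<close> is the whole type \<open>'a\<close>; its dimension is \<open>CARD('n)\<close>.
  (The dimension is thereby positive; a connected 0-dimensional manifold is a point, hence compact.)
  A chart is a pair of its domain and its coordinate map; values of the coordinate map outside of
  the domain are irrelevant.
\<close>

type_synonym ('a, 'n) chart = "'a set \<times> ('a \<Rightarrow> real^'n)"

abbreviation cdom :: "('a, 'n) chart \<Rightarrow> 'a set" where
  "cdom c \<equiv> fst c"

abbreviation crd :: "('a, 'n) chart \<Rightarrow> 'a \<Rightarrow> real^'n" where
  "crd c \<equiv> snd c"

definition cinv :: "('a, 'n) chart \<Rightarrow> real^'n \<Rightarrow> 'a" where
  "cinv c = inv_into (cdom c) (crd c)"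

definition is_chart :: "('a::topological_space, 'n::finite) chart \<Rightarrow> bool" where
  "is_chart c \<longleftrightarrow> open (cdom c) \<and> open (crd c ` cdom c) \<and>
     homeomorphism (cdom c) (crd c ` cdom c) (crd c) (cinv c)"

definition transition :: "('a, 'n) chart \<Rightarrow> ('a, 'n) chart \<Rightarrow> real^'n \<Rightarrow> real^'n" where
  "transition c c' = crd c' \<circ> cinv c"

text \<open>
  A smooth structure together with an orientation is given by an atlas whose coordinate changes
  are smooth with positive Jacobian determinant.  The atlas need not be maximal.
\<close>

definition oriented_smooth_atlas :: "('a::topological_space, 'n::finite) chart set \<Rightarrow> bool" where
  "oriented_smooth_atlas A \<longleftrightarrow>
     (\<forall>c\<in>A. is_chart c) \<and> (\<Union>c\<in>A. cdom c) = UNIV \<and>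
     (\<forall>c\<in>A. \<forall>c'\<in>A. smooth_on (crd c ` (cdom c \<inter> cdom c')) (transition c c') \<and>
        (\<forall>y \<in> crd c ` (cdom c \<inter> cdom c'). det (jacobian (transition c c') (at y)) > 0))"

text \<open>
  A Riemannian metric is given by its coefficient matrices in the charts of the atlas,
  which transform as a covariant 2-tensor under coordinate changes.
\<close>

definition riemannian_metric ::
    "('a::topological_space, 'n::finite) chart set \<Rightarrow> (('a, 'n) chart \<Rightarrow> real^'n \<Rightarrow> real^'n^'n) \<Rightarrow> bool" where
  "riemannian_metric A G \<longleftrightarrow>
     (\<forall>c\<in>A. smooth_on (crd c ` cdom c) (G c) \<and>
        (\<forall>y \<in> crd c ` cdom c. transpose (G c y) = G c y \<and> (\<forall>v. v \<noteq> 0 \<longrightarrow> v \<bullet> (G c y *v v) > 0))) \<and>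
     (\<forall>c\<in>A. \<forall>c'\<in>A. \<forall>y \<in> crd c ` (cdom c \<inter> cdom c').
        G c y = transpose (jacobian (transition c c') (at y)) ** G c' (transition c c' y)
                  ** jacobian (transition c c') (at y))"

text \<open>
  The Riemannian volume is the Borel measure with density \<open>sqrt (det (g\<^sub>i\<^sub>j))\<close> with respect to
  Lebesgue measure in each chart; this determines it uniquely, since countably many charts
  cover the manifold.
\<close>

definition riemannian_volume ::
    "('a::topological_space, 'n::finite) chart set \<Rightarrow> (('a, 'n) chart \<Rightarrow> real^'n \<Rightarrow> real^'n^'n) \<Rightarrow>
     'a measure \<Rightarrow> bool" where
  "riemannian_volume A G m \<longleftrightarrow> sets m = sets borel \<and>
     (\<forall>c\<in>A. \<forall>B \<in> sets borel. B \<subseteq> cdom c \<longrightarrow>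
        emeasure m B = (\<integral>\<^sup>+y \<in> crd c ` B. ennreal (sqrt (det (G c y))) \<partial>lborel))"

definition smooth_function :: "('a::topological_space, 'n::finite) chart set \<Rightarrow> ('a \<Rightarrow> real) \<Rightarrow> bool" where
  "smooth_function A f \<longleftrightarrow> (\<forall>c\<in>A. smooth_on (crd c ` cdom c) (f \<circ> cinv c))"

definition smooth_selfmap :: "('a::topological_space, 'n::finite) chart set \<Rightarrow> ('a \<Rightarrow> 'a) \<Rightarrow> bool" where
  "smooth_selfmap A f \<longleftrightarrow> continuous_on UNIV f \<and>
     (\<forall>c\<in>A. \<forall>c'\<in>A. smooth_on (crd c ` (cdom c \<inter> f -` cdom c')) (crd c' \<circ> f \<circ> cinv c))"

definition diffeomorphism :: "('a::topological_space, 'n::finite) chart set \<Rightarrow> ('a \<Rightarrow> 'a) \<Rightarrow> bool" where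
  "diffeomorphism A f \<longleftrightarrow> bij f \<and> smooth_selfmap A f \<and> smooth_selfmap A (inv_into UNIV f)"

section \<open>The group and its actions\<close>

definition Diff0 :: "('a::topological_space, 'n::finite) chart set \<Rightarrow> ('a \<Rightarrow> 'a) set" where
  "Diff0 A = {\<psi>. diffeomorphism A \<psi> \<and> (\<exists>K. compact K \<and> (\<forall>x. x \<notin> K \<longrightarrow> \<psi> x = x))}"

definition Scale0 :: "('a::topological_space, 'n::finite) chart set \<Rightarrow> ('a \<Rightarrow> real) set" where
  "Scale0 A = {\<theta>. smooth_function A \<theta> \<and> (\<forall>x. \<theta> x > 0) \<and>
                  (\<exists>K. compact K \<and> (\<forall>x. x \<notin> K \<longrightarrow> \<theta> x = 1))}"

definition marked_group ::
    "('a::topological_space, 'n::finite) chart set \<Rightarrow> (('a \<Rightarrow> 'a) \<times> ('a \<Rightarrow> real)) monoid" where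
  "marked_group A =
     \<lparr> carrier = Diff0 A \<times> Scale0 A,
       mult = (\<lambda>(\<psi>\<^sub>1, \<theta>\<^sub>1) (\<psi>\<^sub>2, \<theta>\<^sub>2). (\<psi>\<^sub>1 \<circ> \<psi>\<^sub>2, \<lambda>x. \<theta>\<^sub>1 x * \<theta>\<^sub>2 (inv_into UNIV \<psi>\<^sub>1 x))),
       one = (id, \<lambda>_. 1) \<rparr>"

fun act_point :: "('a \<Rightarrow> 'a) \<times> ('a \<Rightarrow> real) \<Rightarrow> 'a \<times> real \<Rightarrow> 'a \<times> real" where
  "act_point (\<psi>, \<theta>) (x, s) = (\<psi> x, \<theta> (\<psi> x) * s)"

definition act_conf :: "('a \<Rightarrow> 'a) \<times> ('a \<Rightarrow> real) \<Rightarrow> ('a \<times> real) set \<Rightarrow> ('a \<times> real) set" where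
  "act_conf g \<omega> = act_point g ` \<omega>"

section \<open>Measures on the manifold and on the marked space\<close>

definition radon_measure :: "'a::topological_space measure \<Rightarrow> bool" where
  "radon_measure M \<longleftrightarrow> sets M = sets borel \<and> (\<forall>K. compact K \<longrightarrow> emeasure M K < \<infinity>) \<and>
     (\<forall>B \<in> sets borel. emeasure M B = (SUP K \<in> {K. compact K \<and> K \<in> sets borel \<and> K \<subseteq> B}. emeasure M K))"

definition nonatomic :: "'a measure \<Rightarrow> bool" where
  "nonatomic M \<longleftrightarrow> (\<forall>B \<in> sets M. emeasure M B > 0 \<longrightarrow>
     (\<exists>C \<in> sets M. C \<subseteq> B \<and> 0 < emeasure M C \<and> emeasure M C < emeasure M B))"

text \<open>Lebesgue measure on the open half-line, which is the space of marks.\<close>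

definition lam :: "real measure" where
  "lam = restrict_space lborel {0<..}"

definition cyl :: "'a set \<Rightarrow> ('a \<times> real) set" where
  "cyl L = L \<times> {0<..}"

definition q_density :: "('a \<Rightarrow> ennreal) \<Rightarrow> ('a \<Rightarrow> real \<Rightarrow> ennreal) \<Rightarrow> 'a \<times> real \<Rightarrow> ennreal" where
  "q_density \<rho> p = (\<lambda>(x, s). \<rho> x * p x s)"

definition sigma_tilde ::
    "'a measure \<Rightarrow> ('a \<Rightarrow> ennreal) \<Rightarrow> ('a \<Rightarrow> real \<Rightarrow> ennreal) \<Rightarrow> ('a \<times> real) measure" where
  "sigma_tilde m \<rho> p = density (m \<Otimes>\<^sub>M lam) (q_density \<rho> p)"

section \<open>The marked configuration space and the marked Poisson measure\<close>

definition Omega :: "('a::topological_space \<times> real) set set" where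
  "Omega = {\<omega>. \<omega> \<subseteq> cyl UNIV \<and> inj_on fst \<omega> \<and> (\<forall>K. compact K \<longrightarrow> finite (fst ` \<omega> \<inter> K))}"

definition Bc :: "'a::topological_space set set" where
  "Bc = {L \<in> sets borel. compact (closure L)}"

definition Bc_marked :: "('a::topological_space \<times> real) set set" where
  "Bc_marked = {B \<in> sets borel. B \<subseteq> cyl UNIV \<and> fst ` B \<in> Bc}"

definition Omega_M :: "('a::topological_space \<times> real) set measure" where
  "Omega_M = sigma Omega {(\<lambda>\<omega>. card (\<omega> \<inter> B)) -` N \<inter> Omega | B N. B \<in> Bc_marked}"

text \<open>
  The image of the \<open>n\<close>-fold product of \<open>S\<close>, restricted to the cylinder over \<open>L\<close>, under the map
  sending an \<open>n\<close>-tuple with pairwise distinct positions to the set of its entries.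
  For \<open>n = 0\<close> this is the unit mass at the empty configuration.
\<close>

definition poisson_component ::
    "('a::topological_space \<times> real) measure \<Rightarrow> 'a set \<Rightarrow> nat \<Rightarrow> ('a \<times> real) set measure" where
  "poisson_component S L n =
     distr (restrict_space (Pi\<^sub>M {..<n} (\<lambda>_. restrict_space S (cyl L))) {z. inj_on (\<lambda>i. fst (z i)) {..<n}})
       Omega_M (\<lambda>z. z ` {..<n})"

definition marked_poisson ::
    "('a::topological_space \<times> real) measure \<Rightarrow> ('a \<times> real) set measure \<Rightarrow> bool" where
  "marked_poisson S P \<longleftrightarrow> prob_space P \<and> sets P = sets Omega_M \<and>
     (\<forall>L. open L \<and> compact (closure L) \<longrightarrow>
        (\<forall>E \<in> sets Omega_M.
           emeasure (distr P Omega_M (\<lambda>\<omega>. \<omega> \<inter> cyl L)) E =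
             ennreal (exp (- measure S (cyl L))) *
               (\<Sum>n. ennreal (1 / fact n) * emeasure (poisson_component S L n) E)))"

section \<open>Quasiinvariance and the density\<close>

definition quasiinvariant ::
    "('a::topological_space, 'n::finite) chart set \<Rightarrow> ('a \<times> real) set measure \<Rightarrow> bool" where
  "quasiinvariant A P \<longleftrightarrow> (\<forall>g \<in> carrier (marked_group A).
     absolutely_continuous P (distr P Omega_M (act_conf g)) \<and>
     absolutely_continuous (distr P Omega_M (act_conf g)) P)"

text \<open>
  The Radon-Nikodym density of the image of \<open>m\<close> under \<open>\<psi>\<close> with respect to \<open>m\<close>, in its unique
  continuous version.  (An arbitrary version need not equal 1 everywhere outside the support of
  \<open>\<psi>\<close>, so that the product over a configuration could have infinitely many factors distinct
  from 1.)
\<close>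

definition J_density :: "'a::topological_space measure \<Rightarrow> ('a \<Rightarrow> 'a) \<Rightarrow> 'a \<Rightarrow> real" where
  "J_density m \<psi> = (THE J. continuous_on UNIV J \<and> (\<forall>x. 0 \<le> J x) \<and>
                          distr m borel \<psi> = density m (\<lambda>x. ennreal (J x)))"

definition p_density ::
    "'a::topological_space measure \<Rightarrow> ('a \<Rightarrow> ennreal) \<Rightarrow> ('a \<Rightarrow> real \<Rightarrow> ennreal) \<Rightarrow>
     ('a \<Rightarrow> 'a) \<times> ('a \<Rightarrow> real) \<Rightarrow> 'a \<times> real \<Rightarrow> ennreal" where
  "p_density m \<rho> p = (\<lambda>(\<psi>, \<theta>) (x, s).
     let q = q_density \<rho> p (x, s);
         q' = q_density \<rho> p (inv_into UNIV \<psi> x, inverse (\<theta> x) * s)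
     in if 0 < q \<and> q < \<infinity> \<and> 0 < q' \<and> q' < \<infinity>
        then q' / (q * ennreal (\<theta> x)) * ennreal (J_density m \<psi> x)
        else 1)"

text \<open>The product over a configuration of a function that differs from 1 at only finitely many of its points.\<close>

definition conf_prod :: "('a \<times> real \<Rightarrow> ennreal) \<Rightarrow> ('a \<times> real) set \<Rightarrow> ennreal" where
  "conf_prod f \<omega> = (\<Prod>z \<in> {z \<in> \<omega>. f z \<noteq> 1}. f z)"

end

theory Submission
  imports Defs
begin

text \<open>
  A marked Poisson measure is determined by its restrictions to bounded windows, and in a window it is a
  mixture of images of product measures of the intensity.  A transformation \<open>g = (\<psi>, \<theta>)\<close> of the
  marked space acts on all points of a configuration at once.  So if the image of the intensity under
  \<open>g\<close> has the density \<open>f\<close> with respect to the intensity, the image of its \<open>n\<close>-th power has the density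
  \<open>f (z\<^sub>1) * ... * f (z\<^sub>n)\<close>, which is the product of \<open>f\<close> over the configuration \<open>{z\<^sub>1, ..., z\<^sub>n}\<close>.  Since \<open>g\<close> is the
  identity over the complement of a compact set \<open>K\<close>, it maps the cylinder over every window that contains \<open>K\<close> onto itself, and
  \<open>f\<close> is 1 outside of it.  The normalising factors therefore agree, and the product over the points
  in the window equals the product over the whole configuration.  This identifies the image of
  the Poisson measure on all events observable in a window (\<open>poisson_component_transformed\<close>,
  \<open>local_law_transformed\<close>), and these events generate the sigma-algebra (\<open>distr_poisson\<close>).

  The density \<open>f\<close> of the intensity is obtained from the density of the image of the Riemannian volume
  under \<open>\<psi>\<close>.  The product over a configuration requires a version that is exactly 1 off \<open>K\<close>, hence the continuous version.
  In charts the change of variables formula gives continuous local densities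
  (\<open>diffeomorphism_local_density\<close>).  As the volume is positive on nonempty open sets, these are unique and glue
  (\<open>glue_continuous_densities\<close>), and the resulting density equals 1 wherever \<open>\<psi>\<close> is the
  identity near the point (\<open>J_density_eq_1\<close>).  Scaling the marks by \<open>\<theta>\<close> contributes \<open>1 / \<theta>\<close> (\<open>distr_pair_lam\<close>), and
  multiplying by the quotient of the values of \<open>q\<close> gives the claim for the
  intensity (\<open>distr_sigma_tilde\<close>).

  The existence of a density yields one half of quasiinvariance.  The other half is the same
  statement for the inverse transformation (\<open>absolutely_continuous_action_converse\<close>).
\<close>

section \<open>Change of variables in coordinate spaces\<close>

text \<open>
  A copy of a finite type with a canonical well-order.  The change of variables formula for
  injective differentiable maps is stated for coordinate spaces with a well-ordered index type;
  renaming the coordinates along a bijection with this copy carries it over to every finite index type.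
\<close>

typedef ('n::finite) wo_index = "{..<CARD('n)}"
  by (auto intro!: exI[of _ 0])

instance wo_index :: (finite) finite
  by standard (simp add: type_definition.univ[OF type_definition_wo_index])

instantiation wo_index :: (finite) wellorder
begin
definition less_eq_wo_index :: "'a wo_index \<Rightarrow> 'a wo_index \<Rightarrow> bool" where
  "less_eq_wo_index a b \<longleftrightarrow> Rep_wo_index a \<le> Rep_wo_index b"
definition less_wo_index :: "'a wo_index \<Rightarrow> 'a wo_index \<Rightarrow> bool" where
  "less_wo_index a b \<longleftrightarrow> Rep_wo_index a < Rep_wo_index b"
instance
proof
  fix Q :: "'a wo_index \<Rightarrow> bool" and a
  assume step: "\<And>x. (\<And>y. y < x \<Longrightarrow> Q y) \<Longrightarrow> Q x"
  show "Q a"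
  proof (induction a rule: measure_induct_rule[of Rep_wo_index])
    case (less x)
    show "Q x"
      by (rule step) (simp add: less less_wo_index_def)
  qed
qed (auto simp: less_eq_wo_index_def less_wo_index_def Rep_wo_index_inject)
end

lemma bij_has_inverse:
  "bij e \<Longrightarrow> \<exists>e'. (\<forall>i. e' (e i) = i) \<and> (\<forall>j. e (e' j) = j)"
  by (rule exI[of _ "inv_into UNIV e"]) (simp add: bij_is_inj bij_is_surj surj_f_inv_f)

lemma wo_index_bij: "\<exists>e :: 'n::finite wo_index \<Rightarrow> 'n. bij e"
proof -
  have "bij_betw Rep_wo_index (UNIV :: 'n wo_index set) {..<CARD('n)}"
    by (simp add: bij_betw_def inj_on_def Rep_wo_index_inject type_definition.Rep_range[OF type_definition_wo_index])
  moreover obtain f :: "nat \<Rightarrow> 'n" where "bij_betw f {..<CARD('n)} UNIV"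
    using ex_bij_betw_nat_finite[of "UNIV :: 'n set"] by (auto simp: lessThan_atLeast0)
  ultimately show ?thesis
    using bij_betw_trans by blast
qed

text \<open>
  The underlying equivalence speaks about finite volumes and finite integrals only.  The extended
  identity follows because finiteness of either side yields the equality, and otherwise both sides
  are infinite.
\<close>

lemma emeasure_injective_image_wellorder:
  fixes f :: "real^'n::{finite,wellorder} \<Rightarrow> real^'n::_"
  assumes B: "B \<in> sets borel" and fB: "f ` B \<in> sets borel"
    and der: "\<And>x. x \<in> B \<Longrightarrow> (f has_derivative f' x) (at x)"
    and inj: "inj_on f B"
    and meas: "(\<lambda>x. indicator B x * \<bar>det (matrix (f' x))\<bar>) \<in> borel_measurable borel"
  shows "emeasure lborel (f ` B) = (\<integral>\<^sup>+x\<in>B. ennreal \<bar>det (matrix (f' x))\<bar> \<partial>lborel)"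
proof -
  let ?d = "\<lambda>x. \<bar>det (matrix (f' x))\<bar>"
  have equiv: "f ` B \<in> lmeasurable \<and> measure lebesgue (f ` B) = r \<longleftrightarrow> (?d has_integral r) B" for r
    by (rule has_measure_differentiable_image) (use B der inj in \<open>auto intro: has_derivative_at_withinI\<close>)
  have em: "emeasure lborel (f ` B) = emeasure lebesgue (f ` B)"
    using fB by simp
  have comm: "(\<integral>\<^sup>+x\<in>B. ennreal (?d x) \<partial>lborel) = (\<integral>\<^sup>+x. ennreal (indicator B x * ?d x) \<partial>lborel)"
    by (intro nn_integral_cong) (auto split: split_indicator)
  have "(\<exists>r\<ge>0. (\<integral>\<^sup>+x. ennreal (indicator B x * ?d x) \<partial>lborel) = ennreal r) \<or>
      (\<integral>\<^sup>+x. ennreal (indicator B x * ?d x) \<partial>lborel) = \<infinity>"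
    by (cases "\<integral>\<^sup>+x. ennreal (indicator B x * ?d x) \<partial>lborel" rule: ennreal_cases) auto
  then consider (int) r where "0 \<le> r" "(\<integral>\<^sup>+x. ennreal (indicator B x * ?d x) \<partial>lborel) = ennreal r"
    | (fin) "emeasure lborel (f ` B) \<noteq> \<infinity>"
    | (inf) "emeasure lborel (f ` B) = \<infinity>" "(\<integral>\<^sup>+x. ennreal (indicator B x * ?d x) \<partial>lborel) = \<infinity>"
    by blast
  then show ?thesis
  proof cases
    case int
    have "((\<lambda>x. indicator B x * ?d x) has_integral r) UNIV"
      using int meas by (intro nn_integral_has_integral) auto
    then have "(?d has_integral r) B"
      using has_integral_restrict_UNIV[of B ?d r]
      by (simp add: indicator_def of_bool_def if_distrib if_distribR cong: if_cong)
    then have "f ` B \<in> lmeasurable" "measure lebesgue (f ` B) = r"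
      using equiv by auto
    then show ?thesis
      using int emeasure_eq_measure2[of "f ` B" lebesgue] by (simp only: em comm)
  next
    case fin
    then have "f ` B \<in> lmeasurable"
      using fB by (simp add: fmeasurable_def less_top)
    then have "(?d has_integral measure lebesgue (f ` B)) B"
      using equiv by auto
    from nn_integral_has_integral_lebesgue'[OF _ this]
    show ?thesis
      using \<open>f ` B \<in> lmeasurable\<close> emeasure_eq_measure2[of "f ` B" lebesgue] by (simp only: em)
  qed (simp add: comm)
qed

text \<open>
  Renaming coordinates maps boxes to boxes with the same side lengths, and Lebesgue measure is
  determined by its values on boxes.
\<close>

lemma distr_reindex_lborel:
  fixes e :: "'k::finite \<Rightarrow> 'n::finite"
  assumes "bij e"
  shows "distr lborel borel (\<lambda>x :: real^'n. \<chi> i. x $ e i) = (lborel :: (real^'k) measure)"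
proof (rule lborel_eqI[symmetric])
  obtain e' where ein: "\<And>i. e' (e i) = i" "\<And>j. e (e' j) = j"
    using bij_has_inverse[OF assms] by blast
  let ?T = "\<lambda>x :: real^'n. (\<chi> i. x $ e i) :: real^'k"
  have cont: "continuous_on UNIV ?T"
    by (intro continuous_intros)
  then have T: "?T \<in> borel_measurable borel"
    by (rule borel_measurable_continuous_onI)
  fix l u :: "real^'k"
  assume le: "\<And>b. b \<in> Basis \<Longrightarrow> l \<bullet> b \<le> u \<bullet> b"
  then have le': "l $ i \<le> u $ i" for i
    using le[of "axis i 1"] by (simp add: cart_eq_inner_axis[symmetric])
  define l' u' :: "real^'n" where "l' = (\<chi> j. l $ e' j)" and "u' = (\<chi> j. u $ e' j)"
  have pre: "?T -` box l u = box l' u'"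
  proof -
    have "(\<forall>i. l $ i < x $ e i \<and> x $ e i < u $ i) \<longleftrightarrow> (\<forall>j. l $ e' j < x $ j \<and> x $ j < u $ e' j)" for x
      by (metis ein)
    then show ?thesis
      by (auto simp: mem_box_cart l'_def u'_def)
  qed
  have le2: "\<And>b. b \<in> Basis \<Longrightarrow> l' \<bullet> b \<le> u' \<bullet> b"
    by (auto simp: Basis_vec_def cart_eq_inner_axis[symmetric] l'_def u'_def le')
  have prodB: "(\<Prod>b\<in>Basis. (v - w) \<bullet> b) = (\<Prod>i\<in>UNIV. (v - w) $ i)" for v w :: "real^'j::finite"
  proof -
    have "inj (\<lambda>i::'j. axis i (1::real))"
      by (auto simp: inj_on_def axis_eq_axis)
    moreover have "(Basis :: (real^'j) set) = range (\<lambda>i. axis i 1)"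
      by (auto simp: Basis_vec_def)
    ultimately show ?thesis
      using prod.reindex[of "\<lambda>i::'j. axis i (1::real)" UNIV "\<lambda>b. (v - w) \<bullet> b"]
      by (simp add: cart_eq_inner_axis o_def)
  qed
  have "emeasure (distr lborel borel ?T) (box l u) = emeasure lborel (box l' u')"
    using T by (simp add: emeasure_distr pre)
  also have "\<dots> = (\<Prod>b\<in>Basis. (u' - l') \<bullet> b)"
    using le2 by simp
  also have "(\<Prod>b\<in>Basis. (u' - l') \<bullet> b) = (\<Prod>b\<in>Basis. (u - l) \<bullet> b)"
    unfolding prodB l'_def u'_def
    by (intro prod.reindex_bij_witness[of _ e e']) (auto simp: ein)
  finally show "emeasure (distr lborel borel ?T) (box l u) = (\<Prod>b\<in>Basis. (u - l) \<bullet> b)" .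
qed simp

lemma continuous_on_det:
  fixes M :: "'a::topological_space \<Rightarrow> real^'n^'n"
  assumes "\<And>i j. continuous_on S (\<lambda>x. M x $ i $ j)"
  shows "continuous_on S (\<lambda>x. det (M x))"
  unfolding det_def by (intro continuous_intros assms)

text \<open>
  The density \<open>h\<close> is the modulus of the Jacobian determinant, computed after renaming the coordinates.
  Renaming preserves volumes, so the formula for well-ordered indices gives the claim.
\<close>

lemma emeasure_injective_image:
  fixes f :: "real^'n::finite \<Rightarrow> real^'n"
  assumes W: "open W"
    and der: "\<And>x. x \<in> W \<Longrightarrow> (f has_derivative f' x) (at x)"
    and cont: "\<And>v. continuous_on W (\<lambda>x. f' x v)"
    and inj: "inj_on f W"
  shows "\<exists>h. continuous_on W h \<and> (\<forall>x. 0 \<le> h x) \<and>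
    (\<forall>B\<in>sets borel. B \<subseteq> W \<longrightarrow> f ` B \<in> sets borel \<longrightarrow>
       emeasure lborel (f ` B) = (\<integral>\<^sup>+x\<in>B. ennreal (h x) \<partial>lborel))"
proof -
  obtain e :: "'n wo_index \<Rightarrow> 'n" where e: "bij e"
    using wo_index_bij by blast
  then obtain e' where ein: "\<And>i. e' (e i) = i" "\<And>j. e (e' j) = j"
    using bij_has_inverse by blast
  define T :: "real^'n \<Rightarrow> real^'n wo_index" where "T = (\<lambda>x. \<chi> i. x $ e i)"
  define U :: "real^'n wo_index \<Rightarrow> real^'n" where "U = (\<lambda>x. \<chi> j. x $ e' j)"
  have UT [simp]: "U (T x) = x" "T (U y) = y" for x y
    by (simp_all add: T_def U_def ein vec_eq_iff)
  have contT: "continuous_on S T" and contU: "continuous_on S' U" for S S'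
    unfolding T_def U_def by (intro continuous_intros)+
  have blT: "bounded_linear T"
    unfolding T_def linear_conv_bounded_linear[symmetric]
    by (auto intro!: linearI simp: vec_eq_iff)
  have blU: "bounded_linear U"
    unfolding U_def linear_conv_bounded_linear[symmetric]
    by (auto intro!: linearI simp: vec_eq_iff)
  have Tm: "T \<in> borel_measurable borel" and Um: "U \<in> borel_measurable borel"
    using contT contU by (auto intro: borel_measurable_continuous_onI)
  have distrT: "distr lborel borel T = lborel"
    unfolding T_def by (rule distr_reindex_lborel[OF e])
  have imT: "T ` B = U -` B" for B
    by (auto intro: rev_image_eqI)
  have Tborel: "T ` B \<in> sets borel" if "B \<in> sets borel" for B
    unfolding imT using measurable_sets_borel[OF Um that] by simp
  have emT: "emeasure lborel (T ` B) = emeasure lborel B" if "B \<in> sets borel" for B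
  proof -
    have "emeasure lborel (T ` B) = emeasure (distr lborel borel T) (T ` B)"
      by (simp add: distrT)
    also have "\<dots> = emeasure lborel (T -` T ` B)"
      using Tm Tborel[OF that] by (simp add: emeasure_distr)
    also have "T -` T ` B = B"
      by (auto dest: arg_cong[of _ _ U])
    finally show ?thesis .
  qed
  define k where "k = T \<circ> f \<circ> U"
  define k' where "k' y = T \<circ> f' (U y) \<circ> U" for y
  (* The derivative of f, conjugated by the isometry T, is the derivative of the conjugated map k. *)
  define h where "h x = \<bar>det (matrix (T \<circ> f' x \<circ> U))\<bar>" for x
  have conth: "continuous_on W h"
    unfolding h_def matrix_def T_def
    by (auto intro!: continuous_intros continuous_on_det continuous_on_vec_lambda continuous_on_component cont)
  have "emeasure lborel (f ` B) = (\<integral>\<^sup>+x\<in>B. ennreal (h x) \<partial>lborel)"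
    if B: "B \<in> sets borel" "B \<subseteq> W" "f ` B \<in> sets borel" for B
  proof -
    have kTB: "k ` T ` B = T ` f ` B"
      by (auto simp: k_def image_comp)
    have "(\<lambda>x. indicator W x *\<^sub>R h x) \<in> borel_measurable borel"
      using borel_measurable_continuous_on_indicator[of W h] W conth by auto
    then have hm: "(\<lambda>x. indicator B x * (indicator W x *\<^sub>R h x)) \<in> borel_measurable borel"
      using B by measurable
    moreover have "(\<lambda>x. indicator B x * (indicator W x *\<^sub>R h x)) = (\<lambda>x. indicator B x * h x)"
      using B by (intro ext) (auto split: split_indicator)
    ultimately have hm: "(\<lambda>x. indicator B x * h x) \<in> borel_measurable borel"
      by simp
    have "emeasure lborel (f ` B) = emeasure lborel (k ` T ` B)"
      unfolding kTB using B by (simp add: emT)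
    also have "\<dots> = (\<integral>\<^sup>+y\<in>T ` B. ennreal \<bar>det (matrix (k' y))\<bar> \<partial>lborel)"
    proof (rule emeasure_injective_image_wellorder)
      show "T ` B \<in> sets borel" "k ` T ` B \<in> sets borel"
        using B Tborel by (auto simp: kTB)
      show "inj_on k (T ` B)"
      proof (rule inj_onI)
        fix y z assume "y \<in> T ` B" "z \<in> T ` B" and eq: "k y = k z"
        then have "U y \<in> W" "U z \<in> W"
          using B(2) by auto
        moreover have "f (U y) = f (U z)"
          using arg_cong[OF eq, of U] by (simp add: k_def)
        ultimately have "U y = U z"
          using inj by (simp add: inj_on_def)
        then show "y = z"
          by (metis UT(2))
      qed
      show "(k has_derivative k' y) (at y)" if "y \<in> T ` B" for y
      proof -
        from that have "U y \<in> W"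
          using B by auto
        then have 1: "(f has_derivative f' (U y)) (at (U y))"
          by (rule der)
        have 2: "(U has_derivative U) (at y)"
          using blU by (rule bounded_linear_imp_has_derivative)
        have 3: "(T has_derivative T) (at (f (U y)))"
          using blT by (rule bounded_linear_imp_has_derivative)
        show ?thesis
          unfolding k_def k'_def comp_assoc
          by (intro diff_chain_at 2 1) (simp add: 3)
      qed
      have "(\<lambda>y. indicator B (U y) * h (U y)) \<in> borel_measurable borel"
        using measurable_compose[OF Um hm] .
      moreover have "indicator B (U y) = (indicator (T ` B) y :: real)" for y
        by (auto simp: imT split: split_indicator)
      ultimately show "(\<lambda>y. indicator (T ` B) y * \<bar>det (matrix (k' y))\<bar>) \<in> borel_measurable borel"
        by (simp add: h_def k'_def)
    qed
    also have "\<dots> = (\<integral>\<^sup>+y. ennreal (indicator B (U y) * h (U y)) \<partial>lborel)"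
      by (intro nn_integral_cong) (auto simp: imT h_def k'_def split: split_indicator)
    also have "\<dots> = (\<integral>\<^sup>+y. ennreal (indicator B (U y) * h (U y)) \<partial>distr lborel borel T)"
      by (simp add: distrT)
    also have "\<dots> = (\<integral>\<^sup>+x. ennreal (indicator B x * h x) \<partial>lborel)"
      using Tm measurable_compose[OF Um hm] by (subst nn_integral_distr) auto
    also have "\<dots> = (\<integral>\<^sup>+x\<in>B. ennreal (h x) \<partial>lborel)"
      by (intro nn_integral_cong) (auto split: split_indicator)
    finally show ?thesis .
  qed
  moreover have "\<forall>x. 0 \<le> h x"
    by (simp add: h_def)
  ultimately show ?thesis
    using conth by blast
qed

section \<open>Measures with continuous densities\<close>

lemma measurable_cont_indicator:
  fixes f :: "'a::topological_space \<Rightarrow> real"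
  assumes "S \<in> sets borel" "continuous_on S f"
  shows "(\<lambda>x. ennreal (f x) * indicator S x) \<in> borel_measurable borel"
proof -
  have "(\<lambda>x. ennreal (indicator S x *\<^sub>R f x)) \<in> borel_measurable borel"
    using borel_measurable_continuous_on_indicator[OF assms] by measurable
  also have "(\<lambda>x. ennreal (indicator S x *\<^sub>R f x)) = (\<lambda>x. ennreal (f x) * indicator S x)"
    by (intro ext) (auto split: split_indicator)
  finally show ?thesis .
qed

lemma homeomorphism_image_borel:
  assumes "homeomorphism S T f g" "T \<in> sets borel" "B \<in> sets borel" "B \<subseteq> S"
  shows "f ` B \<in> sets borel"
proof -
  have "g \<in> borel_measurable (restrict_space borel T)"
    using assms(1) by (intro borel_measurable_continuous_on_restrict) (simp add: homeomorphism_def)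
  from measurable_sets[OF this \<open>B \<in> sets borel\<close>] have "g -` B \<inter> T \<in> sets borel"
    using assms(2) by (auto simp: sets_restrict_space_iff space_restrict_space)
  also have "g -` B \<inter> T = f ` B"
    using assms(1,4) by (force simp: homeomorphism_def)
  finally show ?thesis .
qed

text \<open>
  The hypothesis \<open>eq\<close> says that \<open>f\<close> carries the measure with density \<open>w\<close> on \<open>S\<close> to the measure \<open>M\<close> on
  \<open>f ` S\<close>, so the claim is the transformation rule for integrals under an image measure.
  It is applied both to coordinate maps and to diffeomorphisms expressed in coordinates.
\<close>

lemma nn_integral_injective_image:
  fixes f :: "'a::topological_space \<Rightarrow> 'b::topological_space" and w u :: "_ \<Rightarrow> ennreal"
  assumes M: "sets M = sets borel" and N: "sets N = sets borel"
    and S: "S \<in> sets borel" and f: "continuous_on S f" "inj_on f S"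
    and im: "\<And>B. B \<in> sets borel \<Longrightarrow> B \<subseteq> S \<Longrightarrow> f ` B \<in> sets borel"
    and w: "(\<lambda>x. w x * indicator S x) \<in> borel_measurable borel"
    and u: "(\<lambda>y. u y * indicator (f ` S) y) \<in> borel_measurable borel"
    and eq: "\<And>B. B \<in> sets borel \<Longrightarrow> B \<subseteq> S \<Longrightarrow> emeasure M (f ` B) = (\<integral>\<^sup>+x\<in>B. w x \<partial>N)"
    and B: "B \<in> sets borel" "B \<subseteq> S"
  shows "(\<integral>\<^sup>+y\<in>f ` B. u y \<partial>M) = (\<integral>\<^sup>+x\<in>B. u (f x) * w x \<partial>N)"
proof -
  (* An everywhere defined measurable map is needed for forming the image measure. *)
  define F where "F x = (if x \<in> S then f x else undefined)" for x
  have F: "F \<in> borel_measurable borel"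
    unfolding F_def using f S
    by (subst measurable_restrict_space_iff[symmetric]) (auto intro: borel_measurable_continuous_on_restrict)
  have FB: "F ` C = f ` C" if "C \<subseteq> S" for C
    using that by (auto simp: F_def)
  have F': "F \<in> measurable N borel"
    using F by (simp only: measurable_cong_sets[OF N refl])
  have w': "(\<lambda>x. w x * indicator C x) \<in> borel_measurable N" if "C \<in> sets borel" "C \<subseteq> S" for C
  proof -
    have "(\<lambda>x. w x * indicator S x * indicator C x) \<in> borel_measurable borel"
      using w that by measurable
    also have "(\<lambda>x. w x * indicator S x * indicator C x) = (\<lambda>x. w x * indicator C x)"
      using that by (intro ext) (auto split: split_indicator)
    finally show ?thesis
      by (simp only: measurable_cong_sets[OF N refl])
  qed
  have indfB: "f ` B \<in> sets M"
    using im B M by simp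
  have "distr (density N (\<lambda>x. w x * indicator B x)) borel F = density M (indicator (f ` B))"
  proof (rule measure_eqI)
    fix C assume "C \<in> sets (distr (density N (\<lambda>x. w x * indicator B x)) borel F)"
    then have C: "C \<in> sets borel"
      by simp
    have BC: "F -` C \<inter> B \<in> sets borel"
      using measurable_sets[OF F C] B by auto
    have fBC: "f ` (F -` C \<inter> B) = f ` B \<inter> C"
      using B by (auto simp: F_def)
    have "emeasure (distr (density N (\<lambda>x. w x * indicator B x)) borel F) C =
        emeasure (density N (\<lambda>x. w x * indicator B x)) (F -` C \<inter> space N)"
      using F' C by (simp add: emeasure_distr)
    also have "\<dots> = (\<integral>\<^sup>+x. w x * indicator B x * indicator (F -` C \<inter> space N) x \<partial>N)"
      using w'[OF B] measurable_sets[OF F' C] by (simp add: emeasure_density)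
    also have "\<dots> = (\<integral>\<^sup>+x\<in>F -` C \<inter> B. w x \<partial>N)"
      by (intro nn_integral_cong) (auto split: split_indicator)
    also have "\<dots> = emeasure M (f ` B \<inter> C)"
      using eq[OF BC] B unfolding fBC by (simp add: le_infI2)
    also have "\<dots> = emeasure (density M (indicator (f ` B))) C"
      using C indfB M
      by (subst emeasure_density) (auto simp: indicator_inter_arith[symmetric])
    finally show "emeasure (distr (density N (\<lambda>x. w x * indicator B x)) borel F) C =
      emeasure (density M (indicator (f ` B))) C" .
  qed (simp add: M)
  note D = this
  define v where "v y = u y * indicator (f ` S) y" for y
  have v: "v \<in> borel_measurable borel"
    using u by (simp add: v_def[abs_def])
  have "(\<integral>\<^sup>+y\<in>f ` B. u y \<partial>M) = (\<integral>\<^sup>+y. indicator (f ` B) y * v y \<partial>M)"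
    using B by (intro nn_integral_cong) (auto simp: v_def split: split_indicator)
  also have "\<dots> = integral\<^sup>N (density M (indicator (f ` B))) v"
    by (intro nn_integral_density[symmetric] borel_measurable_indicator indfB)
      (simp only: measurable_cong_sets[OF M refl] v)
  also have "\<dots> = integral\<^sup>N (density N (\<lambda>x. w x * indicator B x)) (\<lambda>x. v (F x))"
    unfolding D[symmetric] using v F' by (intro nn_integral_distr) auto
  also have "\<dots> = (\<integral>\<^sup>+x. w x * indicator B x * v (F x) \<partial>N)"
    using v F' w'[OF B] by (intro nn_integral_density) auto
  also have "\<dots> = (\<integral>\<^sup>+x\<in>B. u (f x) * w x \<partial>N)"
    using B by (intro nn_integral_cong) (auto simp: v_def F_def mult.commute split: split_indicator)
  finally show ?thesis .
qed

lemma countable_open_subcover: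
  fixes U :: "'a::second_countable_topology \<Rightarrow> 'a set"
  assumes "\<And>x. open (U x)" "\<And>x. x \<in> U x"
  shows "\<exists>V :: nat \<Rightarrow> 'a set. range V \<subseteq> range U \<and> (\<Union>i. V i) = UNIV"
proof -
  obtain F where F: "F \<subseteq> range U" "countable F" "\<Union>F = \<Union>(range U)"
    using Lindelof[of "range U"] assms by auto
  have "\<Union>F = UNIV"
    using F assms by auto
  then have "F \<noteq> {}"
    by auto
  then have "range (from_nat_into F) = F"
    using F by (simp add: range_from_nat_into)
  with F \<open>\<Union>F = UNIV\<close> show ?thesis
    by (intro exI[of _ "from_nat_into F"]) auto
qed

text \<open>
  By the Lindelof property countably many of the given neighbourhoods cover the space;
  cutting a Borel set along the disjointed cover reduces the claim to small sets.
\<close>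

lemma measure_eqI_locally:
  fixes M N :: "'a::second_countable_topology measure"
  assumes M: "sets M = sets borel" and N: "sets N = sets borel"
    and loc: "\<And>x. \<exists>U. open U \<and> x \<in> U \<and> (\<forall>B\<in>sets borel. B \<subseteq> U \<longrightarrow> emeasure M B = emeasure N B)"
  shows "M = N"
proof (rule measure_eqI)
  have "\<forall>x. \<exists>U. open U \<and> x \<in> U \<and> (\<forall>B\<in>sets borel. B \<subseteq> U \<longrightarrow> emeasure M B = emeasure N B)"
    using loc by blast
  from choice[OF this] obtain U where U: "\<And>x. open (U x)" "\<And>x. x \<in> U x"
    "\<And>x B. B \<in> sets borel \<Longrightarrow> B \<subseteq> U x \<Longrightarrow> emeasure M B = emeasure N B"
    by blast
  obtain V :: "nat \<Rightarrow> 'a set" where V: "range V \<subseteq> range U" "(\<Union>i. V i) = UNIV"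
    using countable_open_subcover[of U] U by auto
  have Vb: "V i \<in> sets borel" for i
  proof -
    obtain x where "V i = U x"
      using V(1) by auto
    then show ?thesis
      using U(1) by simp
  qed
  then have Db: "disjointed V i \<in> sets borel" for i
    using sets.range_disjointed_sets[of V borel] by auto
  fix B assume "B \<in> sets M"
  then have B: "B \<in> sets borel"
    using M by simp
  have decomp: "emeasure K B = (\<Sum>i. emeasure K (B \<inter> disjointed V i))" if "sets K = sets borel" for K
  proof -
    have "disjoint_family (\<lambda>i. B \<inter> disjointed V i)"
      using disjoint_family_disjointed[of V] unfolding disjoint_family_on_def by blast
    then have "(\<Sum>i. emeasure K (B \<inter> disjointed V i)) = emeasure K (\<Union>i. B \<inter> disjointed V i)"
      using B Db that by (intro suminf_emeasure) auto
    also have "(\<Union>i. B \<inter> disjointed V i) = B"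
      using V(2) UN_disjointed_eq[of V] by auto
    finally show ?thesis ..
  qed
  have "emeasure M (B \<inter> disjointed V i) = emeasure N (B \<inter> disjointed V i)" for i
  proof -
    obtain x where "V i = U x"
      using V(1) by auto
    then have "B \<inter> disjointed V i \<subseteq> U x"
      using disjointed_subset[of V i] by auto
    then show ?thesis
      using U(3)[of "B \<inter> disjointed V i" x] B Db by auto
  qed
  then show "emeasure M B = emeasure N B"
    by (simp only: decomp[OF M] decomp[OF N])
qed (simp add: M N)

text \<open>
  Positivity on nonempty open sets turns almost everywhere equality of continuous functions into
  equality, which makes continuous densities unique and allows local ones to be glued.
\<close>

locale full_support_measure = sigma_finite_measure m
  for m :: "'a::{t2_space, second_countable_topology} measure" +
  assumes sets_m [simp, measurable_cong]: "sets m = sets borel"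
    and full_support: "\<And>V. open V \<Longrightarrow> V \<noteq> {} \<Longrightarrow> emeasure m V \<noteq> 0"
begin

lemma space_m [simp]: "space m = UNIV"
  using sets_eq_imp_space_eq[OF sets_m] by simp

text \<open>
  The set where the two densities differ is open in \<open>U\<close> and null, hence empty.
\<close>

lemma continuous_densities_eq:
  fixes j1 j2 :: "'a \<Rightarrow> real"
  assumes U: "open U" and c1: "continuous_on U j1" and c2: "continuous_on U j2"
    and nn: "\<And>x. x \<in> U \<Longrightarrow> 0 \<le> j1 x" "\<And>x. x \<in> U \<Longrightarrow> 0 \<le> j2 x"
    and eq: "\<And>B. B \<in> sets borel \<Longrightarrow> B \<subseteq> U \<Longrightarrow>
      (\<integral>\<^sup>+x\<in>B. ennreal (j1 x) \<partial>m) = (\<integral>\<^sup>+x\<in>B. ennreal (j2 x) \<partial>m)"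
    and x: "x \<in> U"
  shows "j1 x = j2 x"
proof -
  have Ub: "U \<in> sets borel"
    using U by simp
  have meas: "(\<lambda>x. ennreal (j x) * indicator U x) \<in> borel_measurable m" if "continuous_on U j" for j
    using measurable_cont_indicator[OF Ub that] by simp
  have "density m (\<lambda>x. ennreal (j1 x) * indicator U x) = density m (\<lambda>x. ennreal (j2 x) * indicator U x)"
  proof (rule measure_eqI)
    fix B assume "B \<in> sets (density m (\<lambda>x. ennreal (j1 x) * indicator U x))"
    then have B: "B \<in> sets borel"
      by simp
    have *: "emeasure (density m (\<lambda>x. ennreal (j x) * indicator U x)) B =
        (\<integral>\<^sup>+x\<in>B \<inter> U. ennreal (j x) \<partial>m)" if "continuous_on U j" for j
      using meas[OF that] B
      by (simp add: emeasure_density) (intro nn_integral_cong, auto split: split_indicator)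
    show "emeasure (density m (\<lambda>x. ennreal (j1 x) * indicator U x)) B =
        emeasure (density m (\<lambda>x. ennreal (j2 x) * indicator U x)) B"
      using eq[of "B \<inter> U"] B Ub by (simp add: * c1 c2)
  qed simp
  then have "AE x in m. ennreal (j1 x) * indicator U x = ennreal (j2 x) * indicator U x"
    by (subst (asm) density_unique_iff) (auto intro: meas c1 c2)
  then have ae: "AE x in m. x \<notin> U \<inter> (\<lambda>x. j1 x - j2 x) -` (- {0})"
    by eventually_elim (use nn in \<open>auto split: split_indicator_asm\<close>)
  have op: "open (U \<inter> (\<lambda>x. j1 x - j2 x) -` (- {0}))"
    using U c1 c2 by (intro continuous_open_preimage continuous_intros) auto
  then have "emeasure m (U \<inter> (\<lambda>x. j1 x - j2 x) -` (- {0})) = 0"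
    using ae by (subst (asm) AE_iff_measurable[where N="U \<inter> (\<lambda>x. j1 x - j2 x) -` (- {0})"]) auto
  then have "U \<inter> (\<lambda>x. j1 x - j2 x) -` (- {0}) = {}"
    using full_support[OF op] by blast
  with x show ?thesis
    by auto
qed

text \<open>
  On overlaps the local densities agree by uniqueness, so evaluating at each point the density that
  belongs to the neighbourhood chosen for this point gives a continuous function.
\<close>

lemma glue_continuous_densities:
  assumes N: "sets N = sets borel"
    and loc: "\<And>x. \<exists>U j. open U \<and> x \<in> U \<and> continuous_on U j \<and> (\<forall>y. 0 \<le> j y) \<and>
      (\<forall>B\<in>sets borel. B \<subseteq> U \<longrightarrow> emeasure N B = (\<integral>\<^sup>+y\<in>B. ennreal (j y) \<partial>m))"
  shows "\<exists>J. continuous_on UNIV J \<and> (\<forall>x. 0 \<le> J x) \<and> N = density m (\<lambda>x. ennreal (J x))"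
proof -
  have "\<forall>x. \<exists>p. open (fst p) \<and> x \<in> fst p \<and> continuous_on (fst p) (snd p) \<and> (\<forall>y. 0 \<le> snd p y) \<and>
      (\<forall>B\<in>sets borel. B \<subseteq> fst p \<longrightarrow> emeasure N B = (\<integral>\<^sup>+y\<in>B. ennreal (snd p y) \<partial>m))"
    using loc by simp
  from choice[OF this] obtain p where p: "\<forall>x. open (fst (p x)) \<and> x \<in> fst (p x) \<and>
      continuous_on (fst (p x)) (snd (p x)) \<and> (\<forall>y. 0 \<le> snd (p x) y) \<and>
      (\<forall>B\<in>sets borel. B \<subseteq> fst (p x) \<longrightarrow> emeasure N B = (\<integral>\<^sup>+y\<in>B. ennreal (snd (p x) y) \<partial>m))"
    by blast
  define U j where "U x = fst (p x)" and "j x = snd (p x)" for x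
  have U: "\<And>x. open (U x)" "\<And>x. x \<in> U x" and j: "\<And>x. continuous_on (U x) (j x)"
    "\<And>x y. 0 \<le> j x y"
    and eq: "\<And>x B. B \<in> sets borel \<Longrightarrow> B \<subseteq> U x \<Longrightarrow> emeasure N B = (\<integral>\<^sup>+y\<in>B. ennreal (j x y) \<partial>m)"
    using p unfolding U_def j_def by blast+
  define J where "J x = j x x" for x
  have J: "J y = j x y" if "y \<in> U x" for x y
    unfolding J_def
  proof (rule continuous_densities_eq[of "U x \<inter> U y" "j y" "j x"])
    show "(\<integral>\<^sup>+z\<in>B. ennreal (j y z) \<partial>m) = (\<integral>\<^sup>+z\<in>B. ennreal (j x z) \<partial>m)"
      if "B \<in> sets borel" "B \<subseteq> U x \<inter> U y" for B
      using eq[of B x] eq[of B y] that by simp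
  qed (use U j that in \<open>auto intro: continuous_on_subset\<close>)
  have "isCont J x" for x
  proof -
    have "continuous_on (U x) J"
      using j(1)[of x] J by (subst continuous_on_cong[OF refl J]) auto
    then show ?thesis
      using U by (simp add: continuous_on_eq_continuous_at)
  qed
  then have contJ: "continuous_on UNIV J"
    by (simp add: continuous_at_imp_continuous_on)
  then have Jm: "J \<in> borel_measurable borel"
    by (rule borel_measurable_continuous_onI)
  have "N = density m (\<lambda>x. ennreal (J x))"
  proof (rule measure_eqI_locally)
    fix x
    show "\<exists>U. open U \<and> x \<in> U \<and>
      (\<forall>B\<in>sets borel. B \<subseteq> U \<longrightarrow> emeasure N B = emeasure (density m (\<lambda>x. ennreal (J x))) B)"
    proof (intro exI[of _ "U x"] conjI ballI impI)
      fix B assume B: "B \<in> sets borel" "B \<subseteq> U x"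
      have "emeasure (density m (\<lambda>x. ennreal (J x))) B = (\<integral>\<^sup>+y\<in>B. ennreal (J y) \<partial>m)"
        using Jm B by (subst emeasure_density) auto
      also have "\<dots> = (\<integral>\<^sup>+y\<in>B. ennreal (j x y) \<partial>m)"
        using B J by (intro nn_integral_cong) (auto split: split_indicator)
      finally show "emeasure N B = emeasure (density m (\<lambda>x. ennreal (J x))) B"
        using eq[OF B] by simp
    qed (use U in auto)
  qed (simp_all add: N)
  with contJ j(2) show ?thesis
    unfolding J_def[abs_def] by (intro exI[of _ "\<lambda>x. j x x"]) (auto simp: J_def[abs_def])
qed

lemma J_density_eq:
  assumes "continuous_on UNIV J" "\<And>x. 0 \<le> J x" "distr m borel \<psi> = density m (\<lambda>x. ennreal (J x))"
  shows "J_density m \<psi> = J"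
  unfolding J_density_def
proof (rule the_equality)
  fix J' assume J': "continuous_on UNIV J' \<and> (\<forall>x. 0 \<le> J' x) \<and> distr m borel \<psi> = density m (\<lambda>x. ennreal (J' x))"
  show "J' = J"
  proof
    fix x
    have m': "J' \<in> borel_measurable m" "J \<in> borel_measurable m"
      unfolding measurable_cong_sets[OF sets_m refl]
      using J' assms(1) by (auto intro: borel_measurable_continuous_onI)
    have e: "(\<integral>\<^sup>+x\<in>B. ennreal (J' x) \<partial>m) = (\<integral>\<^sup>+x\<in>B. ennreal (J x) \<partial>m)" if "B \<in> sets borel" for B
    proof -
      have "(\<integral>\<^sup>+x\<in>B. ennreal (J' x) \<partial>m) = emeasure (density m (\<lambda>x. ennreal (J' x))) B"
        using m' that by (subst emeasure_density) auto
      also have "\<dots> = emeasure (density m (\<lambda>x. ennreal (J x))) B"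
        using J' assms(3) by simp
      also have "\<dots> = (\<integral>\<^sup>+x\<in>B. ennreal (J x) \<partial>m)"
        using m' that by (subst emeasure_density) auto
      finally show ?thesis .
    qed
    show "J' x = J x"
      by (rule continuous_densities_eq[of UNIV]) (use J' assms e in auto)
  qed
qed (use assms in auto)

end

section \<open>The Riemannian volume and its images under diffeomorphisms\<close>

text \<open>
  The segment from the identity to \<open>M\<close> consists of positive definite, hence invertible, matrices.
  So the determinant does not vanish along it, and at the identity it is 1.
\<close>

lemma det_pos_of_positive_definite:
  fixes M :: "real^'n::finite^'n"
  assumes pd: "\<And>v. v \<noteq> 0 \<Longrightarrow> v \<bullet> (M *v v) > 0"
  shows "det M > 0"
proof (rule ccontr)
  assume neg: "\<not> det M > 0"
  define H where "H t = (1 - t) *\<^sub>R mat 1 + t *\<^sub>R M" for t :: real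
  have nz: "det (H t) \<noteq> 0" if "0 \<le> t" "t \<le> 1" for t
  proof -
    have "v = 0" if "H t *v v = 0" for v
    proof (rule ccontr)
      assume "v \<noteq> 0"
      have "H t *v v = (1 - t) *\<^sub>R v + t *\<^sub>R (M *v v)"
        by (simp add: H_def matrix_vector_mult_add_rdistrib scaleR_matrix_vector_assoc[symmetric])
      then have "0 = (1 - t) * (v \<bullet> v) + t * (v \<bullet> (M *v v))"
        using that by (metis inner_add_right inner_scaleR_right inner_zero_right)
      moreover have "(1 - t) * (v \<bullet> v) + t * (v \<bullet> (M *v v)) > 0"
      proof (cases "t = 0")
        case False
        then have "t * (v \<bullet> (M *v v)) > 0"
          using pd[OF \<open>v \<noteq> 0\<close>] \<open>0 \<le> t\<close> by simp
        then show ?thesis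
          using \<open>t \<le> 1\<close> by (simp add: add_nonneg_pos)
      qed (use \<open>v \<noteq> 0\<close> in simp)
      ultimately show False by simp
    qed
    then have "invertible (H t)"
      unfolding invertible_left_inverse matrix_left_invertible_ker by blast
    then show ?thesis
      by (simp add: invertible_det_nz)
  qed
  have "continuous_on {0..1} (\<lambda>t. det (H t))"
    unfolding H_def by (intro continuous_on_det) (auto intro!: continuous_intros)
  moreover have "det (H 0) = 1" "det (H 1) = det M"
    by (simp_all add: H_def)
  ultimately have "\<exists>t\<ge>0. t \<le> 1 \<and> det (H t) = 0"
    using IVT2'[of "\<lambda>t. det (H t)" 1 0 0] neg by auto
  then show False
    using nz by blast
qed

lemma open_lborel_pos:
  fixes S :: "'a::euclidean_space set"
  assumes "open S" "S \<noteq> {}"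
  shows "emeasure lborel S \<noteq> 0"
proof
  assume "emeasure lborel S = 0"
  then have "S \<in> null_sets lborel"
    using assms(1) by auto
  then have "negligible S"
    by (simp add: negligible_iff_null_sets null_sets_completionI)
  then show False
    using open_not_negligible assms by blast
qed

lemma smooth_on_derivative:
  assumes "smooth_on S f"
  shows "\<And>x. x \<in> S \<Longrightarrow> (f has_derivative frechet_derivative f (at x)) (at x)"
    and "\<And>v. continuous_on S (\<lambda>x. frechet_derivative f (at x) v)"
  using assms[unfolded smooth_on_def, rule_format, of "Suc 0"] by (auto simp: frechet_derivative_works)

lemma smooth_on_continuous: "smooth_on S f \<Longrightarrow> continuous_on S f"
  unfolding smooth_on_def by (metis Ck_on.simps(1))

locale riemannian_manifold =
  fixes A :: "('a::{t2_space, second_countable_topology}, 'n::finite) chart set"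
    and G :: "('a, 'n) chart \<Rightarrow> real^'n \<Rightarrow> real^'n^'n"
    and m :: "'a measure"
  assumes atlas: "oriented_smooth_atlas A"
    and metric: "riemannian_metric A G"
    and volume: "riemannian_volume A G m"
begin

lemma vol_sets: "sets m = sets borel"
  using volume by (simp add: riemannian_volume_def)

lemma chart_at: "\<exists>c\<in>A. x \<in> cdom c"
  using atlas unfolding oriented_smooth_atlas_def by blast

context
  fixes c assumes c: "c \<in> A"
begin

lemma chart_open: "open (cdom c)" "open (crd c ` cdom c)"
  and chart_homeo: "homeomorphism (cdom c) (crd c ` cdom c) (crd c) (cinv c)"
  using atlas c unfolding oriented_smooth_atlas_def is_chart_def by blast+

lemma cinv_crd: "x \<in> cdom c \<Longrightarrow> cinv c (crd c x) = x"
  and crd_cinv: "y \<in> crd c ` cdom c \<Longrightarrow> crd c (cinv c y) = y"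
  and cinv_in: "y \<in> crd c ` cdom c \<Longrightarrow> cinv c y \<in> cdom c"
  and cont_crd: "continuous_on (cdom c) (crd c)"
  and cont_cinv: "continuous_on (crd c ` cdom c) (cinv c)"
  using chart_homeo unfolding homeomorphism_def by auto

lemma crd_borel: "B \<in> sets borel \<Longrightarrow> B \<subseteq> cdom c \<Longrightarrow> crd c ` B \<in> sets borel"
  by (rule homeomorphism_image_borel[OF chart_homeo]) (use chart_open in auto)

lemma cinv_borel: "B \<in> sets borel \<Longrightarrow> B \<subseteq> crd c ` cdom c \<Longrightarrow> cinv c ` B \<in> sets borel"
  by (rule homeomorphism_image_borel[OF homeomorphism_sym[THEN iffD1, OF chart_homeo]])
    (use chart_open in auto)

lemma crd_cinv_image: "B \<subseteq> crd c ` cdom c \<Longrightarrow> crd c ` cinv c ` B = B"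
  using crd_cinv by (force simp: image_image)

lemma cinv_crd_image: "B \<subseteq> cdom c \<Longrightarrow> cinv c ` crd c ` B = B"
  using cinv_crd by (force simp: image_image)

lemma crd_open: "open V \<Longrightarrow> V \<subseteq> cdom c \<Longrightarrow> open (crd c ` V)"
proof -
  assume V: "open V" "V \<subseteq> cdom c"
  have "crd c ` V = crd c ` cdom c \<inter> cinv c -` V"
    using V(2) cinv_crd crd_cinv by (auto intro: rev_image_eqI)
  then show ?thesis
    using continuous_open_preimage[OF cont_cinv chart_open(2) V(1)] by simp
qed

lemma cinv_open: "open V \<Longrightarrow> V \<subseteq> crd c ` cdom c \<Longrightarrow> open (cinv c ` V)"
proof -
  assume V: "open V" "V \<subseteq> crd c ` cdom c"
  have "cinv c ` V = cdom c \<inter> crd c -` V"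
    using V(2) cinv_crd crd_cinv cinv_in by (auto intro: rev_image_eqI)
  then show ?thesis
    using continuous_open_preimage[OF cont_crd chart_open(1) V(1)] by simp
qed

definition vol_density :: "real^'n \<Rightarrow> real" where
  "vol_density y = sqrt (det (G c y))"

lemma vol_density_pos: "y \<in> crd c ` cdom c \<Longrightarrow> vol_density y > 0"
  unfolding vol_density_def using metric c
  by (auto simp: riemannian_metric_def intro!: det_pos_of_positive_definite)

lemma vol_density_cont: "continuous_on (crd c ` cdom c) vol_density"
proof -
  have "continuous_on (crd c ` cdom c) (G c)"
    using metric c by (auto simp: riemannian_metric_def intro: smooth_on_continuous)
  then show ?thesis
    unfolding vol_density_def
    by (intro continuous_intros continuous_on_det continuous_on_component)
qed

lemma vol_chart:
  assumes "B \<in> sets borel" "B \<subseteq> cdom c"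
  shows "emeasure m B = (\<integral>\<^sup>+y\<in>crd c ` B. ennreal (vol_density y) \<partial>lborel)"
  using volume c assms unfolding riemannian_volume_def vol_density_def by blast

lemma vol_nn_integral:
  assumes B: "B \<in> sets borel" "B \<subseteq> cdom c"
    and u: "(\<lambda>x. u x * indicator B x) \<in> borel_measurable borel"
  shows "(\<integral>\<^sup>+x\<in>B. u x \<partial>m) = (\<integral>\<^sup>+y\<in>crd c ` B. u (cinv c y) * ennreal (vol_density y) \<partial>lborel)"
proof -
  have sub: "crd c ` B \<subseteq> crd c ` cdom c"
    using B by auto
  have "(\<integral>\<^sup>+x\<in>cinv c ` (crd c ` B). u x \<partial>m) =
      (\<integral>\<^sup>+y\<in>crd c ` B. u (cinv c y) * ennreal (vol_density y) \<partial>lborel)"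
  proof (rule nn_integral_injective_image[where S = "crd c ` B"])
    show "inj_on (cinv c) (crd c ` B)"
      by (rule inj_on_inverseI[where g = "crd c"]) (use sub crd_cinv in auto)
    show "continuous_on (crd c ` B) (cinv c)"
      by (rule continuous_on_subset[OF cont_cinv sub])
    show "(\<lambda>y. u y * indicator (cinv c ` crd c ` B) y) \<in> borel_measurable borel"
      unfolding cinv_crd_image[OF B(2)] by (rule u)
    show "emeasure m (cinv c ` C) = (\<integral>\<^sup>+y\<in>C. ennreal (vol_density y) \<partial>lborel)"
      if C: "C \<in> sets borel" "C \<subseteq> crd c ` B" for C
    proof -
      have C': "C \<subseteq> crd c ` cdom c"
        using C sub by auto
      then have "cinv c ` C \<subseteq> cdom c"
        using cinv_in by auto
      from vol_chart[OF cinv_borel[OF C(1) C'] this] show ?thesis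
        by (simp only: crd_cinv_image[OF C'])
    qed
    show "(\<lambda>x. ennreal (vol_density x) * indicator (crd c ` B) x) \<in> borel_measurable borel"
      using crd_borel[OF B] continuous_on_subset[OF vol_density_cont sub] by (rule measurable_cont_indicator)
    show "cinv c ` C \<in> sets borel" if "C \<in> sets borel" "C \<subseteq> crd c ` B" for C
      using that sub by (intro cinv_borel) auto
  qed (use crd_borel[OF B] in \<open>auto simp: vol_sets\<close>)
  then show ?thesis
    by (simp only: cinv_crd_image[OF B(2)])
qed

end

text \<open>
  The preimage of a small coordinate ball, on whose compact closure the volume density is bounded.
\<close>

lemma finite_relatively_compact_nbhd: "\<exists>U. open U \<and> x \<in> U \<and> compact (closure U) \<and> emeasure m U < \<infinity>"
proof -
  obtain c where c: "c \<in> A" "x \<in> cdom c"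
    using chart_at by blast
  then obtain e where e: "e > 0" "cball (crd c x) e \<subseteq> crd c ` cdom c"
    using chart_open(2)[OF c(1)] by (meson imageI open_contains_cball)
  let ?b = "ball (crd c x) e" and ?K = "cball (crd c x) e"
  let ?U = "cinv c ` ?b"
  have sub: "?b \<subseteq> crd c ` cdom c"
    using e ball_subset_cball by blast
  have U: "open ?U"
    by (rule cinv_open[OF c(1) _ sub]) simp
  have "x \<in> ?U"
    using e cinv_crd[OF c] by (force intro: rev_image_eqI[of "crd c x"])
  have "compact (cinv c ` ?K)"
    by (intro compact_continuous_image continuous_on_subset[OF cont_cinv[OF c(1)] e(2)]) simp
  moreover have "closure ?U \<subseteq> cinv c ` ?K"
    using calculation by (intro closure_minimal image_mono ball_subset_cball compact_imp_closed)
  ultimately have "compact (closure ?U)"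
    using compact_Int_closed[of "cinv c ` ?K" "closure ?U"] by (simp add: inf.absorb2)
  have "?U \<subseteq> cdom c"
    using sub cinv_in[OF c(1)] by auto
  have "compact (vol_density c ` ?K)"
    by (intro compact_continuous_image continuous_on_subset[OF vol_density_cont[OF c(1)] e(2)]) simp
  then obtain C where C: "\<And>y. y \<in> ?K \<Longrightarrow> vol_density c y \<le> C"
    using bounded_imp_bdd_above compact_imp_bounded by (metis bdd_above.E imageI)
  have "emeasure m ?U = (\<integral>\<^sup>+y\<in>?b. ennreal (vol_density c y) \<partial>lborel)"
    using vol_chart[OF c(1) _ \<open>?U \<subseteq> cdom c\<close>] U by (simp add: crd_cinv_image[OF c(1) sub])
  also have "\<dots> \<le> (\<integral>\<^sup>+y. ennreal C * indicator ?b y \<partial>lborel)"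
    using C by (intro nn_integral_mono) (auto split: split_indicator intro: ennreal_leI)
  also have "\<dots> = ennreal C * emeasure lborel ?b"
    by (simp add: nn_integral_cmult_indicator)
  also have "\<dots> < \<infinity>"
    using emeasure_lborel_ball_finite[of "crd c x" e] by (auto simp: ennreal_mult_less_top)
  finally show ?thesis
    using U \<open>x \<in> ?U\<close> \<open>compact (closure ?U)\<close> by blast
qed

text \<open>
  Countably many neighbourhoods of finite volume cover the manifold.  A nonempty open set
  contains a nonempty open piece of a chart, on which a positive density is integrated.
\<close>

sublocale full_support_measure m
proof
  obtain U where U: "\<And>x. open (U x)" "\<And>x. x \<in> U x" "\<And>x. emeasure m (U x) < \<infinity>"
  proof -
    have "\<forall>x. \<exists>U. open U \<and> x \<in> U \<and> emeasure m U < \<infinity>"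
      using finite_relatively_compact_nbhd by blast
    from choice[OF this] show ?thesis
      using that by blast
  qed
  obtain V :: "nat \<Rightarrow> 'a set" where V: "range V \<subseteq> range U" "(\<Union>i. V i) = UNIV"
    using countable_open_subcover[of U] U by auto
  show "\<exists>A. countable A \<and> A \<subseteq> sets m \<and> \<Union>A = space m \<and> (\<forall>a\<in>A. emeasure m a \<noteq> \<infinity>)"
  proof (intro exI[of _ "range V"] conjI ballI)
    show "range V \<subseteq> sets m"
      using V U by (auto simp: vol_sets)
    show "\<Union>(range V) = space m"
      using V sets_eq_imp_space_eq[OF vol_sets] by simp
    show "emeasure m a \<noteq> \<infinity>" if "a \<in> range V" for a
      using V(1) U(3) that by (auto simp: less_top)
  qed simp
  show "sets m = sets borel"
    by (rule vol_sets)
  fix V :: "'a set" assume V: "open V" "V \<noteq> {}"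
  then obtain x c where xc: "x \<in> V" "c \<in> A" "x \<in> cdom c"
    using chart_at by blast
  let ?W = "V \<inter> cdom c"
  have W: "open ?W"
    using V chart_open[OF xc(2)] by auto
  have oW: "open (crd c ` ?W)"
    by (rule crd_open[OF xc(2) W]) simp
  show "emeasure m V \<noteq> 0"
  proof
    assume "emeasure m V = 0"
    then have "emeasure m ?W = 0"
      using emeasure_mono[of ?W V m] V by (simp add: vol_sets)
    then have "(\<integral>\<^sup>+y\<in>crd c ` ?W. ennreal (vol_density c y) \<partial>lborel) = 0"
      using vol_chart[OF xc(2), of ?W] W by simp
    moreover have "(\<lambda>y. ennreal (vol_density c y) * indicator (crd c ` ?W) y) \<in> borel_measurable borel"
      using oW by (intro measurable_cont_indicator continuous_on_subset[OF vol_density_cont[OF xc(2)]]) auto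
    ultimately have "AE y in lborel. ennreal (vol_density c y) * indicator (crd c ` ?W) y = 0"
      by (subst (asm) nn_integral_0_iff_AE) auto
    then have "AE y in lborel. y \<notin> crd c ` ?W"
    proof eventually_elim
      case (elim y)
      then show ?case
        using vol_density_pos[OF xc(2), of y] by (auto split: split_indicator_asm simp: ennreal_eq_0_iff)
    qed
    then have "emeasure lborel (crd c ` ?W) = 0"
      using oW by (subst (asm) AE_iff_measurable[where N = "crd c ` ?W"]) auto
    then show False
      using open_lborel_pos[OF oW] xc by auto
  qed
qed


text \<open>
  In charts around \<open>x\<close> and \<open>\<psi>\<^sup>-\<^sup>1 x\<close> the inverse of \<open>\<psi>\<close> becomes an injective smooth map \<open>F\<close>.  Writing \<open>v\<close>, \<open>v'\<close>
  for the coordinate densities of the volume in the two charts and \<open>h\<close> for the Jacobian factor of \<open>F\<close>,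
  the image volume has the density \<open>h * (v' o F) / v\<close>.
\<close>

lemma diffeomorphism_local_density:
  assumes "diffeomorphism A \<psi>"
  shows "\<exists>U j. open U \<and> x \<in> U \<and> continuous_on U j \<and> (\<forall>y. 0 \<le> j y) \<and>
    (\<forall>B\<in>sets borel. B \<subseteq> U \<longrightarrow> emeasure m (\<psi> -` B) = (\<integral>\<^sup>+y\<in>B. ennreal (j y) \<partial>m))"
proof -
  define \<phi> where "\<phi> = inv_into UNIV \<psi>"
  have bij: "bij \<psi>" and sm: "smooth_selfmap A \<phi>" and cont\<psi>: "continuous_on UNIV \<psi>"
    using assms by (auto simp: diffeomorphism_def smooth_selfmap_def \<phi>_def)
  have cont\<phi>: "continuous_on UNIV \<phi>"
    using sm by (simp add: smooth_selfmap_def)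
  have \<phi>\<psi>: "\<phi> (\<psi> y) = y" and \<psi>\<phi>: "\<psi> (\<phi> y) = y" for y
    using bij by (simp_all add: \<phi>_def bij_is_inj bij_is_surj surj_f_inv_f)
  have pre: "\<psi> -` B = \<phi> ` B" for B
    using \<phi>\<psi> \<psi>\<phi> by (auto intro: rev_image_eqI)
  have \<phi>borel: "\<phi> ` B \<in> sets borel" if "B \<in> sets borel" for B
    using measurable_sets_borel[OF borel_measurable_continuous_onI[OF cont\<psi>] that] by (simp add: pre)
  obtain c where c: "c \<in> A" "x \<in> cdom c"
    using chart_at by blast
  obtain c' where c': "c' \<in> A" "\<phi> x \<in> cdom c'"
    using chart_at by blast
  define U where "U = cdom c \<inter> \<phi> -` cdom c'"
  define W where "W = crd c ` U"
  define F where "F = crd c' \<circ> \<phi> \<circ> cinv c"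
  have Usub: "U \<subseteq> cdom c"
    by (simp add: U_def)
  have oU: "open U"
    unfolding U_def using chart_open[OF c(1)] chart_open[OF c'(1)] cont\<phi>
    by (intro open_Int) (simp_all add: open_vimage)
  have oW: "open W"
    unfolding W_def by (rule crd_open[OF c(1) oU Usub])
  have Wsub: "W \<subseteq> crd c ` cdom c"
    using Usub by (auto simp: W_def)
  have cinvW: "cinv c y \<in> U" if "y \<in> W" for y
    using that cinv_crd[OF c(1)] Usub by (auto simp: W_def)
  have smF: "smooth_on W F"
    using sm c c' unfolding smooth_selfmap_def W_def U_def F_def by blast
  have injF: "inj_on F W"
  proof (rule inj_onI)
    fix y z assume yz: "y \<in> W" "z \<in> W" "F y = F z"
    then have "\<phi> (cinv c y) = \<phi> (cinv c z)"
      using cinvW[OF yz(1)] cinvW[OF yz(2)] cinv_crd[OF c'(1)]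
      by (metis F_def Int_iff U_def comp_apply vimageD)
    then have "cinv c y = cinv c z"
      by (metis \<psi>\<phi>)
    then show "y = z"
      using crd_cinv[OF c(1)] Wsub yz by (metis subsetD)
  qed
  obtain h where h: "continuous_on W h" "\<And>x. 0 \<le> h x"
    "\<And>B. B \<in> sets borel \<Longrightarrow> B \<subseteq> W \<Longrightarrow> F ` B \<in> sets borel \<Longrightarrow>
       emeasure lborel (F ` B) = (\<integral>\<^sup>+x\<in>B. ennreal (h x) \<partial>lborel)"
    using emeasure_injective_image[OF oW smooth_on_derivative(1)[OF smF] smooth_on_derivative(2)[OF smF] injF]
    by blast
  have Fim: "F ` B = crd c' ` \<phi> ` cinv c ` B" for B
    by (simp add: F_def image_image)
  have \<phi>cinv: "\<phi> ` cinv c ` B \<subseteq> cdom c'" if "B \<subseteq> W" for B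
    using cinvW that by (auto simp: U_def)
  have Fborel: "F ` B \<in> sets borel" if "B \<in> sets borel" "B \<subseteq> W" for B
    unfolding Fim using that Wsub
    by (intro crd_borel[OF c'(1)] \<phi>borel cinv_borel[OF c(1)] \<phi>cinv) auto
  have Fin: "F y \<in> crd c' ` cdom c'" if "y \<in> W" for y
    using cinvW[OF that] by (auto simp: F_def U_def)
  have contF: "continuous_on W F"
    using smF by (rule smooth_on_continuous)
  define k where "k y = h y * vol_density c' (F y) / vol_density c y" for y
  have contk: "continuous_on W k"
    unfolding k_def using Fin Wsub
    by (intro continuous_intros h(1) continuous_on_compose2[OF vol_density_cont[OF c'(1)] contF]
          continuous_on_subset[OF vol_density_cont[OF c(1)]]) (auto dest!: vol_density_pos[OF c(1)] subsetD)
  define j where "j x = \<bar>k (crd c x)\<bar>" for x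
  have contj: "continuous_on U j"
    unfolding j_def
    by (intro continuous_intros continuous_on_compose2[OF contk continuous_on_subset[OF cont_crd[OF c(1)] Usub]])
      (simp add: W_def)
  have "emeasure m (\<psi> -` B) = (\<integral>\<^sup>+y\<in>B. ennreal (j y) \<partial>m)" if B: "B \<in> sets borel" "B \<subseteq> U" for B
  proof -
    have cB: "crd c ` B \<in> sets borel" "crd c ` B \<subseteq> W"
      using B Usub by (auto simp: W_def intro: crd_borel[OF c(1)])
    have BU: "B \<subseteq> cdom c"
      using B Usub by auto
    have FcB: "F ` crd c ` B = crd c' ` \<phi> ` B"
      by (simp only: Fim cinv_crd_image[OF c(1) BU])
    have "\<phi> ` B \<subseteq> cdom c'"
      using B by (auto simp: U_def)
    (* Chart at the preimage, then the transformation by F, then back to the manifold. *)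
    then have "emeasure m (\<psi> -` B) = (\<integral>\<^sup>+y\<in>F ` crd c ` B. ennreal (vol_density c' y) \<partial>lborel)"
      using vol_chart[OF c'(1) \<phi>borel[OF B(1)]] by (simp only: pre FcB)
    also have "\<dots> = (\<integral>\<^sup>+y\<in>crd c ` B. ennreal (vol_density c' (F y)) * ennreal (h y) \<partial>lborel)"
    proof (rule nn_integral_injective_image[where S = W])
      show "(\<lambda>x. ennreal (h x) * indicator W x) \<in> borel_measurable borel"
        using oW h(1) by (intro measurable_cont_indicator) auto
      show "(\<lambda>y. ennreal (vol_density c' y) * indicator (F ` W) y) \<in> borel_measurable borel"
        using Fborel[of W] oW Fin
        by (intro measurable_cont_indicator continuous_on_subset[OF vol_density_cont[OF c'(1)]]) auto
      show "emeasure lborel (F ` C) = (\<integral>\<^sup>+x\<in>C. ennreal (h x) \<partial>lborel)"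
        if "C \<in> sets borel" "C \<subseteq> W" for C
        by (rule h(3)[OF that Fborel[OF that]])
    qed (use oW contF injF Fborel cB in auto)
    also have "\<dots> = (\<integral>\<^sup>+y\<in>crd c ` B. ennreal (j (cinv c y)) * ennreal (vol_density c y) \<partial>lborel)"
    proof (intro nn_integral_cong)
      fix y
      show "ennreal (vol_density c' (F y)) * ennreal (h y) * indicator (crd c ` B) y =
        ennreal (j (cinv c y)) * ennreal (vol_density c y) * indicator (crd c ` B) y"
      proof (cases "y \<in> crd c ` B")
        case True
        then have y: "y \<in> W"
          using cB by auto
        then have pos: "vol_density c y > 0" "vol_density c' (F y) > 0" "crd c (cinv c y) = y"
          using Wsub Fin[OF y] vol_density_pos[OF c(1)] vol_density_pos[OF c'(1)] crd_cinv[OF c(1)] by auto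
        then have "j (cinv c y) * vol_density c y = vol_density c' (F y) * h y"
          using h(2)[of y] by (simp add: j_def k_def)
        then show ?thesis
          using pos h(2)[of y] by (simp add: ennreal_mult[symmetric] j_def)
      qed simp
    qed
    also have "\<dots> = (\<integral>\<^sup>+y\<in>B. ennreal (j y) \<partial>m)"
    proof (rule vol_nn_integral[OF c(1) B(1) BU, symmetric])
      show "(\<lambda>x. ennreal (j x) * indicator B x) \<in> borel_measurable borel"
        using B(1) continuous_on_subset[OF contj B(2)] by (rule measurable_cont_indicator)
    qed
    finally show ?thesis .
  qed
  moreover have "x \<in> U"
    using c c' by (simp add: U_def)
  moreover have "\<forall>y. 0 \<le> j y"
    by (simp add: j_def)
  ultimately show ?thesis
    using oU contj by blast
qed

lemma diffeomorphism_inverse: "diffeomorphism A \<psi> \<Longrightarrow> diffeomorphism A (inv_into UNIV \<psi>)"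
  by (simp add: diffeomorphism_def bij_imp_bij_inv inv_inv_eq)

context
  fixes \<psi> assumes \<psi>: "diffeomorphism A \<psi>"
begin

lemma diffeo_continuous: "continuous_on UNIV \<psi>" "continuous_on UNIV (inv_into UNIV \<psi>)"
  and diffeo_bij: "bij \<psi>"
  using \<psi> by (auto simp: diffeomorphism_def smooth_selfmap_def)

lemma diffeo_measurable: "\<psi> \<in> borel_measurable m"
  unfolding measurable_cong_sets[OF vol_sets refl]
  by (rule borel_measurable_continuous_onI[OF diffeo_continuous(1)])

text \<open>
  The local densities glue to a continuous one, so the definite description defining \<open>J_density\<close>
  denotes an actual density.
\<close>

lemma J_density:
  "continuous_on UNIV (J_density m \<psi>)" "0 \<le> J_density m \<psi> x"
  "distr m borel \<psi> = density m (\<lambda>x. ennreal (J_density m \<psi> x))"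
proof -
  have "\<exists>J. continuous_on UNIV J \<and> (\<forall>x. 0 \<le> J x) \<and> distr m borel \<psi> = density m (\<lambda>x. ennreal (J x))"
  proof (rule glue_continuous_densities)
    fix x
    have em: "emeasure (distr m borel \<psi>) B = emeasure m (\<psi> -` B)" if "B \<in> sets borel" for B
      using diffeo_measurable that by (simp add: emeasure_distr)
    show "\<exists>U j. open U \<and> x \<in> U \<and> continuous_on U j \<and> (\<forall>y. 0 \<le> j y) \<and>
      (\<forall>B\<in>sets borel. B \<subseteq> U \<longrightarrow> emeasure (distr m borel \<psi>) B = (\<integral>\<^sup>+y\<in>B. ennreal (j y) \<partial>m))"
      using diffeomorphism_local_density[OF \<psi>, of x] by (simp add: em)
  qed simp
  then obtain J where J: "continuous_on UNIV J" "\<And>x. 0 \<le> J x" "distr m borel \<psi> = density m (\<lambda>x. ennreal (J x))"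
    by blast
  then have "J_density m \<psi> = J"
    by (rule J_density_eq)
  with J show "continuous_on UNIV (J_density m \<psi>)" "0 \<le> J_density m \<psi> x"
    "distr m borel \<psi> = density m (\<lambda>x. ennreal (J_density m \<psi> x))"
    by auto
qed

lemma J_density_measurable: "J_density m \<psi> \<in> borel_measurable borel"
  by (rule borel_measurable_continuous_onI[OF J_density(1)])

lemma J_density_emeasure:
  assumes "B \<in> sets borel"
  shows "emeasure m (\<psi> -` B) = (\<integral>\<^sup>+x\<in>B. ennreal (J_density m \<psi> x) \<partial>m)"
proof -
  have "emeasure m (\<psi> -` B) = emeasure (distr m borel \<psi>) B"
    using diffeo_measurable assms by (simp add: emeasure_distr)
  also have "\<dots> = (\<integral>\<^sup>+x\<in>B. ennreal (J_density m \<psi> x) \<partial>m)"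
    unfolding J_density(3) using J_density_measurable assms by (subst emeasure_density) auto
  finally show ?thesis .
qed

text \<open>
  Sets disjoint from \<open>K\<close> are their own preimages, so the constant 1 is a continuous density there.
  The identity holds at every point off \<open>K\<close>, which is what makes products over
  infinite configurations finite.
\<close>

lemma J_density_eq_1:
  assumes K: "compact K" "\<And>x. x \<notin> K \<Longrightarrow> \<psi> x = x" and x: "x \<notin> K"
  shows "J_density m \<psi> x = 1"
proof (rule continuous_densities_eq[of "- K" _ "\<lambda>_. 1"])
  show "open (- K)"
    using K(1) compact_imp_closed by auto
  show "continuous_on (- K) (J_density m \<psi>)"
    using J_density(1) by (rule continuous_on_subset) simp
  show "(\<integral>\<^sup>+x\<in>B. ennreal (J_density m \<psi> x) \<partial>m) = (\<integral>\<^sup>+x\<in>B. ennreal 1 \<partial>m)"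
    if B: "B \<in> sets borel" "B \<subseteq> - K" for B
  proof -
    have "\<psi> -` B = B"
    proof (intro equalityI subsetI)
      fix y assume "y \<in> \<psi> -` B"
      then have y: "\<psi> y \<in> B"
        by simp
      then have "\<psi> (\<psi> y) = \<psi> y"
        using B K(2) by auto
      then have "\<psi> y = y"
        using diffeo_bij by (simp add: bij_is_inj inj_eq)
      with y show "y \<in> B"
        by simp
    next
      fix y assume "y \<in> B"
      then show "y \<in> \<psi> -` B"
        using B(2) K(2)[of y] by auto
    qed
    then show ?thesis
      using J_density_emeasure[OF B(1)] B(1) by simp
  qed
qed (use x J_density(2) in auto)

end

text \<open>
  The zero set of the density has a null preimage; the inverse diffeomorphism has a density as well
  and therefore maps this null set back to a null set.
\<close>

lemma J_density_AE_pos: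
  assumes \<psi>: "diffeomorphism A \<psi>"
  shows "AE x in m. J_density m \<psi> x > 0"
proof -
  let ?N = "{x. J_density m \<psi> x = 0}"
  let ?\<phi> = "inv_into UNIV \<psi>"
  have N: "?N \<in> sets borel"
    using measurable_sets_borel[OF J_density_measurable[OF \<psi>], of "{0}"] by (simp add: vimage_def)
  have "(\<integral>\<^sup>+x\<in>?N. ennreal (J_density m \<psi> x) \<partial>m) = (\<integral>\<^sup>+x. 0 \<partial>m)"
    by (intro nn_integral_cong) (auto split: split_indicator)
  then have 0: "emeasure m (\<psi> -` ?N) = 0"
    unfolding J_density_emeasure[OF \<psi> N] by simp
  have pb: "\<psi> -` ?N \<in> sets borel"
    using measurable_sets[OF diffeo_measurable[OF \<psi>] N] by simp
  have "?\<phi> -` (\<psi> -` ?N) = ?N"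
    using diffeo_bij[OF \<psi>] by (auto simp: bij_is_surj surj_f_inv_f)
  then have "emeasure m ?N = (\<integral>\<^sup>+x\<in>\<psi> -` ?N. ennreal (J_density m ?\<phi> x) \<partial>m)"
    using J_density_emeasure[OF diffeomorphism_inverse[OF \<psi>] pb] by simp
  also have "\<dots> = 0"
  proof -
    have "AE x in m. x \<notin> \<psi> -` ?N"
      using 0 pb by (intro AE_not_in) auto
    then have "AE x in m. ennreal (J_density m ?\<phi> x) * indicator (\<psi> -` ?N) x = 0"
      by eventually_elim auto
    from nn_integral_cong_AE[OF this] show ?thesis
      by simp
  qed
  finally have "AE x in m. x \<notin> ?N"
    using N by (intro AE_not_in) auto
  then show ?thesis
    by eventually_elim (use J_density(2)[OF \<psi>] in \<open>auto simp: less_le\<close>)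
qed

end

section \<open>Transformation of the intensity measure\<close>

text \<open>
  The measurable space underlying both the product of the volume with the Lebesgue measure on the
  half-line and the intensity measure.  Describing it by Borel sets of the product topology fits
  the families of sets from which the configuration space is built.
\<close>

definition marked_space :: "('a::topological_space \<times> real) measure" where
  "marked_space = restrict_space borel (cyl UNIV)"

lemma cyl_borel: "L \<in> sets borel \<Longrightarrow> cyl L \<in> sets (borel :: ('a::second_countable_topology \<times> real) measure)"
  unfolding cyl_def borel_prod[symmetric] by (intro pair_measureI) auto

lemma cyl_iff: "z \<in> cyl L \<longleftrightarrow> fst z \<in> L \<and> 0 < snd z"
  by (cases z) (auto simp: cyl_def)

lemma space_marked [simp]: "space marked_space = cyl UNIV"
  by (simp add: marked_space_def space_restrict_space)

lemma sets_marked_iff: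
  "B \<in> sets (marked_space :: ('a::second_countable_topology \<times> real) measure) \<longleftrightarrow> B \<in> sets borel \<and> B \<subseteq> cyl UNIV"
  unfolding marked_space_def by (subst sets_restrict_space_iff) (auto intro: cyl_borel)

lemma cyl_marked: "L \<in> sets borel \<Longrightarrow> cyl L \<in> sets (marked_space :: ('a::second_countable_topology \<times> real) measure)"
  unfolding sets_marked_iff using cyl_borel[of L] by (auto simp: cyl_def)

lemma space_lam: "space lam = {0<..}"
  by (simp add: lam_def space_restrict_space)

lemma sets_pair_lam:
  fixes m :: "'a::second_countable_topology measure"
  assumes m: "sets m = sets borel"
  shows "sets (m \<Otimes>\<^sub>M lam) = sets (marked_space :: ('a \<times> real) measure)"
proof -
  have sp: "space (m \<Otimes>\<^sub>M lam) = cyl UNIV"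
    using sets_eq_imp_space_eq[OF m] by (simp add: space_pair_measure space_lam cyl_def)
  have "(\<lambda>z. (fst z, snd z)) \<in> measurable marked_space (m \<Otimes>\<^sub>M lam)"
  proof (rule measurable_Pair)
    have "(\<lambda>z. fst z) \<in> measurable (marked_space :: ('a \<times> real) measure) borel"
      unfolding marked_space_def borel_prod[symmetric] by (rule measurable_restrict_space1) simp
    then show "(\<lambda>z. fst z) \<in> measurable marked_space m"
      by (simp only: measurable_cong_sets[OF refl m])
    have "(\<lambda>z. snd z) \<in> measurable (marked_space :: ('a \<times> real) measure) borel"
      unfolding marked_space_def borel_prod[symmetric] by (rule measurable_restrict_space1) simp
    then show "(\<lambda>z. snd z) \<in> measurable (marked_space :: ('a \<times> real) measure) lam"
      unfolding lam_def by (intro measurable_restrict_space2) (auto simp: cyl_iff)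
  qed
  then have 1: "B \<in> sets marked_space" if "B \<in> sets (m \<Otimes>\<^sub>M lam)" for B
    using measurable_sets[OF _ that, of "\<lambda>z. (fst z, snd z)" marked_space] sets.sets_into_space[OF that]
    by (simp add: sp inf.absorb1)
  have "fst \<in> measurable (m \<Otimes>\<^sub>M lam) m"
    by simp
  then have f: "fst \<in> measurable (m \<Otimes>\<^sub>M lam) borel"
    by (simp only: measurable_cong_sets[OF refl m])
  have s: "snd \<in> measurable (m \<Otimes>\<^sub>M lam) borel"
    unfolding lam_def using measurable_snd[of m "restrict_space lborel {0<..}"]
    by (subst (asm) measurable_restrict_space2_iff) auto
  have "(\<lambda>z. (fst z, snd z)) \<in> measurable (m \<Otimes>\<^sub>M lam) (borel \<Otimes>\<^sub>M borel)"
    by (rule measurable_Pair[OF f s])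
  then have id: "(\<lambda>z. z) \<in> measurable (m \<Otimes>\<^sub>M lam) (borel :: ('a \<times> real) measure)"
    by (simp add: borel_prod)
  have 2: "B \<in> sets (m \<Otimes>\<^sub>M lam)" if "B \<in> sets marked_space" for B
    using measurable_sets[OF id, of B] that by (auto simp: sets_marked_iff sp inf.absorb1)
  show ?thesis
    using 1 2 by blast
qed

lemma sigma_finite_lam: "sigma_finite_measure lam"
  unfolding lam_def by (rule sigma_finite_measure_restrict_space) (auto intro: lborel.sigma_finite_measure_axioms)

lemma nn_integral_lam_scale:
  assumes f: "f \<in> borel_measurable lam" and c: "c > 0"
  shows "(\<integral>\<^sup>+s. f (c * s) \<partial>lam) = ennreal (1 / c) * (\<integral>\<^sup>+s. f s \<partial>lam)"
proof -
  define F where "F s = f s * indicator {0<..} s" for s :: real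
  have F: "F \<in> borel_measurable borel"
    using f unfolding lam_def F_def
    by (subst (asm) borel_measurable_restrict_space_iff_ennreal) auto
  have "(\<integral>\<^sup>+s. f s \<partial>lam) = (\<integral>\<^sup>+s. F s \<partial>lborel)"
    unfolding lam_def F_def by (rule nn_integral_restrict_space) auto
  also have "\<dots> = ennreal c * (\<integral>\<^sup>+s. F (c * s) \<partial>lborel)"
    using nn_integral_real_affine[OF F, of c 0] c by simp
  finally have 1: "(\<integral>\<^sup>+s. f s \<partial>lam) = ennreal c * (\<integral>\<^sup>+s. F (c * s) \<partial>lborel)" .
  have "(\<integral>\<^sup>+s. f (c * s) \<partial>lam) = (\<integral>\<^sup>+s. f (c * s) * indicator {0<..} s \<partial>lborel)"
    unfolding lam_def by (rule nn_integral_restrict_space) auto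
  also have "\<dots> = (\<integral>\<^sup>+s. F (c * s) \<partial>lborel)"
    using c by (intro nn_integral_cong) (auto simp: F_def zero_less_mult_iff split: split_indicator)
  finally show ?thesis
    using c unfolding 1 by (simp add: mult.assoc[symmetric] ennreal_mult[symmetric])
qed

text \<open>
  The part of an element of the marked group that acts on the marked space.  With continuity in place of
  smoothness, the inverse transformation is visibly of the same kind.
  The set \<open>K\<close> contains the supports of both components.
\<close>

locale marked_transformation =
  fixes \<psi> :: "'a::{t2_space, second_countable_topology} \<Rightarrow> 'a" and \<theta> :: "'a \<Rightarrow> real" and K :: "'a set"
  assumes bij: "bij \<psi>"
    and cont: "continuous_on UNIV \<psi>" and cont_inv: "continuous_on UNIV (inv_into UNIV \<psi>)"
    and cont_scale: "continuous_on UNIV \<theta>" and scale_pos: "\<theta> x > 0"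
    and K: "compact K" and off_K: "x \<notin> K \<Longrightarrow> \<psi> x = x" "x \<notin> K \<Longrightarrow> \<theta> x = 1"
begin

abbreviation "\<phi> \<equiv> inv_into UNIV \<psi>"
abbreviation "g \<equiv> act_point (\<psi>, \<theta>)"
abbreviation "h \<equiv> act_point (\<phi>, \<lambda>x. inverse (\<theta> (\<psi> x)))"

lemma inv_simps [simp]: "\<phi> (\<psi> x) = x" "\<psi> (\<phi> x) = x"
  using bij by (simp_all add: bij_is_inj bij_is_surj surj_f_inv_f)

lemma g_eq: "g z = (\<psi> (fst z), \<theta> (\<psi> (fst z)) * snd z)"
  by (cases z) simp

lemma h_eq: "h z = (\<phi> (fst z), inverse (\<theta> (fst z)) * snd z)"
  by (cases z) simp

lemma scale_nonzero [simp]: "\<theta> x \<noteq> 0"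
  using scale_pos[of x] by simp

lemma gh [simp]: "g (h z) = z" "h (g z) = z"
  by (simp_all add: g_eq h_eq prod_eq_iff)

lemma inj_g: "inj g"
  by (rule inj_on_inverseI[where g = h]) simp

lemma inv_off_K: "x \<notin> K \<Longrightarrow> \<phi> x = x"
  by (metis inv_simps(1) off_K(1))

lemma inverse_transformation: "marked_transformation \<phi> (\<lambda>x. inverse (\<theta> (\<psi> x))) K"
proof
  show "continuous_on UNIV (inv_into UNIV \<phi>)"
    using bij cont by (simp add: inv_inv_eq)
  show "continuous_on UNIV (\<lambda>x. inverse (\<theta> (\<psi> x)))"
    using scale_pos
    by (intro continuous_on_inverse continuous_on_compose2[OF cont_scale cont]) (auto simp: less_le)
qed (use bij cont cont_inv scale_pos K inv_off_K off_K in \<open>auto simp: bij_imp_bij_inv\<close>)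

lemma psi_in_iff: "K \<subseteq> L \<Longrightarrow> \<psi> x \<in> L \<longleftrightarrow> x \<in> L"
  by (metis inv_off_K inv_simps(1) off_K(1) subsetD)

text \<open>
  A transformation that is trivial off \<open>K\<close> maps each \<open>L\<close> that contains \<open>K\<close> onto itself, so it
  preserves what happens in a sufficiently large window.
\<close>

lemma g_cyl: "K \<subseteq> L \<Longrightarrow> g z \<in> cyl L \<longleftrightarrow> z \<in> cyl L"
  using scale_pos[of "\<psi> (fst z)"] by (simp add: cyl_iff g_eq psi_in_iff zero_less_mult_iff)

lemma g_continuous: "continuous_on UNIV g"
  unfolding g_eq[abs_def]
  by (intro continuous_intros continuous_on_compose2[OF cont] continuous_on_compose2[OF cont_scale]) auto

lemma g_measurable: "g \<in> measurable marked_space marked_space"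
  unfolding marked_space_def
proof (rule measurable_restrict_space2)
  show "g \<in> space (restrict_space borel (cyl UNIV)) \<rightarrow> cyl UNIV"
    using g_cyl[of UNIV] by (auto simp: space_restrict_space)
  show "g \<in> borel_measurable (restrict_space borel (cyl UNIV))"
    by (intro measurable_restrict_space1 borel_measurable_continuous_onI g_continuous)
qed

lemma h_measurable: "h \<in> measurable marked_space marked_space"
  by (rule marked_transformation.g_measurable[OF inverse_transformation])

end

locale marked_setting = riemannian_manifold A G m
  for A :: "('a::{t2_space, second_countable_topology}, 'n::finite) chart set" and G and m +
  fixes \<rho> :: "'a \<Rightarrow> ennreal" and p :: "'a \<Rightarrow> real \<Rightarrow> ennreal"
  assumes rho_measurable: "\<rho> \<in> borel_measurable m" and rho_pos: "AE x in m. \<rho> x > 0"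
    and p_measurable: "case_prod p \<in> borel_measurable (m \<Otimes>\<^sub>M lam)"
    and p_pos: "AE x in m. AE s in lam. p x s > 0"
    and q_integral: "\<And>L. L \<in> Bc \<Longrightarrow>
      (\<integral>\<^sup>+z \<in> cyl L. ennreal (max 1 (snd z)) * q_density \<rho> p z \<partial>(m \<Otimes>\<^sub>M lam)) < \<infinity>"
begin

sublocale marks: sigma_finite_measure lam
  by (rule sigma_finite_lam)

sublocale marked: pair_sigma_finite m lam ..

abbreviation "q \<equiv> q_density \<rho> p"
abbreviation "S \<equiv> sigma_tilde m \<rho> p"

lemma sets_marked: "sets (m \<Otimes>\<^sub>M lam) = sets marked_space"
  by (rule sets_pair_lam[OF vol_sets])

lemma space_pair_lam: "space (m \<Otimes>\<^sub>M lam) = cyl UNIV"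
  using sets_eq_imp_space_eq[OF sets_marked] by simp

lemma sets_sigma_tilde: "sets S = sets marked_space"
  by (simp only: sigma_tilde_def sets_density sets_marked)

lemma q_measurable: "q \<in> borel_measurable (m \<Otimes>\<^sub>M lam)"
proof -
  have "(\<lambda>z. \<rho> (fst z) * case_prod p z) \<in> borel_measurable (m \<Otimes>\<^sub>M lam)"
    using p_measurable measurable_compose[OF measurable_fst rho_measurable] by measurable
  also have "(\<lambda>z. \<rho> (fst z) * case_prod p z) = q"
    by (auto simp: q_density_def)
  finally show ?thesis .
qed

lemma q_pos: "AE z in m \<Otimes>\<^sub>M lam. 0 < q z"
proof (rule marked.AE_pair_measure)
  show "{z \<in> space (m \<Otimes>\<^sub>M lam). 0 < q z} \<in> sets (m \<Otimes>\<^sub>M lam)"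
    using q_measurable by measurable
  show "AE x in m. AE s in lam. 0 < q (x, s)"
    using rho_pos p_pos
  proof eventually_elim
    case (elim x)
    from elim(2) show ?case
      by eventually_elim (use elim(1) in \<open>simp add: q_density_def ennreal_zero_less_mult_iff\<close>)
  qed
qed

lemma integral_q_finite:
  assumes "L \<in> Bc"
  shows "(\<integral>\<^sup>+z \<in> cyl L. q z \<partial>(m \<Otimes>\<^sub>M lam)) < \<infinity>"
proof -
  have "(\<integral>\<^sup>+z \<in> cyl L. q z \<partial>(m \<Otimes>\<^sub>M lam)) \<le>
      (\<integral>\<^sup>+z \<in> cyl L. ennreal (max 1 (snd z)) * q z \<partial>(m \<Otimes>\<^sub>M lam))"
  proof (intro nn_integral_mono mult_right_mono)
    fix z
    have "1 * q z \<le> ennreal (max 1 (snd z)) * q z"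
      by (intro mult_right_mono) (simp_all flip: ennreal_1 add: ennreal_leI)
    then show "q z \<le> ennreal (max 1 (snd z)) * q z"
      by simp
  qed simp
  also have "\<dots> < \<infinity>"
    by (rule q_integral[OF assms])
  finally show ?thesis .
qed

lemma cyl_sets: "L \<in> sets borel \<Longrightarrow> cyl L \<in> sets (m \<Otimes>\<^sub>M lam)"
  unfolding sets_marked by (rule cyl_marked)

lemma open_Bc: "open L \<Longrightarrow> compact (closure L) \<Longrightarrow> L \<in> Bc"
  by (simp add: Bc_def)

lemma sigma_tilde_cyl_finite:
  assumes "L \<in> Bc"
  shows "emeasure S (cyl L) < \<infinity>"
proof -
  have "L \<in> sets borel"
    using assms by (simp add: Bc_def)
  then show ?thesis
    unfolding sigma_tilde_def
    using q_measurable cyl_sets integral_q_finite[OF assms] by (subst emeasure_density) auto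
qed

text \<open>
  Integrability over countably many relatively compact cylinders that cover the space.
\<close>

lemma q_finite: "AE z in m \<Otimes>\<^sub>M lam. q z < \<infinity>"
proof -
  have "\<forall>x::'a. \<exists>U. open U \<and> x \<in> U \<and> compact (closure U)"
    using finite_relatively_compact_nbhd by blast
  from choice[OF this] obtain U :: "'a \<Rightarrow> 'a set" where U: "\<And>x. open (U x)" "\<And>x. x \<in> U x" "\<And>x. compact (closure (U x))"
    by blast
  obtain V :: "nat \<Rightarrow> 'a set" where V: "range V \<subseteq> range U" "(\<Union>i. V i) = UNIV"
    using countable_open_subcover[of U] U by auto
  have "AE z in m \<Otimes>\<^sub>M lam. q z * indicator (cyl (V i)) z \<noteq> \<infinity>" for i
  proof (rule nn_integral_PInf_AE)
    obtain x where "V i = U x"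
      using V(1) by auto
    then have "V i \<in> Bc"
      by (simp add: U open_Bc)
    then show "(\<integral>\<^sup>+z\<in>cyl (V i). q z \<partial>(m \<Otimes>\<^sub>M lam)) \<noteq> \<infinity>"
      using integral_q_finite by (simp add: less_top)
    have "V i \<in> sets borel"
      using \<open>V i \<in> Bc\<close> by (simp add: Bc_def)
    then show "(\<lambda>z. q z * indicator (cyl (V i)) z) \<in> borel_measurable (m \<Otimes>\<^sub>M lam)"
      using q_measurable cyl_sets by measurable
  qed
  then have "AE z in m \<Otimes>\<^sub>M lam. \<forall>i. q z * indicator (cyl (V i)) z \<noteq> \<infinity>"
    by (simp add: AE_all_countable)
  moreover have "AE z in m \<Otimes>\<^sub>M lam. z \<in> cyl UNIV"
    using AE_space[of "m \<Otimes>\<^sub>M lam"] by (simp only: space_pair_lam)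
  ultimately show ?thesis
  proof eventually_elim
    case (elim z)
    obtain i where "fst z \<in> V i"
      using V(2) by blast
    then have "z \<in> cyl (V i)"
      using elim by (simp add: cyl_iff)
    then show ?case
      using spec[OF elim(1), of i] by (simp add: less_top)
  qed
qed

end

locale marked_action = marked_setting A G m \<rho> p + marked_transformation \<psi> \<theta> K
  for A :: "('a::{t2_space, second_countable_topology}, 'n::finite) chart set" and G m \<rho> p
    and \<psi> :: "'a \<Rightarrow> 'a" and \<theta> K +
  assumes diffeo: "diffeomorphism A \<psi>"
begin

abbreviation "J \<equiv> J_density m \<psi>"

lemma g_measurable_pair: "g \<in> measurable (m \<Otimes>\<^sub>M lam) (m \<Otimes>\<^sub>M lam)"
  using g_measurable by (simp only: measurable_cong_sets[OF sets_marked sets_marked])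

lemma h_measurable_pair: "h \<in> measurable (m \<Otimes>\<^sub>M lam) (m \<Otimes>\<^sub>M lam)"
  using h_measurable by (simp only: measurable_cong_sets[OF sets_marked sets_marked])

text \<open>
  The density of the image of \<open>m \<Otimes>\<^sub>M lam\<close>: the Jacobian of the base map, divided by the factor by which
  the marks over the image point have been stretched.
\<close>

definition base_density :: "'a \<times> real \<Rightarrow> ennreal" where
  "base_density z = ennreal (J (fst z) / \<theta> (fst z))"

lemma borel_measurable_m: "f \<in> borel_measurable borel \<Longrightarrow> f \<in> borel_measurable m"
  by (simp only: measurable_cong_sets[OF vol_sets refl])

lemma scale_measurable: "\<theta> \<in> borel_measurable m"
  by (intro borel_measurable_m borel_measurable_continuous_onI cont_scale)

lemma J_measurable: "J \<in> borel_measurable m"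
  by (intro borel_measurable_m J_density_measurable diffeo)

lemma base_density_measurable: "base_density \<in> borel_measurable (m \<Otimes>\<^sub>M lam)"
  unfolding base_density_def[abs_def]
  using measurable_compose[OF measurable_fst J_measurable] measurable_compose[OF measurable_fst scale_measurable]
  by measurable

text \<open>
  Integrate over the marks first: scaling by \<open>\<theta> (\<psi> x)\<close> contributes the factor \<open>1 / \<theta> (\<psi> x)\<close>, which is a
  function of the image point.  Then transform the integral over the base.
\<close>

lemma distr_pair_lam: "distr (m \<Otimes>\<^sub>M lam) (m \<Otimes>\<^sub>M lam) g = density (m \<Otimes>\<^sub>M lam) base_density"
proof (rule measure_eqI)
  fix E assume "E \<in> sets (distr (m \<Otimes>\<^sub>M lam) (m \<Otimes>\<^sub>M lam) g)"
  then have E: "E \<in> sets (m \<Otimes>\<^sub>M lam)"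
    by simp
  define e :: "'a \<times> real \<Rightarrow> ennreal" where "e = indicator E"
  have e: "e \<in> borel_measurable (m \<Otimes>\<^sub>M lam)"
    using E by (simp add: e_def)
  have e1: "(\<lambda>t. e (y, t)) \<in> borel_measurable lam" for y
    using measurable_compose[OF measurable_Pair1'[of y m lam] e] by simp
  define I where "I y = (\<integral>\<^sup>+t. e (y, t) \<partial>lam)" for y
  have I: "I \<in> borel_measurable m"
    unfolding I_def using marks.borel_measurable_nn_integral_fst[OF e] by simp
  define H where "H y = ennreal (1 / \<theta> y) * I y" for y
  have H: "H \<in> borel_measurable m"
    unfolding H_def using I scale_measurable by measurable
  then have Hb: "H \<in> borel_measurable borel"
    by (simp only: measurable_cong_sets[OF vol_sets refl])
  have "emeasure (distr (m \<Otimes>\<^sub>M lam) (m \<Otimes>\<^sub>M lam) g) E =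
      (\<integral>\<^sup>+z. e z \<partial>distr (m \<Otimes>\<^sub>M lam) (m \<Otimes>\<^sub>M lam) g)"
    using E by (simp add: e_def)
  also have "\<dots> = (\<integral>\<^sup>+z. e (g z) \<partial>(m \<Otimes>\<^sub>M lam))"
    by (rule nn_integral_distr[OF g_measurable_pair]) (use e in simp)
  also have "\<dots> = (\<integral>\<^sup>+x. \<integral>\<^sup>+s. e (g (x, s)) \<partial>lam \<partial>m)"
    by (rule marks.nn_integral_fst[symmetric]) (rule measurable_compose[OF g_measurable_pair e])
  also have "\<dots> = (\<integral>\<^sup>+x. H (\<psi> x) \<partial>m)"
    using nn_integral_lam_scale[OF e1 scale_pos] by (simp add: H_def I_def)
  also have "\<dots> = (\<integral>\<^sup>+x. H x \<partial>distr m borel \<psi>)"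
    by (rule nn_integral_distr[symmetric]) (use diffeo_measurable[OF diffeo] Hb in auto)
  also have "\<dots> = (\<integral>\<^sup>+x. ennreal (J x) * H x \<partial>m)"
    unfolding J_density(3)[OF diffeo] using J_measurable H by (intro nn_integral_density) auto
  also have "\<dots> = (\<integral>\<^sup>+x. \<integral>\<^sup>+t. base_density (x, t) * e (x, t) \<partial>lam \<partial>m)"
  proof (intro nn_integral_cong)
    fix x
    have "(\<integral>\<^sup>+t. base_density (x, t) * e (x, t) \<partial>lam) = ennreal (J x / \<theta> x) * I x"
      using e1 by (simp add: base_density_def I_def nn_integral_cmult)
    also have "ennreal (J x / \<theta> x) = ennreal (J x) * ennreal (1 / \<theta> x)"
      using J_density(2)[OF diffeo, of x] scale_pos[of x] by (simp add: ennreal_mult[symmetric])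
    finally show "ennreal (J x) * H x = (\<integral>\<^sup>+t. base_density (x, t) * e (x, t) \<partial>lam)"
      by (simp add: H_def mult.assoc)
  qed
  also have "\<dots> = (\<integral>\<^sup>+z. base_density z * e z \<partial>(m \<Otimes>\<^sub>M lam))"
    using base_density_measurable e by (intro marks.nn_integral_fst) auto
  also have "\<dots> = emeasure (density (m \<Otimes>\<^sub>M lam) base_density) E"
    using base_density_measurable E by (subst emeasure_density) (auto simp: e_def)
  finally show "emeasure (distr (m \<Otimes>\<^sub>M lam) (m \<Otimes>\<^sub>M lam) g) E =
    emeasure (density (m \<Otimes>\<^sub>M lam) base_density) E" .
qed simp

lemma base_density_pos: "AE z in m \<Otimes>\<^sub>M lam. 0 < base_density z"
proof (rule marked.AE_pair_measure)
  show "{z \<in> space (m \<Otimes>\<^sub>M lam). 0 < base_density z} \<in> sets (m \<Otimes>\<^sub>M lam)"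
    using base_density_measurable by measurable
  show "AE x in m. AE s in lam. 0 < base_density (x, s)"
    using J_density_AE_pos[OF diffeo]
    by eventually_elim (simp add: base_density_def scale_pos)
qed

text \<open>
  The inverse transformation preserves null sets because the image of \<open>m \<Otimes>\<^sub>M lam\<close> has an almost
  everywhere positive density.  This ensures that the exceptional case in the
  definition of \<open>p_density\<close> occurs on a null set only.
\<close>

lemma AE_inverse:
  assumes "AE z in m \<Otimes>\<^sub>M lam. Q z" and Q: "{z \<in> cyl UNIV. Q z} \<in> sets (m \<Otimes>\<^sub>M lam)"
  shows "AE z in m \<Otimes>\<^sub>M lam. Q (h z)"
proof -
  have "AE z in m \<Otimes>\<^sub>M lam. Q (h (g z))"
    using assms(1) by simp
  moreover have "{z \<in> space (m \<Otimes>\<^sub>M lam). Q (h z)} \<in> sets (m \<Otimes>\<^sub>M lam)"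
  proof -
    have "h -` {z \<in> cyl UNIV. Q z} \<inter> space (m \<Otimes>\<^sub>M lam) \<in> sets (m \<Otimes>\<^sub>M lam)"
      by (rule measurable_sets[OF h_measurable_pair Q])
    also have "h -` {z \<in> cyl UNIV. Q z} \<inter> space (m \<Otimes>\<^sub>M lam) = {z \<in> space (m \<Otimes>\<^sub>M lam). Q (h z)}"
      using measurable_space[OF h_measurable_pair] by (auto simp: space_pair_lam)
    finally show ?thesis .
  qed
  ultimately have "AE z in distr (m \<Otimes>\<^sub>M lam) (m \<Otimes>\<^sub>M lam) g. Q (h z)"
    using g_measurable_pair by (subst AE_distr_iff) auto
  then have "AE z in m \<Otimes>\<^sub>M lam. 0 < base_density z \<longrightarrow> Q (h z)"
    unfolding distr_pair_lam by (subst (asm) AE_density[OF base_density_measurable])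
  with base_density_pos show ?thesis
    by eventually_elim simp
qed

abbreviation "f \<equiv> p_density m \<rho> p (\<psi>, \<theta>)"

lemma f_eq: "f z = (if 0 < q z \<and> q z < \<infinity> \<and> 0 < q (h z) \<and> q (h z) < \<infinity>
   then q (h z) / (q z * ennreal (\<theta> (fst z))) * ennreal (J (fst z)) else 1)"
  by (cases z) (simp only: p_density_def Let_def prod.case h_eq fst_conv snd_conv)

lemma f_measurable: "f \<in> borel_measurable (m \<Otimes>\<^sub>M lam)"
proof -
  have [measurable]: "q \<in> borel_measurable (m \<Otimes>\<^sub>M lam)" "(\<lambda>z. q (h z)) \<in> borel_measurable (m \<Otimes>\<^sub>M lam)"
    "(\<lambda>z. J (fst z)) \<in> borel_measurable (m \<Otimes>\<^sub>M lam)" "(\<lambda>z. \<theta> (fst z)) \<in> borel_measurable (m \<Otimes>\<^sub>M lam)"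
    using q_measurable measurable_compose[OF h_measurable_pair q_measurable]
      measurable_compose[OF measurable_fst J_measurable] measurable_compose[OF measurable_fst scale_measurable]
    by auto
  show ?thesis
    unfolding f_eq[abs_def] by measurable
qed

lemma f_finite: "f z < \<infinity>"
  using scale_pos[of "fst z"]
  by (auto simp: f_eq ennreal_mult_eq_top_iff ennreal_divide_eq_top_iff less_top[symmetric])

lemma f_off_K: "z \<notin> K \<times> UNIV \<Longrightarrow> f z = 1"
proof -
  assume "z \<notin> K \<times> UNIV"
  then have z: "fst z \<notin> K"
    by (cases z) auto
  then have "h z = z"
    by (simp add: h_eq off_K inv_off_K prod_eq_iff)
  moreover have "J (fst z) = 1"
    using J_density_eq_1[OF diffeo K off_K(1) z] .
  ultimately show ?thesis
    using z by (auto simp: f_eq off_K less_top[symmetric])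
qed

text \<open>
  The image of a measure with density \<open>q\<close> has density \<open>(q o g\<^sup>-\<^sup>1) * base_density\<close> with respect to the same
  reference measure.  Where \<open>q\<close> and \<open>q o g\<^sup>-\<^sup>1\<close> are positive and finite, this equals \<open>q * f\<close>.
\<close>

lemma distr_sigma_tilde: "distr S S g = density S f"
proof -
  let ?M = "m \<Otimes>\<^sub>M lam"
  have qh: "(\<lambda>z. q (h z)) \<in> borel_measurable ?M"
    by (rule measurable_compose[OF h_measurable_pair q_measurable])
  have gS: "g \<in> measurable S ?M"
    using g_measurable by (simp only: measurable_cong_sets[OF sets_sigma_tilde sets_marked])
  have "distr S S g = distr S ?M g"
    by (intro distr_cong refl trans[OF sets_sigma_tilde sets_marked[symmetric]])
  also have "\<dots> = density ?M (\<lambda>z. q (h z) * base_density z)"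
  proof (rule measure_eqI)
    fix E assume "E \<in> sets (distr S ?M g)"
    then have E: "E \<in> sets ?M"
      by simp
    then have Eh: "(\<lambda>z. q (h z) * indicator E z) \<in> borel_measurable ?M"
      using qh by measurable
    have gE: "g -` E \<inter> space ?M \<in> sets ?M"
      by (rule measurable_sets[OF g_measurable_pair E])
    have "emeasure (distr S ?M g) E = emeasure S (g -` E \<inter> space ?M)"
      using E gS by (simp add: emeasure_distr sigma_tilde_def)
    also have "\<dots> = (\<integral>\<^sup>+z\<in>g -` E \<inter> space ?M. q z \<partial>?M)"
      unfolding sigma_tilde_def using q_measurable gE by (rule emeasure_density)
    also have "\<dots> = (\<integral>\<^sup>+z. q (h (g z)) * indicator E (g z) \<partial>?M)"
      by (intro nn_integral_cong) (auto split: split_indicator)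
    also have "\<dots> = (\<integral>\<^sup>+z. q (h z) * indicator E z \<partial>distr ?M ?M g)"
      by (rule nn_integral_distr[OF g_measurable_pair, symmetric]) (use Eh in simp)
    also have "\<dots> = (\<integral>\<^sup>+z. base_density z * (q (h z) * indicator E z) \<partial>?M)"
      unfolding distr_pair_lam using base_density_measurable Eh by (rule nn_integral_density)
    also have "\<dots> = emeasure (density ?M (\<lambda>z. q (h z) * base_density z)) E"
      using qh base_density_measurable E by (subst emeasure_density) (auto simp: ac_simps)
    finally show "emeasure (distr S ?M g) E = emeasure (density ?M (\<lambda>z. q (h z) * base_density z)) E" .
  qed simp
  also have "\<dots> = density ?M (\<lambda>z. q z * f z)"
  proof (rule density_cong)
    have "{z \<in> cyl UNIV. 0 < q z \<and> q z < \<infinity>} \<in> sets ?M"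
      using q_measurable unfolding space_pair_lam[symmetric] by measurable
    then have "AE z in ?M. 0 < q (h z) \<and> q (h z) < \<infinity>"
      using q_pos q_finite by (intro AE_inverse[where Q = "\<lambda>z. 0 < q z \<and> q z < \<infinity>"]) auto
    then show "AE z in ?M. q (h z) * base_density z = q z * f z"
      using q_pos q_finite
    proof eventually_elim
      case (elim z)
      have nn: "0 \<le> J (fst z)"
        by (rule J_density(2)[OF diffeo])
      obtain a where a: "q z = ennreal a" "0 < a"
        using elim by (cases "q z" rule: ennreal_cases) auto
      obtain b where b: "q (h z) = ennreal b" "0 < b"
        using elim by (cases "q (h z)" rule: ennreal_cases) auto
      have f: "f z = ennreal (b / (a * \<theta> (fst z)) * J (fst z))"
        using a b nn scale_pos[of "fst z"]
        by (simp add: f_eq ennreal_mult[symmetric] divide_ennreal)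
      have "q (h z) * base_density z = ennreal (b * (J (fst z) / \<theta> (fst z)))"
        unfolding base_density_def b(1) using b nn scale_pos[of "fst z"] by (intro ennreal_mult[symmetric]) auto
      also have "\<dots> = ennreal (a * (b / (a * \<theta> (fst z)) * J (fst z)))"
        using a by simp
      also have "\<dots> = q z * f z"
        unfolding f a using a b nn scale_pos[of "fst z"] by (intro ennreal_mult) auto
      finally show ?case .
    qed
  qed (use qh base_density_measurable q_measurable f_measurable in auto)
  also have "\<dots> = density S f"
    unfolding sigma_tilde_def using q_measurable f_measurable by (rule density_density_eq[symmetric])
  finally show ?thesis .
qed

end

section \<open>Measurability on the configuration space\<close>

lemma space_Omega_M: "space Omega_M = Omega"
  unfolding Omega_M_def by (rule space_measure_of) auto

lemma sets_Omega_M: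
  "sets Omega_M = sigma_sets Omega {(\<lambda>\<omega>. card (\<omega> \<inter> B)) -` N \<inter> Omega | B N. B \<in> Bc_marked}"
  unfolding Omega_M_def by (rule sets_measure_of) auto

lemma measurable_Omega_M:
  fixes h :: "'b \<Rightarrow> ('a::topological_space \<times> real) set"
  assumes "h \<in> space M \<rightarrow> Omega"
    and "\<And>B. B \<in> Bc_marked \<Longrightarrow> (\<lambda>x. card (h x \<inter> B)) \<in> measurable M (count_space UNIV)"
  shows "h \<in> measurable M Omega_M"
  unfolding Omega_M_def
proof (rule measurable_measure_of)
  fix Y :: "('a \<times> real) set set" assume "Y \<in> {(\<lambda>\<omega>. card (\<omega> \<inter> B)) -` N \<inter> Omega | B N. B \<in> Bc_marked}"
  then obtain B N where Y: "Y = (\<lambda>\<omega>. card (\<omega> \<inter> B)) -` N \<inter> Omega" "B \<in> Bc_marked"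
    by auto
  have "(\<lambda>x. card (h x \<inter> B)) -` N \<inter> space M \<in> sets M"
    by (rule measurable_sets[OF assms(2)[OF Y(2)]]) simp
  also have "(\<lambda>x. card (h x \<inter> B)) -` N \<inter> space M = h -` Y \<inter> space M"
    using assms(1) by (auto simp: Y)
  finally show "h -` Y \<inter> space M \<in> sets M" .
qed (use assms in auto)

lemma Omega_subset: "\<omega> \<in> Omega \<Longrightarrow> \<eta> \<subseteq> \<omega> \<Longrightarrow> \<eta> \<in> Omega"
  unfolding Omega_def by (auto intro: inj_on_subset finite_subset[of "fst ` \<eta> \<inter> _" "fst ` \<omega> \<inter> _"])

lemma Omega_pos: "\<omega> \<in> Omega \<Longrightarrow> z \<in> \<omega> \<Longrightarrow> z \<in> cyl UNIV"
  unfolding Omega_def by auto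

lemma Omega_finite:
  assumes "\<omega> \<in> Omega" "L \<in> Bc"
  shows "finite (\<omega> \<inter> cyl L)"
proof (rule finite_imageD)
  have "finite (fst ` \<omega> \<inter> closure L)"
    using assms by (auto simp: Omega_def Bc_def)
  then show "finite (fst ` (\<omega> \<inter> cyl L))"
    by (rule finite_subset[rotated]) (use closure_subset[of L] in \<open>auto simp: cyl_iff\<close>)
  show "inj_on fst (\<omega> \<inter> cyl L)"
    using assms by (auto simp: Omega_def intro: inj_on_subset)
qed

lemma Bc_Int: "L \<in> Bc \<Longrightarrow> C \<in> sets borel \<Longrightarrow> L \<inter> C \<in> Bc"
proof -
  assume a: "L \<in> Bc" "C \<in> sets borel"
  have "compact (closure L \<inter> closure (L \<inter> C))"
    using a by (intro compact_Int_closed) (auto simp: Bc_def)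
  moreover have "closure L \<inter> closure (L \<inter> C) = closure (L \<inter> C)"
    using closure_mono[of "L \<inter> C" L] by auto
  ultimately show ?thesis
    using a by (auto simp: Bc_def)
qed

lemma measurable_nat_of_ennreal:
  assumes "(\<lambda>x. of_nat (f x) :: ennreal) \<in> borel_measurable M"
  shows "f \<in> measurable M (count_space UNIV)"
proof (rule measurableI)
  fix N :: "nat set"
  have "(\<lambda>x. of_nat (f x) :: ennreal) -` of_nat ` N \<inter> space M \<in> sets M"
  proof (rule measurable_sets[OF assms], rule sets.countable)
    show "countable (of_nat ` N :: ennreal set)"
      by (rule countable_image[OF countableI_type])
    show "{a} \<in> sets borel" for a :: ennreal
      by (rule borel_closed[OF closed_singleton])
  qed
  also have "(\<lambda>x. of_nat (f x) :: ennreal) -` of_nat ` N \<inter> space M = f -` N \<inter> space M"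
  proof -
    have "(of_nat k :: ennreal) \<in> of_nat ` N \<longleftrightarrow> k \<in> N" for k
      using inj_image_mem_iff[OF inj_of_nat] .
    then show ?thesis
      unfolding vimage_def by simp
  qed
  finally show "f -` N \<inter> space M \<in> sets M" .
qed simp

lemma card_measurable_generator:
  assumes "B \<in> Bc_marked"
  shows "(\<lambda>\<omega>. card (\<omega> \<inter> B)) \<in> measurable Omega_M (count_space UNIV)"
proof (rule measurableI)
  fix N :: "nat set"
  show "(\<lambda>\<omega>. card (\<omega> \<inter> B)) -` N \<inter> space Omega_M \<in> sets Omega_M"
    unfolding sets_Omega_M space_Omega_M using assms by (auto intro!: sigma_sets.Basic)
qed simp

text \<open>
  The generators of the sigma-algebra count points in sets whose projection to the base is Borel, a property
  that a Borel set in the product may lack.  It holds for rectangles, which form an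
  intersection stable generator, and the counting maps of Borel sets within a
  finite cylinder are closed under complements and disjoint unions.
\<close>

lemma count_measurable:
  fixes B :: "('a::second_countable_topology \<times> real) set"
  assumes L: "L \<in> Bc" and B: "B \<in> sets borel"
  shows "(\<lambda>\<omega>. emeasure (count_space UNIV) (\<omega> \<inter> (B \<inter> cyl L))) \<in> borel_measurable Omega_M"
proof -
  have Lb: "L \<in> sets borel"
    using L by (simp add: Bc_def)
  have fin: "finite (\<omega> \<inter> (B \<inter> cyl L))" if "\<omega> \<in> Omega" for \<omega> B
    using Omega_finite[OF that L] by (rule finite_subset[rotated]) auto
  have "Int_stable {a \<times> b |a b. a \<in> sets (borel :: 'a measure) \<and> b \<in> sets (borel :: real measure)}"
    "{a \<times> b |a b. a \<in> sets (borel :: 'a measure) \<and> b \<in> sets (borel :: real measure)} \<subseteq> Pow UNIV"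
    by (rule Int_stable_pair_measure_generator) simp
  moreover have "B \<in> sigma_sets UNIV {a \<times> b |a b. a \<in> sets (borel :: 'a measure) \<and> b \<in> sets (borel :: real measure)}"
    using B by (simp add: borel_prod[symmetric] sets_pair_measure)
  ultimately show ?thesis
  proof (induction rule: sigma_sets_induct_disjoint)
    case (basic B)
    then obtain C D where CD: "B = C \<times> D" "C \<in> sets borel" "D \<in> sets borel"
      by auto
    have Bm: "B \<inter> cyl L \<in> Bc_marked"
    proof (cases "D \<inter> {0<..} = {}")
      case True
      then have "B \<inter> cyl L = {}"
        by (auto simp: CD cyl_def)
      then show ?thesis
        by (simp add: Bc_marked_def Bc_def)
    next
      case False
      then have "fst ` (B \<inter> cyl L) = L \<inter> C"
        by (force simp: CD cyl_def image_iff)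
      moreover have "B \<in> sets borel"
        using CD by (simp add: borel_prod[symmetric])
      ultimately show ?thesis
        using Bc_Int[OF L CD(2)] cyl_borel[OF Lb] by (auto simp: Bc_marked_def cyl_def)
    qed
    have "(\<lambda>\<omega>. of_nat (card (\<omega> \<inter> (B \<inter> cyl L))) :: ennreal) \<in> borel_measurable Omega_M"
      by (rule measurable_compose[OF card_measurable_generator[OF Bm]]) simp
    then show ?case
      by (rule measurable_cong[THEN iffD1, rotated]) (simp add: space_Omega_M fin emeasure_count_space)
  next
    case (compl B)
    have "cyl L \<in> Bc_marked"
    proof -
      have "fst ` cyl L = L"
        by (auto simp: cyl_def image_iff intro: exI[of _ 1])
      then show ?thesis
        using L cyl_borel[OF Lb] by (auto simp: Bc_marked_def cyl_def)
    qed
    from card_measurable_generator[OF this]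
    have "(\<lambda>\<omega>. of_nat (card (\<omega> \<inter> cyl L)) :: ennreal) \<in> borel_measurable Omega_M"
      by (rule measurable_compose) simp
    with compl have "(\<lambda>\<omega>. of_nat (card (\<omega> \<inter> cyl L)) - emeasure (count_space UNIV) (\<omega> \<inter> (B \<inter> cyl L)))
        \<in> borel_measurable Omega_M"
      by (intro borel_measurable_minus_ennreal)
    then show ?case
    proof (rule measurable_cong[THEN iffD1, rotated])
      fix \<omega> assume "\<omega> \<in> space (Omega_M :: ('a \<times> real) set measure)"
      then have w: "\<omega> \<in> Omega"
        by (simp add: space_Omega_M)
      have "\<omega> \<inter> ((UNIV - B) \<inter> cyl L) = (\<omega> \<inter> cyl L) - (\<omega> \<inter> (B \<inter> cyl L))"
        by auto
      moreover have "emeasure (count_space UNIV) ((\<omega> \<inter> cyl L) - (\<omega> \<inter> (B \<inter> cyl L))) =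
          emeasure (count_space UNIV) (\<omega> \<inter> cyl L) - emeasure (count_space UNIV) (\<omega> \<inter> (B \<inter> cyl L))"
        using fin[OF w] by (intro emeasure_Diff) auto
      ultimately show "of_nat (card (\<omega> \<inter> cyl L)) - emeasure (count_space UNIV) (\<omega> \<inter> (B \<inter> cyl L)) =
          emeasure (count_space UNIV) (\<omega> \<inter> ((UNIV - B) \<inter> cyl L))"
        using Omega_finite[OF w L] by simp
    qed
  next
    case (union B)
    (* Counting with values in the extended reals turns disjoint unions into countable sums. *)
    have "(\<lambda>\<omega>. \<Sum>i. emeasure (count_space UNIV) (\<omega> \<inter> (B i \<inter> cyl L))) \<in> borel_measurable Omega_M"
      using union(3) by (intro borel_measurable_suminf_order)
    moreover have "(\<Sum>i. emeasure (count_space UNIV) (\<omega> \<inter> (B i \<inter> cyl L))) =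
        emeasure (count_space UNIV) (\<omega> \<inter> ((\<Union>i. B i) \<inter> cyl L))" for \<omega>
    proof -
      have "disjoint_family (\<lambda>i. \<omega> \<inter> (B i \<inter> cyl L))"
        using union(1) unfolding disjoint_family_on_def by blast
      then have "(\<Sum>i. emeasure (count_space UNIV) (\<omega> \<inter> (B i \<inter> cyl L))) =
          emeasure (count_space UNIV) (\<Union>i. \<omega> \<inter> (B i \<inter> cyl L))"
        by (intro suminf_emeasure) auto
      also have "(\<Union>i. \<omega> \<inter> (B i \<inter> cyl L)) = \<omega> \<inter> ((\<Union>i. B i) \<inter> cyl L)"
        by auto
      finally show ?thesis .
    qed
    ultimately show ?case
      by simp
  qed simp
qed

lemma card_measurable:
  fixes B :: "('a::second_countable_topology \<times> real) set"
  assumes "L \<in> Bc" "B \<in> sets borel" "B \<subseteq> cyl L"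
  shows "(\<lambda>\<omega>. card (\<omega> \<inter> B)) \<in> measurable Omega_M (count_space UNIV)"
proof (rule measurable_nat_of_ennreal)
  have B: "B \<inter> cyl L = B"
    using assms by auto
  have fin: "finite (\<omega> \<inter> B)" if "\<omega> \<in> Omega" for \<omega>
    using Omega_finite[OF that assms(1)] by (rule finite_subset[rotated]) (use assms in auto)
  show "(\<lambda>\<omega>. of_nat (card (\<omega> \<inter> B)) :: ennreal) \<in> borel_measurable Omega_M"
    using count_measurable[OF assms(1,2)] unfolding B
    by (rule measurable_cong[THEN iffD1, rotated]) (simp add: space_Omega_M fin)
qed

lemma restriction_measurable:
  fixes L :: "'a::second_countable_topology set"
  assumes "L \<in> sets borel"
  shows "(\<lambda>\<omega>. \<omega> \<inter> cyl L) \<in> measurable Omega_M Omega_M"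
proof (rule measurable_Omega_M)
  show "(\<lambda>\<omega>. \<omega> \<inter> cyl L) \<in> space Omega_M \<rightarrow> Omega"
    by (auto simp: space_Omega_M intro: Omega_subset)
  fix B :: "('a \<times> real) set" assume B: "B \<in> Bc_marked"
  then have "B \<subseteq> cyl (fst ` B)" "fst ` B \<in> Bc" "B \<in> sets borel"
    by (auto simp: Bc_marked_def cyl_def intro: rev_image_eqI)
  then show "(\<lambda>\<omega>. card (\<omega> \<inter> cyl L \<inter> B)) \<in> measurable Omega_M (count_space UNIV)"
    using cyl_borel[OF assms] unfolding Int_assoc by (intro card_measurable[of "fst ` B"]) auto
qed

lemma conf_prod_restrict:
  assumes "\<And>z. z \<notin> K \<times> UNIV \<Longrightarrow> f z = 1" "K \<subseteq> L" "\<omega> \<in> Omega"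
  shows "conf_prod f (\<omega> \<inter> cyl L) = conf_prod f \<omega>"
proof -
  have "{z \<in> \<omega> \<inter> cyl L. f z \<noteq> 1} = {z \<in> \<omega>. f z \<noteq> 1}"
    using assms(1,2) Omega_pos[OF assms(3)] by (fastforce simp: cyl_iff)
  then show ?thesis
    by (simp add: conf_prod_def)
qed

lemma conf_prod_finite: "finite \<omega> \<Longrightarrow> conf_prod f \<omega> = (\<Prod>z\<in>\<omega>. f z)"
  unfolding conf_prod_def by (rule prod.mono_neutral_left) auto

text \<open>
  For a simple function \<open>F\<close> the product over the points in a cylinder is a finite product of powers of
  values of \<open>F\<close>, whose exponents count the points of the configuration where \<open>F\<close> takes
  the value.  The general case is a pointwise limit of finite products; since multiplication of
  extended reals is discontinuous, the limit is taken in the reals, which uses that \<open>f\<close> is finite.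
\<close>

lemma conf_prod_measurable:
  fixes f :: "'a::second_countable_topology \<times> real \<Rightarrow> ennreal"
  assumes f: "f \<in> borel_measurable marked_space" "\<And>z. f z < \<infinity>" "\<And>z. z \<notin> K \<times> UNIV \<Longrightarrow> f z = 1"
    and L: "L \<in> Bc" "K \<subseteq> L"
  shows "conf_prod f \<in> borel_measurable Omega_M"
proof -
  define r where "r z = enn2real (f z)" for z
  have r: "r \<in> borel_measurable marked_space" "f z = ennreal (r z)" "0 \<le> r z" for z
    using f(1,2) by (auto simp: r_def[abs_def] less_top)
  obtain F where F: "\<And>i. simple_function marked_space (F i)"
    "\<And>z. z \<in> cyl UNIV \<Longrightarrow> (\<lambda>i. F i z) \<longlonglongrightarrow> r z"
    using borel_measurable_implies_sequence_metric[OF r(1), of 0] by auto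
  have Lb: "L \<in> sets borel"
    using L by (simp add: Bc_def)
  have "(\<lambda>\<omega>. \<Prod>z\<in>\<omega> \<inter> cyl L. F i z) \<in> borel_measurable Omega_M" for i
  proof -
    let ?V = "F i ` cyl UNIV"
    have V: "finite ?V"
      using F(1)[of i] by (simp add: simple_function_def)
    have "(\<lambda>\<omega>. \<Prod>v\<in>?V. v ^ card (\<omega> \<inter> (F i -` {v} \<inter> cyl L))) \<in> borel_measurable Omega_M"
    proof (intro borel_measurable_prod)
      fix v assume "v \<in> ?V"
      then have "F i -` {v} \<inter> cyl UNIV \<in> sets marked_space"
        using F(1)[of i] by (auto simp: simple_function_def)
      then have "F i -` {v} \<inter> cyl UNIV \<inter> cyl L \<in> sets borel"
        using cyl_borel[OF Lb] by (auto simp: sets_marked_iff)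
      also have "F i -` {v} \<inter> cyl UNIV \<inter> cyl L = F i -` {v} \<inter> cyl L"
        by (auto simp: cyl_iff)
      finally have "(\<lambda>\<omega>. card (\<omega> \<inter> (F i -` {v} \<inter> cyl L))) \<in> measurable Omega_M (count_space UNIV)"
        by (intro card_measurable[OF L(1)]) auto
      then show "(\<lambda>\<omega>. v ^ card (\<omega> \<inter> (F i -` {v} \<inter> cyl L))) \<in> borel_measurable Omega_M"
        by (rule measurable_compose) simp
    qed
    then show ?thesis
    proof (rule measurable_cong[THEN iffD1, rotated])
      fix \<omega> assume "\<omega> \<in> space (Omega_M :: ('a \<times> real) set measure)"
      then have fin: "finite (\<omega> \<inter> cyl L)"
        using Omega_finite L by (simp add: space_Omega_M)
      have "(\<Prod>z\<in>\<omega> \<inter> cyl L. F i z) = (\<Prod>v\<in>?V. \<Prod>z | z \<in> \<omega> \<inter> cyl L \<and> F i z = v. F i z)"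
        by (rule prod.group[symmetric, OF fin V]) (auto simp: cyl_iff)
      also have "\<dots> = (\<Prod>v\<in>?V. v ^ card (\<omega> \<inter> (F i -` {v} \<inter> cyl L)))"
      proof (rule prod.cong[OF refl])
        fix v
        have "{z. z \<in> \<omega> \<inter> cyl L \<and> F i z = v} = \<omega> \<inter> (F i -` {v} \<inter> cyl L)"
          by auto
        moreover have "(\<Prod>z | z \<in> \<omega> \<inter> cyl L \<and> F i z = v. F i z) = (\<Prod>z | z \<in> \<omega> \<inter> cyl L \<and> F i z = v. v)"
          by (rule prod.cong) auto
        ultimately show "(\<Prod>z | z \<in> \<omega> \<inter> cyl L \<and> F i z = v. F i z) = v ^ card (\<omega> \<inter> (F i -` {v} \<inter> cyl L))"
          by simp
      qed
      finally show "(\<Prod>v\<in>?V. v ^ card (\<omega> \<inter> (F i -` {v} \<inter> cyl L))) = (\<Prod>z\<in>\<omega> \<inter> cyl L. F i z)" ..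
    qed
  qed
  then have "(\<lambda>\<omega>. \<Prod>z\<in>\<omega> \<inter> cyl L. r z) \<in> borel_measurable Omega_M"
  proof (rule borel_measurable_LIMSEQ_real[rotated])
    fix \<omega> assume "\<omega> \<in> space (Omega_M :: ('a \<times> real) set measure)"
    show "(\<lambda>i. \<Prod>z\<in>\<omega> \<inter> cyl L. F i z) \<longlonglongrightarrow> (\<Prod>z\<in>\<omega> \<inter> cyl L. r z)"
      by (intro tendsto_prod F(2)) (auto simp: cyl_iff)
  qed
  then have "(\<lambda>\<omega>. ennreal (\<Prod>z\<in>\<omega> \<inter> cyl L. r z)) \<in> borel_measurable Omega_M"
    by measurable
  then show ?thesis
  proof (rule measurable_cong[THEN iffD1, rotated])
    fix \<omega> assume "\<omega> \<in> space (Omega_M :: ('a \<times> real) set measure)"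
    then have w: "\<omega> \<in> Omega"
      by (simp add: space_Omega_M)
    have "conf_prod f \<omega> = conf_prod f (\<omega> \<inter> cyl L)"
      using conf_prod_restrict[OF f(3) L(2) w] by simp
    also have "\<dots> = (\<Prod>z\<in>\<omega> \<inter> cyl L. ennreal (r z))"
      using conf_prod_finite[OF Omega_finite[OF w L(1)], of f] r(2) by simp
    also have "\<dots> = ennreal (\<Prod>z\<in>\<omega> \<inter> cyl L. r z)"
      by (rule prod_ennreal) (simp add: r(3))
    finally show "ennreal (\<Prod>z\<in>\<omega> \<inter> cyl L. r z) = conf_prod f \<omega>" ..
  qed
qed

section \<open>Transformation of marked Poisson measures\<close>

lemma nn_integral_sum_of_measures:
  fixes N :: "nat \<Rightarrow> 'b measure" and a :: "nat \<Rightarrow> ennreal"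
  assumes sets: "\<And>n. sets (N n) = sets M"
    and eq: "\<And>E. E \<in> sets M \<Longrightarrow> emeasure M E = (\<Sum>n. a n * emeasure (N n) E)"
    and u: "u \<in> borel_measurable M"
  shows "(\<integral>\<^sup>+x. u x \<partial>M) = (\<Sum>n. a n * (\<integral>\<^sup>+x. u x \<partial>N n))"
proof -
  have mN: "f \<in> borel_measurable (N n) \<longleftrightarrow> f \<in> borel_measurable M" for f :: "'b \<Rightarrow> ennreal" and n
    by (simp only: measurable_cong_sets[OF sets refl])
  have sp: "space (N n) = space M" for n
    by (rule sets_eq_imp_space_eq[OF sets])
  show ?thesis
    using u
  proof (induction u rule: borel_measurable_induct)
    case (cong f g)
    have "(\<integral>\<^sup>+x. f x \<partial>M) = (\<integral>\<^sup>+x. g x \<partial>M)"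
      by (rule nn_integral_cong) (rule cong(3))
    moreover have "(\<integral>\<^sup>+x. f x \<partial>N n) = (\<integral>\<^sup>+x. g x \<partial>N n)" for n
      by (rule nn_integral_cong) (use cong(3) sp in auto)
    ultimately show ?case
      using cong(4) by simp
  next
    case (set E)
    then have "E \<in> sets (N n)" for n
      by (simp only: sets)
    then show ?case
      using eq[OF set] set by simp
  next
    case (mult u c)
    have "(\<integral>\<^sup>+x. c * u x \<partial>N n) = c * (\<integral>\<^sup>+x. u x \<partial>N n)" for n
      using mult(2) by (intro nn_integral_cmult) (simp add: mN)
    moreover have "(\<integral>\<^sup>+x. c * u x \<partial>M) = c * (\<integral>\<^sup>+x. u x \<partial>M)"
      using mult(2) by (intro nn_integral_cmult)
    ultimately show ?case
      by (simp only: mult(4) ennreal_suminf_cmult[symmetric] mult.left_commute)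
  next
    case (add u v)
    have "(\<integral>\<^sup>+x. v x + u x \<partial>N n) = (\<integral>\<^sup>+x. v x \<partial>N n) + (\<integral>\<^sup>+x. u x \<partial>N n)" for n
      using add by (intro nn_integral_add) (simp_all add: mN)
    moreover have "(\<integral>\<^sup>+x. v x + u x \<partial>M) = (\<integral>\<^sup>+x. v x \<partial>M) + (\<integral>\<^sup>+x. u x \<partial>M)"
      using add by (intro nn_integral_add)
    ultimately show ?case
      by (simp only: add.IH distrib_left suminf_add[OF summableI summableI])
  next
    case (seq U)
    have inc: "incseq (\<lambda>i. a n * (\<integral>\<^sup>+x. U i x \<partial>N n))" for n
      using seq(3) by (auto simp: incseq_def le_fun_def intro!: mult_left_mono nn_integral_mono)
    have "(\<integral>\<^sup>+x. (SUP i. U i) x \<partial>M) = (SUP i. \<integral>\<^sup>+x. U i x \<partial>M)"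
      using seq unfolding SUP_apply by (intro nn_integral_monotone_convergence_SUP) auto
    also have "\<dots> = (SUP i. \<Sum>n. a n * (\<integral>\<^sup>+x. U i x \<partial>N n))"
      by (simp only: seq(5))
    also have "\<dots> = (\<Sum>n. SUP i. a n * (\<integral>\<^sup>+x. U i x \<partial>N n))"
      by (rule ennreal_suminf_SUP_eq[symmetric]) (rule inc)
    also have "(\<lambda>n. SUP i. a n * (\<integral>\<^sup>+x. U i x \<partial>N n)) = (\<lambda>n. a n * (\<integral>\<^sup>+x. (SUP i. U i) x \<partial>N n))"
    proof
      fix n
      have "(\<integral>\<^sup>+x. (SUP i. U i) x \<partial>N n) = (SUP i. \<integral>\<^sup>+x. U i x \<partial>N n)"
        using seq unfolding SUP_apply by (intro nn_integral_monotone_convergence_SUP) (simp_all add: mN)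
      then show "(SUP i. a n * (\<integral>\<^sup>+x. U i x \<partial>N n)) = a n * (\<integral>\<^sup>+x. (SUP i. U i) x \<partial>N n)"
        by (simp add: SUP_mult_left_ennreal)
    qed
    finally show ?case .
  qed
qed

text \<open>
  Both sides are the product of the measures \<open>density N f = distr N N g\<close>, because they agree on boxes.
\<close>

lemma distr_PiM_density:
  fixes N :: "'b measure" and I :: "nat set"
  assumes N: "finite_measure N" and g: "g \<in> measurable N N" and f: "f \<in> borel_measurable N"
    and eq: "distr N N g = density N f" and I: "finite I"
  shows "distr (Pi\<^sub>M I (\<lambda>_. N)) (Pi\<^sub>M I (\<lambda>_. N)) (\<lambda>z. \<lambda>i\<in>I. g (z i)) =
    density (Pi\<^sub>M I (\<lambda>_. N)) (\<lambda>w. \<Prod>i\<in>I. f (w i))"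
proof -
  let ?Q = "Pi\<^sub>M I (\<lambda>_. N)"
  let ?D = "density N f"
  interpret N: finite_measure N by fact
  interpret QN: product_sigma_finite "\<lambda>_. N" ..
  have "finite_measure ?D"
    unfolding eq[symmetric] using g by (rule N.finite_measure_distr)
  then interpret D: finite_measure ?D .
  interpret QD: product_sigma_finite "\<lambda>_. ?D" ..
  have setsQ: "sets (Pi\<^sub>M I (\<lambda>_. ?D)) = sets ?Q"
    by (rule sets_PiM_cong) auto
  have T: "(\<lambda>z. \<lambda>i\<in>I. g (z i)) \<in> measurable ?Q ?Q"
    using g by measurable
  have fi: "(\<lambda>w. f (w i)) \<in> borel_measurable ?Q" if "i \<in> I" for i
    using measurable_compose[OF measurable_component_singleton[OF that] f] .
  have "distr ?Q ?Q (\<lambda>z. \<lambda>i\<in>I. g (z i)) = Pi\<^sub>M I (\<lambda>_. ?D)"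
  proof (rule QD.PiM_eqI[OF I])
    fix A assume "\<And>i. i \<in> I \<Longrightarrow> A i \<in> sets ?D"
    then have A: "\<And>i. i \<in> I \<Longrightarrow> A i \<in> sets N"
      by simp
    have "emeasure (distr ?Q ?Q (\<lambda>z. \<lambda>i\<in>I. g (z i))) (Pi\<^sub>E I A) =
        emeasure ?Q ((\<lambda>z. \<lambda>i\<in>I. g (z i)) -` Pi\<^sub>E I A \<inter> space ?Q)"
      using T A I by (intro emeasure_distr sets_PiM_I_finite) auto
    also have "(\<lambda>z. \<lambda>i\<in>I. g (z i)) -` Pi\<^sub>E I A \<inter> space ?Q = Pi\<^sub>E I (\<lambda>i. g -` A i \<inter> space N)"
      by (auto simp: space_PiM PiE_iff)
    also have "emeasure ?Q \<dots> = (\<Prod>i\<in>I. emeasure N (g -` A i \<inter> space N))"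
      using I A g by (intro QN.emeasure_PiM measurable_sets) auto
    also have "\<dots> = (\<Prod>i\<in>I. emeasure ?D (A i))"
      unfolding eq[symmetric] using A g by (intro prod.cong refl emeasure_distr[symmetric])
    finally show "emeasure (distr ?Q ?Q (\<lambda>z. \<lambda>i\<in>I. g (z i))) (Pi\<^sub>E I A) = (\<Prod>i\<in>I. emeasure ?D (A i))" .
  qed (simp add: setsQ)
  also have "\<dots> = density ?Q (\<lambda>w. \<Prod>i\<in>I. f (w i))"
  proof (rule QD.PiM_eqI[OF I, symmetric])
    fix A assume "\<And>i. i \<in> I \<Longrightarrow> A i \<in> sets ?D"
    then have A: "\<And>i. i \<in> I \<Longrightarrow> A i \<in> sets N"
      by simp
    have "emeasure (density ?Q (\<lambda>w. \<Prod>i\<in>I. f (w i))) (Pi\<^sub>E I A) =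
        (\<integral>\<^sup>+w. (\<Prod>i\<in>I. f (w i)) * indicator (Pi\<^sub>E I A) w \<partial>?Q)"
      using A I fi by (intro emeasure_density borel_measurable_prod_ennreal sets_PiM_I_finite) auto
    also have "\<dots> = (\<integral>\<^sup>+w. (\<Prod>i\<in>I. f (w i) * indicator (A i) (w i)) \<partial>?Q)"
    proof (rule nn_integral_cong)
      fix w assume "w \<in> space ?Q"
      then have "indicator (Pi\<^sub>E I A) w = (\<Prod>i\<in>I. indicator (A i) (w i) :: ennreal)"
        using I by (auto simp: space_PiM PiE_iff indicator_def prod_zero_iff intro!: prod.neutral)
      then show "(\<Prod>i\<in>I. f (w i)) * indicator (Pi\<^sub>E I A) w = (\<Prod>i\<in>I. f (w i) * indicator (A i) (w i))"
        by (simp add: prod.distrib)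
    qed
    also have "\<dots> = (\<Prod>i\<in>I. \<integral>\<^sup>+x. f x * indicator (A i) x \<partial>N)"
      using I f A by (intro QN.product_nn_integral_prod) auto
    also have "\<dots> = (\<Prod>i\<in>I. emeasure ?D (A i))"
      using f A by (intro prod.cong refl emeasure_density[symmetric])
    finally show "emeasure (density ?Q (\<lambda>w. \<Prod>i\<in>I. f (w i))) (Pi\<^sub>E I A) = (\<Prod>i\<in>I. emeasure ?D (A i))" .
  qed (simp add: setsQ)
  finally show ?thesis .
qed

lemma cyl_Int_UNIV: "cyl L \<inter> cyl UNIV = cyl L"
  by (auto simp: cyl_def)

lemma (in marked_transformation) act_Omega:
  assumes "\<omega> \<in> Omega"
  shows "act_conf (\<psi>, \<theta>) \<omega> \<in> Omega"
  unfolding Omega_def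
proof (intro CollectI conjI allI impI)
  show "act_conf (\<psi>, \<theta>) \<omega> \<subseteq> cyl UNIV"
    using Omega_pos[OF assms] g_cyl[of UNIV] by (auto simp: act_conf_def)
  have inj: "inj_on fst \<omega>"
    using assms by (simp add: Omega_def)
  show "inj_on fst (act_conf (\<psi>, \<theta>) \<omega>)"
  proof (rule inj_onI)
    fix y z assume "y \<in> act_conf (\<psi>, \<theta>) \<omega>" "z \<in> act_conf (\<psi>, \<theta>) \<omega>" and eq: "fst y = fst z"
    then obtain y' z' where yz: "y = g y'" "z = g z'" "y' \<in> \<omega>" "z' \<in> \<omega>"
      by (auto simp: act_conf_def)
    have "\<psi> (fst y') = \<psi> (fst z')"
      using eq by (simp add: yz g_eq)
    then have "fst y' = fst z'"
      using bij by (simp add: bij_is_inj inj_eq)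
    then show "y = z"
      using inj yz by (auto dest: inj_onD)
  qed
  fix C :: "'a set" assume "compact C"
  then have "compact (\<phi> ` C)"
    by (intro compact_continuous_image continuous_on_subset[OF cont_inv]) auto
  then have "finite (\<psi> ` (fst ` \<omega> \<inter> \<phi> ` C))"
    using assms by (intro finite_imageI) (simp add: Omega_def)
  moreover have "fst ` act_conf (\<psi>, \<theta>) \<omega> \<inter> C \<subseteq> \<psi> ` (fst ` \<omega> \<inter> \<phi> ` C)"
  proof
    fix x assume x: "x \<in> fst ` act_conf (\<psi>, \<theta>) \<omega> \<inter> C"
    then obtain z where z: "z \<in> \<omega>" "x = \<psi> (fst z)"
      by (auto simp: act_conf_def g_eq)
    then have "fst z = \<phi> x"
      by simp
    then have "fst z \<in> fst ` \<omega> \<inter> \<phi> ` C"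
      using x z(1) by blast
    then show "x \<in> \<psi> ` (fst ` \<omega> \<inter> \<phi> ` C)"
      using z(2) by blast
  qed
  ultimately show "finite (fst ` act_conf (\<psi>, \<theta>) \<omega> \<inter> C)"
    by (rule finite_subset[rotated])
qed

lemma (in marked_transformation) act_Int: "act_conf (\<psi>, \<theta>) \<omega> \<inter> B = act_conf (\<psi>, \<theta>) (\<omega> \<inter> g -` B)"
  by (auto simp: act_conf_def)

lemma (in marked_transformation) act_card: "card (act_conf (\<psi>, \<theta>) \<omega>) = card \<omega>"
  unfolding act_conf_def by (rule card_image) (rule inj_on_subset[OF inj_g], simp)

text \<open>
  Counting points of the image configuration in \<open>B\<close> amounts to counting points in the preimage of \<open>B\<close>, which
  lies in a cylinder over a relatively compact set again.
\<close>

lemma (in marked_transformation) act_measurable: "act_conf (\<psi>, \<theta>) \<in> measurable Omega_M Omega_M"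
proof (rule measurable_Omega_M)
  show "act_conf (\<psi>, \<theta>) \<in> space Omega_M \<rightarrow> Omega"
    using act_Omega by (auto simp: space_Omega_M)
  fix B :: "('a \<times> real) set" assume B: "B \<in> Bc_marked"
  have gb: "g \<in> borel_measurable borel"
    by (rule borel_measurable_continuous_onI[OF g_continuous])
  have "fst ` B \<in> sets borel" "compact (closure (fst ` B))"
    using B by (auto simp: Bc_marked_def Bc_def)
  have pb: "\<psi> -` (fst ` B) \<in> sets borel"
    by (rule measurable_sets_borel[OF borel_measurable_continuous_onI[OF cont]]) fact
  have "compact (\<phi> ` closure (fst ` B))"
    by (intro compact_continuous_image continuous_on_subset[OF cont_inv]) (simp, fact)
  moreover have "closure (\<psi> -` (fst ` B)) \<subseteq> \<phi> ` closure (fst ` B)"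
  proof (rule closure_minimal)
    show "\<psi> -` (fst ` B) \<subseteq> \<phi> ` closure (fst ` B)"
    proof
      fix x assume "x \<in> \<psi> -` (fst ` B)"
      then have "\<psi> x \<in> closure (fst ` B)"
        using closure_subset[of "fst ` B"] by (simp add: subset_iff)
      then show "x \<in> \<phi> ` closure (fst ` B)"
        by (rule rev_image_eqI) simp
    qed
    show "closed (\<phi> ` closure (fst ` B))"
      using calculation by (rule compact_imp_closed)
  qed
  ultimately have "compact (closure (\<psi> -` (fst ` B)))"
    using compact_Int_closed[of "\<phi> ` closure (fst ` B)" "closure (\<psi> -` (fst ` B))"] by (simp add: inf.absorb2)
  then have "\<psi> -` (fst ` B) \<in> Bc"
    using pb by (simp add: Bc_def)
  moreover have "g -` B \<in> sets borel"
    by (rule measurable_sets_borel[OF gb]) (use B in \<open>simp add: Bc_marked_def\<close>)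
  moreover have "g -` B \<subseteq> cyl (\<psi> -` (fst ` B))"
  proof
    fix z assume z: "z \<in> g -` B"
    then have "g z \<in> cyl UNIV"
      using B by (auto simp: Bc_marked_def)
    then have "z \<in> cyl UNIV"
      using g_cyl[of UNIV] by simp
    moreover have "\<psi> (fst z) \<in> fst ` B"
      using z by (auto simp: g_eq intro: rev_image_eqI)
    ultimately show "z \<in> cyl (\<psi> -` (fst ` B))"
      by (simp add: cyl_iff)
  qed
  ultimately show "(\<lambda>\<omega>. card (act_conf (\<psi>, \<theta>) \<omega> \<inter> B)) \<in> measurable Omega_M (count_space UNIV)"
    unfolding act_Int act_card by (rule card_measurable)
qed

definition distinct_positions :: "nat \<Rightarrow> (nat \<Rightarrow> 'a \<times> real) set" where
  "distinct_positions n = {z. inj_on (\<lambda>i. fst (z i)) {..<n}}"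

context
  fixes S :: "('a::{t2_space, second_countable_topology} \<times> real) measure" and L :: "'a set"
  assumes sets_S: "sets S = sets marked_space" and L: "L \<in> Bc"
begin

abbreviation "SL \<equiv> restrict_space S (cyl L)"
abbreviation "tuples n \<equiv> Pi\<^sub>M {..<n::nat} (\<lambda>_. SL)"

lemma space_SL: "space SL = cyl L"
  using sets_eq_imp_space_eq[OF sets_S] by (simp add: space_restrict_space cyl_Int_UNIV)

lemma cyl_sets_S: "cyl L \<in> sets S"
  using L unfolding sets_S by (intro cyl_marked) (simp add: Bc_def)

lemma SL_borel: "(\<lambda>z. z) \<in> borel_measurable SL"
proof -
  have "(\<lambda>z. z) \<in> borel_measurable (marked_space :: ('a \<times> real) measure)"
    unfolding marked_space_def by (rule measurable_restrict_space1) simp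
  then have "(\<lambda>z. z) \<in> borel_measurable S"
    by (simp only: measurable_cong_sets[OF sets_S refl])
  then show ?thesis
    by (rule measurable_restrict_space1)
qed

lemma component_borel:
  assumes "i < n"
  shows "(\<lambda>z. z i) \<in> borel_measurable (tuples n)" "(\<lambda>z. fst (z i)) \<in> borel_measurable (tuples n)"
proof -
  have "(\<lambda>z. z i) \<in> measurable (tuples n) SL"
    using assms by (intro measurable_component_singleton) simp
  from measurable_compose[OF this SL_borel]
  show 1: "(\<lambda>z. z i) \<in> borel_measurable (tuples n)" .
  have "(fst :: 'a \<times> real \<Rightarrow> 'a) \<in> borel_measurable borel"
    by (intro borel_measurable_continuous_onI continuous_intros)
  from measurable_compose[OF 1 this]
  show "(\<lambda>z. fst (z i)) \<in> borel_measurable (tuples n)" .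
qed

lemma distinct_positions_sets: "distinct_positions n \<inter> space (tuples n) \<in> sets (tuples n)"
proof -
  have D: "{z \<in> space (tuples n). fst (z i) = fst (z j)} \<in> sets (tuples n)" if "i < n" "j < n" for i j
  proof -
    have "(\<lambda>z. (fst (z i), fst (z j))) \<in> measurable (tuples n) (borel \<Otimes>\<^sub>M borel)"
      using that by (intro measurable_Pair component_borel)
    then have "(\<lambda>z. (fst (z i), fst (z j))) \<in> borel_measurable (tuples n)"
      by (simp add: borel_prod)
    from measurable_sets[OF this borel_closed[OF closed_diagonal]]
    have "(\<lambda>z. (fst (z i), fst (z j))) -` {y. \<exists>x. y = (x, x)} \<inter> space (tuples n) \<in> sets (tuples n)" .
    also have "(\<lambda>z. (fst (z i), fst (z j))) -` {y. \<exists>x. y = (x, x)} \<inter> space (tuples n) =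
        {z \<in> space (tuples n). fst (z i) = fst (z j)}"
      by auto
    finally show ?thesis .
  qed
  have "distinct_positions n \<inter> space (tuples n) =
      space (tuples n) - (\<Union>i<n. \<Union>j\<in>{..<n} - {i}. {z \<in> space (tuples n). fst (z i) = fst (z j)})"
    by (auto simp: distinct_positions_def inj_on_def)
  also have "\<dots> \<in> sets (tuples n)"
    using D by (intro sets.Diff sets.top sets.finite_UN) auto
  finally show ?thesis .
qed

lemma tuple_image_Omega:
  assumes z: "z \<in> space (tuples n)" "z \<in> distinct_positions n"
  shows "z ` {..<n} \<in> Omega"
  unfolding Omega_def
proof (intro CollectI conjI allI impI)
  show "z ` {..<n} \<subseteq> cyl UNIV"
    using z(1) by (auto simp: space_PiM space_SL PiE_iff cyl_iff)
  show "inj_on fst (z ` {..<n})"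
    using z(2) by (auto simp: distinct_positions_def inj_on_def)
qed auto

text \<open>
  For a tuple with distinct positions the number of points in \<open>B\<close> is the number of indices hitting \<open>B\<close>.
\<close>

lemma tuple_image_measurable:
  "(\<lambda>z. z ` {..<n}) \<in> measurable (restrict_space (tuples n) (distinct_positions n)) Omega_M"
proof (rule measurable_Omega_M)
  show "(\<lambda>z. z ` {..<n}) \<in> space (restrict_space (tuples n) (distinct_positions n)) \<rightarrow> Omega"
    using tuple_image_Omega by (auto simp: space_restrict_space)
  fix B :: "('a \<times> real) set" assume "B \<in> Bc_marked"
  then have B: "B \<in> sets borel"
    by (simp add: Bc_marked_def)
  have "(\<lambda>z. \<Sum>i<n. indicator B (z i) :: ennreal) \<in> borel_measurable (tuples n)"
  proof (intro borel_measurable_sum)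
    fix i assume "i \<in> {..<n}"
    then have "(\<lambda>z. z i) \<in> borel_measurable (tuples n)"
      by (intro component_borel) simp
    then show "(\<lambda>z. indicator B (z i) :: ennreal) \<in> borel_measurable (tuples n)"
      by (rule measurable_compose) (use B in simp)
  qed
  then have m: "(\<lambda>z. \<Sum>i<n. indicator B (z i) :: ennreal)
      \<in> borel_measurable (restrict_space (tuples n) (distinct_positions n))"
    by (rule measurable_restrict_space1)
  show "(\<lambda>z. card (z ` {..<n} \<inter> B)) \<in> measurable (restrict_space (tuples n) (distinct_positions n)) (count_space UNIV)"
  proof (rule measurable_nat_of_ennreal, rule measurable_cong[THEN iffD1, OF _ m])
    fix z assume "z \<in> space (restrict_space (tuples n) (distinct_positions n))"
    then have inj: "inj_on z {..<n}"
      by (auto simp: space_restrict_space distinct_positions_def inj_on_def)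
    have "z ` {..<n} \<inter> B = z ` {i. i < n \<and> z i \<in> B}"
      by auto
    then have "card (z ` {..<n} \<inter> B) = card {i. i < n \<and> z i \<in> B}"
      using card_image[OF inj_on_subset[OF inj, of "{i. i < n \<and> z i \<in> B}"]] by auto
    moreover have "(\<Sum>i<n. indicator B (z i) :: ennreal) = (\<Sum>i | i < n \<and> z i \<in> B. 1)"
      by (rule sum.mono_neutral_cong_right) (auto simp: indicator_def)
    ultimately show "(\<Sum>i<n. indicator B (z i) :: ennreal) = of_nat (card (z ` {..<n} \<inter> B))"
      by simp
  qed
qed

lemma poisson_component_eq:
  "poisson_component S L n =
    distr (restrict_space (tuples n) (distinct_positions n)) Omega_M (\<lambda>z. z ` {..<n})"
  by (simp add: poisson_component_def distinct_positions_def)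

lemma nn_integral_poisson_component:
  assumes u: "u \<in> borel_measurable Omega_M"
  shows "(\<integral>\<^sup>+\<omega>. u \<omega> \<partial>poisson_component S L n) =
    (\<integral>\<^sup>+z\<in>distinct_positions n. u (z ` {..<n}) \<partial>tuples n)"
proof -
  have "(\<integral>\<^sup>+\<omega>. u \<omega> \<partial>poisson_component S L n) =
      (\<integral>\<^sup>+z. u (z ` {..<n}) \<partial>restrict_space (tuples n) (distinct_positions n))"
    unfolding poisson_component_eq using tuple_image_measurable u by (intro nn_integral_distr) auto
  also have "\<dots> = (\<integral>\<^sup>+z\<in>distinct_positions n. u (z ` {..<n}) \<partial>tuples n)"
    using distinct_positions_sets by (rule nn_integral_restrict_space)
  finally show ?thesis .
qed

lemma tuple_functional_measurable:
  assumes u: "u \<in> borel_measurable Omega_M"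
  shows "(\<lambda>z. u (z ` {..<n}) * indicator (distinct_positions n) z :: ennreal) \<in> borel_measurable (tuples n)"
  using measurable_compose[OF tuple_image_measurable u] distinct_positions_sets
  by (subst (asm) borel_measurable_restrict_space_iff_ennreal) auto

end

text \<open>
  How a Poisson measure transforms depends on the intensity measure only through the density \<open>f\<close> of its
  image, which has to be finite everywhere and equal to 1 off \<open>K\<close>.
\<close>

locale marked_poisson_action = marked_transformation \<psi> \<theta> K
  for \<psi> :: "'a::{t2_space, second_countable_topology} \<Rightarrow> 'a" and \<theta> K +
  fixes S :: "('a \<times> real) measure" and P :: "('a \<times> real) set measure" and f :: "'a \<times> real \<Rightarrow> ennreal"
  assumes sets_S: "sets S = sets marked_space"
    and locally_finite: "\<And>L. open L \<Longrightarrow> compact (closure L) \<Longrightarrow> emeasure S (cyl L) < \<infinity>"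
    and relatively_compact_nbhd: "\<And>C :: 'a set. compact C \<Longrightarrow> \<exists>L. open L \<and> C \<subseteq> L \<and> compact (closure L)"
    and f_measurable: "f \<in> borel_measurable S" and f_finite: "\<And>z. f z < \<infinity>"
    and f_off_K: "\<And>z. z \<notin> K \<times> UNIV \<Longrightarrow> f z = 1"
    and transformed: "distr S S g = density S f"
    and poisson: "marked_poisson S P"
begin

lemma sets_P: "sets P = sets Omega_M" and prob_P: "prob_space P"
  using poisson by (auto simp: marked_poisson_def)

lemma space_P: "space P = Omega"
  using sets_eq_imp_space_eq[OF sets_P] by (simp add: space_Omega_M)

lemma space_S: "space S = cyl UNIV"
  using sets_eq_imp_space_eq[OF sets_S] by simp

lemma g_measurable_S: "g \<in> measurable S S"
  using g_measurable by (simp only: measurable_cong_sets[OF sets_S sets_S])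

text \<open>
  A bounded observation window that contains the support of the transformation.
\<close>

definition window :: "'a set \<Rightarrow> bool" where
  "window L \<longleftrightarrow> open L \<and> compact (closure L) \<and> K \<subseteq> L"

lemma conf_density_measurable: "conf_prod f \<in> borel_measurable Omega_M"
proof -
  obtain L where L: "open L" "K \<subseteq> L" "compact (closure L)"
    using relatively_compact_nbhd[OF K] by blast
  have "f \<in> borel_measurable marked_space"
    using f_measurable by (simp only: measurable_cong_sets[OF sets_S refl])
  then show ?thesis
    by (rule conf_prod_measurable[OF _ f_finite f_off_K _ L(2)]) (use L in \<open>simp_all add: Bc_def\<close>)
qed

lemma conf_density_measurable_on:
  "E \<in> sets Omega_M \<Longrightarrow> (\<lambda>\<omega>. conf_prod f \<omega> * indicator E \<omega>) \<in> borel_measurable Omega_M"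
  using conf_density_measurable by (intro borel_measurable_times_ennreal borel_measurable_indicator)

context
  fixes L assumes L: "window L"
begin

lemma L_Bc: "L \<in> Bc" and K_subset: "K \<subseteq> L"
  using L by (auto simp: window_def Bc_def)

abbreviation "R \<equiv> restrict_space S (cyl L)"
abbreviation "T n \<equiv> Pi\<^sub>M {..<n::nat} (\<lambda>_. R)"

lemma space_R: "space R = cyl L"
  by (rule space_SL[OF sets_S L_Bc])

lemma sets_R_iff: "E \<in> sets R \<longleftrightarrow> E \<in> sets S \<and> E \<subseteq> cyl L"
  using cyl_sets_S[OF sets_S L_Bc] by (subst sets_restrict_space_iff) (auto simp: space_S cyl_Int_UNIV)

lemma finite_R: "finite_measure R"
proof
  have "emeasure R (space R) = emeasure S (cyl L)"
    unfolding space_R using cyl_sets_S[OF sets_S L_Bc]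
    by (intro emeasure_restrict_space) (simp_all add: space_S cyl_Int_UNIV)
  then show "emeasure R (space R) \<noteq> \<infinity>"
    using locally_finite[of L] L by (simp add: window_def less_top)
qed

lemma g_measurable_R: "g \<in> measurable R R"
proof (rule measurable_restrict_space2)
  show "g \<in> space R \<rightarrow> cyl L"
    using g_cyl[OF K_subset] by (auto simp: space_R)
  show "g \<in> measurable R S"
    by (rule measurable_restrict_space1[OF g_measurable_S])
qed

lemma f_measurable_R: "f \<in> borel_measurable R"
  by (rule measurable_restrict_space1[OF f_measurable])

lemma transformed_R: "distr R R g = density R f"
proof (rule measure_eqI)
  fix E assume "E \<in> sets (distr R R g)"
  then have ER: "E \<in> sets R"
    by simp
  then have E: "E \<in> sets S" "E \<subseteq> cyl L"
    by (simp_all add: sets_R_iff)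
  have cyl: "cyl L \<inter> space S \<in> sets S"
    using cyl_sets_S[OF sets_S L_Bc] by (simp add: space_S cyl_Int_UNIV)
  have "emeasure (distr R R g) E = emeasure R (g -` E \<inter> space R)"
    using g_measurable_R ER by (rule emeasure_distr)
  also have "\<dots> = emeasure S (g -` E \<inter> space R)"
    using cyl by (intro emeasure_restrict_space) (auto simp: space_R)
  also have "g -` E \<inter> space R = g -` E \<inter> space S"
  proof -
    have "z \<in> cyl L" if "g z \<in> E" for z
      using that E(2) g_cyl[OF K_subset, of z] by blast
    moreover have "cyl L \<subseteq> cyl UNIV"
      by (auto simp: cyl_def)
    ultimately show ?thesis
      unfolding space_R space_S by blast
  qed
  also have "emeasure S \<dots> = emeasure (density S f) E"
    unfolding transformed[symmetric] using g_measurable_S E(1) by (rule emeasure_distr[symmetric])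
  also have "\<dots> = (\<integral>\<^sup>+z\<in>E. f z \<partial>S)"
    using f_measurable E(1) by (rule emeasure_density)
  also have "\<dots> = (\<integral>\<^sup>+z. f z * indicator E z * indicator (cyl L) z \<partial>S)"
    using E(2) by (intro nn_integral_cong) (auto split: split_indicator)
  also have "\<dots> = (\<integral>\<^sup>+z\<in>E. f z \<partial>R)"
    by (rule nn_integral_restrict_space[OF cyl, symmetric])
  also have "\<dots> = emeasure (density R f) E"
    using f_measurable_R ER by (rule emeasure_density[symmetric])
  finally show "emeasure (distr R R g) E = emeasure (density R f) E" .
qed simp

lemma sets_poisson_component: "sets (poisson_component S L n) = sets Omega_M"
  unfolding poisson_component_def by (rule sets_distr)

text \<open>
  Applying the transformation to all points of a tuple turns the product measure into the one with
  density \<open>\<Prod>i. f (w i)\<close>.  It preserves distinctness of the positions, and for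
  a tuple with distinct positions this product is the product over its configuration.
\<close>

lemma poisson_component_transformed:
  assumes E: "E \<in> sets Omega_M"
  shows "emeasure (poisson_component S L n) (act_conf (\<psi>, \<theta>) -` E \<inter> Omega) =
    (\<integral>\<^sup>+\<omega>\<in>E. conf_prod f \<omega> \<partial>poisson_component S L n)"
proof -
  let ?I = "{..<n}" and ?D = "distinct_positions n :: (nat \<Rightarrow> 'a \<times> real) set"
  define t where "t z = (\<lambda>i\<in>?I. g (z i))" for z :: "nat \<Rightarrow> 'a \<times> real"
  define u where "u w = (indicator E (w ` ?I) * indicator ?D w :: ennreal)" for w :: "nat \<Rightarrow> 'a \<times> real"
  have gE: "act_conf (\<psi>, \<theta>) -` E \<inter> Omega \<in> sets Omega_M"
    using measurable_sets[OF act_measurable E] by (simp add: space_Omega_M)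
  have comp: "(\<lambda>z. z i) \<in> measurable (T n) R" if "i \<in> ?I" for i
    using that by (rule measurable_component_singleton)
  have um: "u \<in> borel_measurable (T n)"
    unfolding u_def[abs_def] using E by (intro tuple_functional_measurable[OF sets_S L_Bc]) simp
  have tm: "t \<in> measurable (T n) (T n)"
    unfolding t_def[abs_def]
    by (intro measurable_restrict measurable_compose[OF comp g_measurable_R])
  have fm: "(\<lambda>w. \<Prod>i\<in>?I. f (w i)) \<in> borel_measurable (T n)"
    by (intro borel_measurable_prod_ennreal measurable_compose[OF comp f_measurable_R])
  have t_image: "t z ` ?I = act_conf (\<psi>, \<theta>) (z ` ?I)" for z
    by (auto simp: t_def act_conf_def image_image)
  have t_D: "t z \<in> ?D \<longleftrightarrow> z \<in> ?D" for z
  proof -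
    have "inj_on (\<lambda>i. fst (t z i)) ?I \<longleftrightarrow> inj_on (\<lambda>i. \<psi> (fst (z i))) ?I"
      by (rule inj_on_cong) (simp add: t_def g_eq)
    also have "\<dots> \<longleftrightarrow> inj_on (\<lambda>i. fst (z i)) ?I"
      by (simp add: inj_on_def inj_eq[OF bij_is_inj[OF bij]])
    finally show ?thesis
      by (simp add: distinct_positions_def)
  qed
  have "emeasure (poisson_component S L n) (act_conf (\<psi>, \<theta>) -` E \<inter> Omega) =
      (\<integral>\<^sup>+\<omega>. indicator (act_conf (\<psi>, \<theta>) -` E \<inter> Omega) \<omega> \<partial>poisson_component S L n)"
    by (rule nn_integral_indicator[symmetric]) (simp only: sets_poisson_component gE)
  also have "\<dots> = (\<integral>\<^sup>+z\<in>?D. indicator (act_conf (\<psi>, \<theta>) -` E \<inter> Omega) (z ` ?I) \<partial>T n)"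
    using gE by (intro nn_integral_poisson_component[OF sets_S L_Bc]) simp
  also have "\<dots> = (\<integral>\<^sup>+z. u (t z) \<partial>T n)"
  proof (rule nn_integral_cong)
    fix z assume "z \<in> space (T n)"
    then show "indicator (act_conf (\<psi>, \<theta>) -` E \<inter> Omega) (z ` ?I) * indicator ?D z = (u (t z) :: ennreal)"
      using tuple_image_Omega[OF sets_S L_Bc, of z n] t_D[of z]
      by (auto simp: u_def t_image split: split_indicator)
  qed
  also have "\<dots> = (\<integral>\<^sup>+w. u w \<partial>distr (T n) (T n) t)"
    using tm um by (intro nn_integral_distr[symmetric]) auto
  also have "distr (T n) (T n) t = density (T n) (\<lambda>w. \<Prod>i\<in>?I. f (w i))"
    unfolding t_def[abs_def]
    by (rule distr_PiM_density[OF finite_R g_measurable_R f_measurable_R transformed_R]) simp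
  also have "(\<integral>\<^sup>+w. u w \<partial>\<dots>) = (\<integral>\<^sup>+w. (\<Prod>i\<in>?I. f (w i)) * u w \<partial>T n)"
    using fm um by (rule nn_integral_density)
  also have "\<dots> = (\<integral>\<^sup>+w\<in>?D. conf_prod f (w ` ?I) * indicator E (w ` ?I) \<partial>T n)"
  proof (rule nn_integral_cong)
    fix w
    have "conf_prod f (w ` ?I) = (\<Prod>i\<in>?I. f (w i))" if "w \<in> ?D"
    proof -
      have "inj_on w ?I"
        using that by (auto simp: distinct_positions_def inj_on_def)
      then show ?thesis
        by (simp add: conf_prod_finite prod.reindex)
    qed
    then show "(\<Prod>i\<in>?I. f (w i)) * u w = conf_prod f (w ` ?I) * indicator E (w ` ?I) * indicator ?D w"
      by (auto simp: u_def split: split_indicator)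
  qed
  also have "\<dots> = (\<integral>\<^sup>+\<omega>\<in>E. conf_prod f \<omega> \<partial>poisson_component S L n)"
    by (rule nn_integral_poisson_component[OF sets_S L_Bc conf_density_measurable_on[OF E], symmetric])
  finally show ?thesis .
qed

definition local_law :: "('a \<times> real) set measure" where
  "local_law = distr P Omega_M (\<lambda>\<omega>. \<omega> \<inter> cyl L)"

lemma restrict_measurable: "(\<lambda>\<omega>. \<omega> \<inter> cyl L) \<in> measurable P Omega_M"
  using restriction_measurable[of L] L_Bc by (simp only: measurable_cong_sets[OF sets_P refl]) (simp add: Bc_def)

lemma local_law_sum:
  assumes "E \<in> sets Omega_M"
  shows "emeasure local_law E =
    (\<Sum>n. ennreal (exp (- measure S (cyl L))) * ennreal (1 / fact n) * emeasure (poisson_component S L n) E)"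
proof -
  have "emeasure local_law E = ennreal (exp (- measure S (cyl L))) *
      (\<Sum>n. ennreal (1 / fact n) * emeasure (poisson_component S L n) E)"
    using poisson L assms unfolding marked_poisson_def window_def local_law_def by blast
  then show ?thesis
    by (simp only: ennreal_suminf_cmult mult.assoc)
qed

text \<open>
  The transformation maps the window onto itself, so the total mass in the exponential factor of the Poisson law is
  unchanged and the densities of the components carry over to their weighted sum.
\<close>

lemma local_law_transformed:
  assumes E: "E \<in> sets Omega_M"
  shows "emeasure local_law (act_conf (\<psi>, \<theta>) -` E \<inter> Omega) = (\<integral>\<^sup>+\<omega>\<in>E. conf_prod f \<omega> \<partial>local_law)"
proof -
  have gE: "act_conf (\<psi>, \<theta>) -` E \<inter> Omega \<in> sets Omega_M"
    using measurable_sets[OF act_measurable E] by (simp add: space_Omega_M)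
  have sets_ll: "sets local_law = sets Omega_M"
    by (simp add: local_law_def)
  have "(\<integral>\<^sup>+\<omega>\<in>E. conf_prod f \<omega> \<partial>local_law) =
      (\<Sum>n. ennreal (exp (- measure S (cyl L))) * ennreal (1 / fact n) *
        (\<integral>\<^sup>+\<omega>\<in>E. conf_prod f \<omega> \<partial>poisson_component S L n))"
  proof (rule nn_integral_sum_of_measures)
    show "sets (poisson_component S L n) = sets local_law" for n
      by (simp only: sets_poisson_component sets_ll)
    show "(\<lambda>\<omega>. conf_prod f \<omega> * indicator E \<omega>) \<in> borel_measurable local_law"
      unfolding measurable_cong_sets[OF sets_ll refl]
      by (rule conf_density_measurable_on[OF E])
  qed (use local_law_sum sets_ll in blast)
  then show ?thesis
    by (simp only: local_law_sum[OF gE] poisson_component_transformed[OF E])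
qed

end

text \<open>
  Events that depend on the configuration in a window form an intersection stable generator of the
  sigma-algebra.  On them both measures are computed from the law in the window, since the
  points outside of it are fixed and contribute only factors 1.
\<close>

lemma distr_poisson: "distr P Omega_M (act_conf (\<psi>, \<theta>)) = density P (conf_prod f)"
proof -
  define F :: "('a \<times> real) set set set" where
    "F = {{\<omega> \<in> Omega. \<omega> \<inter> cyl L \<in> E} | L E. window L \<and> E \<in> sets Omega_M}"
  interpret prob_space P by (rule prob_P)
  have cm: "conf_prod f \<in> borel_measurable P"
    using conf_density_measurable by (simp only: measurable_cong_sets[OF sets_P refl])
  have am: "act_conf (\<psi>, \<theta>) \<in> measurable P Omega_M"
    using act_measurable by (simp only: measurable_cong_sets[OF sets_P refl])
  have rm: "{\<omega> \<in> Omega. \<omega> \<inter> cyl L \<in> E} \<in> sets Omega_M" if "window L" "E \<in> sets Omega_M" for L E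
  proof -
    have "(\<lambda>\<omega>. \<omega> \<inter> cyl L) \<in> measurable Omega_M Omega_M"
      using that by (intro restriction_measurable) (simp add: window_def)
    from measurable_sets[OF this that(2)]
    have "(\<lambda>\<omega>. \<omega> \<inter> cyl L) -` E \<inter> Omega \<in> sets Omega_M"
      by (simp only: space_Omega_M)
    also have "(\<lambda>\<omega>. \<omega> \<inter> cyl L) -` E \<inter> Omega = {\<omega> \<in> Omega. \<omega> \<inter> cyl L \<in> E}"
      by auto
    finally show ?thesis .
  qed
  obtain L0 where L0: "window L0"
    using relatively_compact_nbhd[OF K] by (auto simp: window_def)
  have "Omega = {\<omega> \<in> Omega. \<omega> \<inter> cyl L0 \<in> Omega}"
    by (auto intro: Omega_subset)
  then have Omega_F: "Omega \<in> F"
    unfolding F_def using L0 sets.top[of Omega_M] unfolding space_Omega_M by blast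
  have F_sets: "F \<subseteq> sets Omega_M"
    unfolding F_def using rm by auto
  have gen: "sets Omega_M = sigma_sets Omega F"
  proof (intro equalityI)
    show "sets Omega_M \<subseteq> sigma_sets Omega F"
      unfolding sets_Omega_M
    proof (rule sigma_sets_mono, safe)
      fix B :: "('a \<times> real) set" and N assume B: "B \<in> Bc_marked"
      let ?X = "(\<lambda>\<omega>. card (\<omega> \<inter> B)) -` N \<inter> Omega"
      have "compact (closure (fst ` B) \<union> K)"
        using B K by (intro compact_Un) (simp_all add: Bc_marked_def Bc_def)
      then obtain L where L: "open L" "closure (fst ` B) \<union> K \<subseteq> L" "compact (closure L)"
        using relatively_compact_nbhd by blast
      then have "window L"
        by (simp add: window_def)
      have BL: "B \<subseteq> cyl L"
      proof
        fix z assume z: "z \<in> B"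
        then have "fst z \<in> L"
          using L(2) closure_subset[of "fst ` B"] by blast
        moreover have "z \<in> cyl UNIV"
          using B z by (auto simp: Bc_marked_def)
        ultimately show "z \<in> cyl L"
          by (simp add: cyl_iff)
      qed
      have "?X \<in> sets Omega_M"
        unfolding sets_Omega_M using B by (intro sigma_sets.Basic) auto
      moreover have "?X = {\<omega> \<in> Omega. \<omega> \<inter> cyl L \<in> ?X}"
      proof -
        have "\<omega> \<inter> cyl L \<inter> B = \<omega> \<inter> B" for \<omega>
          using BL by auto
        then show ?thesis
          by (auto intro: Omega_subset)
      qed
      ultimately have "?X \<in> F"
        unfolding F_def using \<open>window L\<close> by blast
      then show "?X \<in> sigma_sets Omega F"
        by (rule sigma_sets.Basic)
    qed
    show "sigma_sets Omega F \<subseteq> sets Omega_M"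
      using sets.sigma_sets_subset[OF F_sets] by (simp add: space_Omega_M)
  qed
  show ?thesis
  proof (rule measure_eqI_generator_eq[where E = F and \<Omega> = Omega and A = "\<lambda>_. Omega"])
    show "Int_stable F"
      unfolding Int_stable_def
    proof (intro ballI)
      fix X Y assume "X \<in> F" "Y \<in> F"
      then obtain L1 E1 L2 E2 where X: "X = {\<omega> \<in> Omega. \<omega> \<inter> cyl L1 \<in> E1}" "window L1" "E1 \<in> sets Omega_M"
        and Y: "Y = {\<omega> \<in> Omega. \<omega> \<inter> cyl L2 \<in> E2}" "window L2" "E2 \<in> sets Omega_M"
        by (auto simp: F_def)
      (* Two events observed in L1 and in L2 are both observed in the union, which is a window again. *)
      have adm: "window (L1 \<union> L2)"
        using X(2) Y(2) by (auto simp: window_def closure_Un)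
      have "X \<inter> Y \<in> sets Omega_M"
        using rm X Y by auto
      moreover have "X \<inter> Y = {\<omega> \<in> Omega. \<omega> \<inter> cyl (L1 \<union> L2) \<in> X \<inter> Y}"
      proof -
        have "\<omega> \<inter> cyl (L1 \<union> L2) \<inter> cyl L1 = \<omega> \<inter> cyl L1" "\<omega> \<inter> cyl (L1 \<union> L2) \<inter> cyl L2 = \<omega> \<inter> cyl L2" for \<omega>
          by (auto simp: cyl_iff)
        then show ?thesis
          unfolding X(1) Y(1) by (auto intro: Omega_subset)
      qed
      ultimately show "X \<inter> Y \<in> F"
        unfolding F_def using adm by blast
    qed
    show "F \<subseteq> Pow Omega"
      by (auto simp: F_def)
    show "sets (distr P Omega_M (act_conf (\<psi>, \<theta>))) = sigma_sets Omega F"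
      by (simp only: sets_distr gen)
    show "sets (density P (conf_prod f)) = sigma_sets Omega F"
      by (simp only: sets_density sets_P gen)
    show "range (\<lambda>_::nat. Omega) \<subseteq> F"
      using Omega_F by auto
    interpret D: prob_space "distr P Omega_M (act_conf (\<psi>, \<theta>))"
      using am by (rule prob_space_distr)
    show "emeasure (distr P Omega_M (act_conf (\<psi>, \<theta>))) Omega \<noteq> \<infinity>" for i :: nat
      using D.emeasure_finite by simp
    fix X assume "X \<in> F"
    then obtain L E where X: "X = {\<omega> \<in> Omega. \<omega> \<inter> cyl L \<in> E}" and L: "window L" and E: "E \<in> sets Omega_M"
      by (auto simp: F_def)
    have K_subset: "K \<subseteq> L"
      using L by (simp add: window_def)
    have Xs: "X \<in> sets Omega_M"
      using rm[OF L E] by (simp add: X)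
    have gE: "act_conf (\<psi>, \<theta>) -` E \<inter> Omega \<in> sets Omega_M"
      using measurable_sets[OF act_measurable E] by (simp add: space_Omega_M)
    have act_cyl: "act_conf (\<psi>, \<theta>) \<omega> \<inter> cyl L = act_conf (\<psi>, \<theta>) (\<omega> \<inter> cyl L)" for \<omega>
      unfolding act_Int using g_cyl[OF K_subset] by (simp add: vimage_def)
    have "emeasure (distr P Omega_M (act_conf (\<psi>, \<theta>))) X = emeasure P (act_conf (\<psi>, \<theta>) -` X \<inter> space P)"
      using am Xs by (rule emeasure_distr)
    also have "act_conf (\<psi>, \<theta>) -` X \<inter> space P =
        (\<lambda>\<omega>. \<omega> \<inter> cyl L) -` (act_conf (\<psi>, \<theta>) -` E \<inter> Omega) \<inter> space P"
    proof (rule Set.set_eqI)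
      fix \<omega>
      have "act_conf (\<psi>, \<theta>) \<omega> \<in> Omega" "\<omega> \<inter> cyl L \<in> Omega" if "\<omega> \<in> Omega"
        using that by (rule act_Omega, rule Omega_subset) auto
      then show "\<omega> \<in> act_conf (\<psi>, \<theta>) -` X \<inter> space P \<longleftrightarrow>
          \<omega> \<in> (\<lambda>\<omega>. \<omega> \<inter> cyl L) -` (act_conf (\<psi>, \<theta>) -` E \<inter> Omega) \<inter> space P"
        by (simp add: X space_P act_cyl) blast
    qed
    also have "emeasure P \<dots> = emeasure (local_law L) (act_conf (\<psi>, \<theta>) -` E \<inter> Omega)"
      unfolding local_law_def[OF L] using restrict_measurable[OF L] gE by (rule emeasure_distr[symmetric])
    also have "\<dots> = (\<integral>\<^sup>+\<omega>\<in>E. conf_prod f \<omega> \<partial>local_law L)"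
      by (rule local_law_transformed[OF L E])
    also have "\<dots> = (\<integral>\<^sup>+\<omega>. conf_prod f (\<omega> \<inter> cyl L) * indicator E (\<omega> \<inter> cyl L) \<partial>P)"
      unfolding local_law_def[OF L] using restrict_measurable[OF L] conf_density_measurable_on[OF E]
      by (intro nn_integral_distr) auto
    also have "\<dots> = (\<integral>\<^sup>+\<omega>\<in>X. conf_prod f \<omega> \<partial>P)"
    proof (rule nn_integral_cong)
      fix \<omega> assume "\<omega> \<in> space P"
      then have w: "\<omega> \<in> Omega"
        by (simp add: space_P)
      then have "indicator E (\<omega> \<inter> cyl L) = (indicator X \<omega> :: ennreal)"
        by (simp add: X indicator_def)
      then show "conf_prod f (\<omega> \<inter> cyl L) * indicator E (\<omega> \<inter> cyl L) = conf_prod f \<omega> * indicator X \<omega>"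
        using conf_prod_restrict[OF f_off_K K_subset w] by simp
    qed
    also have "\<dots> = emeasure (density P (conf_prod f)) X"
      by (rule emeasure_density[symmetric, OF cm]) (simp only: sets_P Xs)
    finally show "emeasure (distr P Omega_M (act_conf (\<psi>, \<theta>))) X = emeasure (density P (conf_prod f)) X" .
  qed simp
qed

end

section \<open>Quasiinvariance under the marked group\<close>

context riemannian_manifold
begin

lemma smooth_function_continuous:
  assumes "smooth_function A \<theta>"
  shows "continuous_on UNIV \<theta>"
proof -
  have "isCont \<theta> x" for x
  proof -
    obtain c where c: "c \<in> A" "x \<in> cdom c"
      using chart_at by blast
    have "smooth_on (crd c ` cdom c) (\<theta> \<circ> cinv c)"
      using assms c(1) by (simp add: smooth_function_def)
    then have "continuous_on (crd c ` cdom c) (\<theta> \<circ> cinv c)"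
      by (rule smooth_on_continuous)
    then have "continuous_on (cdom c) (\<lambda>x. (\<theta> \<circ> cinv c) (crd c x))"
      by (rule continuous_on_compose2[OF _ cont_crd[OF c(1)]]) auto
    then have "continuous_on (cdom c) \<theta>"
      by (rule continuous_on_cong[THEN iffD1, rotated 2]) (simp_all add: cinv_crd[OF c(1)])
    then show ?thesis
      using c(2) chart_open(1)[OF c(1)] by (simp add: continuous_on_eq_continuous_at)
  qed
  then show ?thesis
    by (simp add: continuous_at_imp_continuous_on)
qed

lemma relatively_compact_nbhd:
  fixes C :: "'a set"
  assumes "compact C"
  shows "\<exists>L. open L \<and> C \<subseteq> L \<and> compact (closure L)"
proof -
  have "\<forall>x::'a. \<exists>U. open U \<and> x \<in> U \<and> compact (closure U)"
    using finite_relatively_compact_nbhd by blast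
  from choice[OF this] obtain U :: "'a \<Rightarrow> 'a set"
    where U: "\<And>x. open (U x)" "\<And>x. x \<in> U x" "\<And>x. compact (closure (U x))"
    by blast
  have cover: "C \<subseteq> (\<Union>x\<in>C. U x)"
    using U(2) by blast
  obtain D where D: "finite D" "C \<subseteq> (\<Union>x\<in>D. U x)"
    by (rule compactE_image[OF assms U(1) cover])
  have "closure (\<Union>x\<in>D. U x) = (\<Union>x\<in>D. closure (U x))"
    using D(1) by (induction D) (simp_all add: closure_Un)
  moreover have "compact (\<Union>x\<in>D. closure (U x))"
    using D(1) U(3) by (intro compact_UN) auto
  ultimately show ?thesis
    using D(2) U(1) by (intro exI[of _ "\<Union>x\<in>D. U x"]) auto
qed

lemma marked_group_transformation:
  assumes "(\<psi>, \<theta>) \<in> carrier (marked_group A)"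
  shows "diffeomorphism A \<psi>" "\<exists>K. marked_transformation \<psi> \<theta> K"
proof -
  have carrier: "\<psi> \<in> Diff0 A" "\<theta> \<in> Scale0 A"
    using assms by (simp_all add: marked_group_def)
  obtain K1 where \<psi>: "diffeomorphism A \<psi>" "compact K1" "\<And>x. x \<notin> K1 \<Longrightarrow> \<psi> x = x"
    using carrier(1) unfolding Diff0_def by blast
  obtain K2 where \<theta>: "smooth_function A \<theta>" "\<And>x. \<theta> x > 0" "compact K2" "\<And>x. x \<notin> K2 \<Longrightarrow> \<theta> x = 1"
    using carrier(2) unfolding Scale0_def by blast
  have "marked_transformation \<psi> \<theta> (K1 \<union> K2)"
  proof
    show "compact (K1 \<union> K2)"
      using \<psi>(2) \<theta>(3) by (rule compact_Un)
  qed (use \<psi> \<theta> diffeo_bij[OF \<psi>(1)] diffeo_continuous[OF \<psi>(1)] smooth_function_continuous[OF \<theta>(1)] in auto)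
  with \<psi>(1) show "diffeomorphism A \<psi>" "\<exists>K. marked_transformation \<psi> \<theta> K"
    by auto
qed

end

context marked_action
begin

lemma distr_marked_poisson:
  assumes P: "marked_poisson S P"
  shows "conf_prod f \<in> borel_measurable P"
    and "distr P Omega_M (act_conf (\<psi>, \<theta>)) = density P (conf_prod f)"
proof -
  interpret action: marked_poisson_action \<psi> \<theta> K S P f
  proof
    show "f \<in> borel_measurable S"
      using f_measurable by (simp only: measurable_cong_sets[OF trans[OF sets_sigma_tilde sets_marked[symmetric]] refl])
    show "emeasure S (cyl L) < \<infinity>" if "open L" "compact (closure L)" for L
      by (rule sigma_tilde_cyl_finite[OF open_Bc[OF that]])
    show "\<exists>L. open L \<and> C \<subseteq> L \<and> compact (closure L)" if "compact C" for C :: "'a set"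
      using that by (rule relatively_compact_nbhd)
  qed (rule sets_sigma_tilde f_finite f_off_K distr_sigma_tilde P; assumption?)+
  show "conf_prod f \<in> borel_measurable P"
    using action.conf_density_measurable by (simp only: measurable_cong_sets[OF action.sets_P refl])
  show "distr P Omega_M (act_conf (\<psi>, \<theta>)) = density P (conf_prod f)"
    by (rule action.distr_poisson)
qed

lemma inverse_action: "marked_action A G m \<rho> p \<phi> (\<lambda>x. inverse (\<theta> (\<psi> x))) K"
  by (intro marked_action.intro marked_action_axioms.intro marked_setting_axioms inverse_transformation
      diffeomorphism_inverse diffeo)

lemma absolutely_continuous_action:
  assumes "marked_poisson S P"
  shows "absolutely_continuous P (distr P Omega_M (act_conf (\<psi>, \<theta>)))"
  unfolding distr_marked_poisson(2)[OF assms]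
  by (rule absolutely_continuousI_density[OF distr_marked_poisson(1)[OF assms]])

text \<open>
  If the preimage of \<open>N\<close> under the action is null, apply the inverse transformation, which preserves null sets
  by the same theorem: the preimage of the preimage is \<open>N\<close>.
\<close>

lemma absolutely_continuous_action_converse:
  assumes P: "marked_poisson S P"
  shows "absolutely_continuous (distr P Omega_M (act_conf (\<psi>, \<theta>))) P"
  unfolding absolutely_continuous_def
proof
  let ?h = "(\<phi>, \<lambda>x. inverse (\<theta> (\<psi> x)))"
  have sets_P: "sets P = sets Omega_M"
    using P by (simp add: marked_poisson_def)
  have space_P: "space P = Omega"
    using sets_eq_imp_space_eq[OF sets_P] by (simp add: space_Omega_M)
  have am: "act_conf (\<psi>, \<theta>) \<in> measurable P Omega_M"
    using act_measurable by (simp only: measurable_cong_sets[OF sets_P refl])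
  have hm: "act_conf ?h \<in> measurable P Omega_M"
    using marked_transformation.act_measurable[OF inverse_transformation]
    by (simp only: measurable_cong_sets[OF sets_P refl])
  have ac: "absolutely_continuous P (distr P Omega_M (act_conf ?h))"
    by (rule marked_action.absolutely_continuous_action[OF inverse_action P])
  fix N assume N: "N \<in> null_sets (distr P Omega_M (act_conf (\<psi>, \<theta>)))"
  then have Ns: "N \<in> sets Omega_M"
    by auto
  let ?M = "act_conf (\<psi>, \<theta>) -` N \<inter> space P"
  have Ms: "?M \<in> sets P"
    using am Ns by (rule measurable_sets)
  have "emeasure P ?M = 0"
    using N am Ns by (simp add: null_sets_def emeasure_distr)
  then have "?M \<in> null_sets P"
    using Ms by (rule null_setsI)
  then have "?M \<in> null_sets (distr P Omega_M (act_conf ?h))"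
    using ac by (auto simp: absolutely_continuous_def)
  then have 0: "emeasure (distr P Omega_M (act_conf ?h)) ?M = 0"
    by auto
  have "?M \<in> sets Omega_M"
    using Ms by (simp only: sets_P)
  from emeasure_distr[OF hm this] 0
  have "emeasure P (act_conf ?h -` ?M \<inter> space P) = 0"
    by (simp only:)
  also have "act_conf ?h -` ?M \<inter> space P = N"
  proof -
    have "act_conf (\<psi>, \<theta>) (act_conf ?h \<omega>) = \<omega>" for \<omega>
      by (simp only: act_conf_def image_image gh image_ident)
    moreover have "act_conf ?h \<omega> \<in> Omega" if "\<omega> \<in> Omega" for \<omega>
      using marked_transformation.act_Omega[OF inverse_transformation that] .
    moreover have "N \<subseteq> Omega"
      using sets.sets_into_space[OF Ns] by (simp add: space_Omega_M)
    ultimately show ?thesis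
      unfolding space_P by auto
  qed
  finally show "N \<in> null_sets P"
    using Ns sets_P by (intro null_setsI) simp_all
qed

end

theorem proposition2p3:
  fixes A :: "('a::{t2_space, second_countable_topology}, 'n::finite) chart set"
    and G :: "('a, 'n) chart \<Rightarrow> real^'n \<Rightarrow> real^'n^'n"
    and m :: "'a measure"
    and \<rho> :: "'a \<Rightarrow> ennreal"
    and p :: "'a \<Rightarrow> real \<Rightarrow> ennreal"
    and P :: "('a \<times> real) set measure"
  assumes "oriented_smooth_atlas A"
    and "riemannian_metric A G"
    and "connected (UNIV :: 'a set)"
    and "\<not> compact (UNIV :: 'a set)"
    and "riemannian_volume A G m"
    and "\<rho> \<in> borel_measurable m"
    and "radon_measure (density m \<rho>)"
    and "nonatomic (density m \<rho>)"
    and "AE x in m. \<rho> x > 0"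
    and "case_prod p \<in> borel_measurable (m \<Otimes>\<^sub>M lam)"
    and "AE x in m. (AE s in lam. p x s > 0) \<and> (\<integral>\<^sup>+s. p x s \<partial>lam) < \<infinity>"
    and "emeasure (sigma_tilde m \<rho> p) (cyl UNIV) = \<infinity>"
    and "\<And>L. L \<in> Bc \<Longrightarrow>
           (\<integral>\<^sup>+z \<in> cyl L. ennreal (max 1 (snd z)) * q_density \<rho> p z \<partial>(m \<Otimes>\<^sub>M lam)) < \<infinity>"
    and "marked_poisson (sigma_tilde m \<rho> p) P"
  shows "quasiinvariant A P \<and>
    (\<forall>g \<in> carrier (marked_group A).
       distr (sigma_tilde m \<rho> p) (sigma_tilde m \<rho> p) (act_point g)
         = density (sigma_tilde m \<rho> p) (p_density m \<rho> p g) \<and>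
       (AE \<omega> in P. RN_deriv P (distr P Omega_M (act_conf g)) \<omega> = conf_prod (p_density m \<rho> p g) \<omega>))"
proof -
  interpret setting: marked_setting A G m \<rho> p
  proof
    show "AE x in m. AE s in lam. p x s > 0"
      using assms(11) by eventually_elim simp
  qed (use assms in blast)+
  interpret P: prob_space P
    using assms(14) by (simp add: marked_poisson_def)
  have "absolutely_continuous P (distr P Omega_M (act_conf g)) \<and>
      absolutely_continuous (distr P Omega_M (act_conf g)) P \<and>
      distr (sigma_tilde m \<rho> p) (sigma_tilde m \<rho> p) (act_point g)
         = density (sigma_tilde m \<rho> p) (p_density m \<rho> p g) \<and>
      (AE \<omega> in P. RN_deriv P (distr P Omega_M (act_conf g)) \<omega> = conf_prod (p_density m \<rho> p g) \<omega>)"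
    if g: "g \<in> carrier (marked_group A)" for g
  proof -
    obtain \<psi> \<theta> where [simp]: "g = (\<psi>, \<theta>)"
      by (cases g)
    obtain K where "marked_transformation \<psi> \<theta> K"
      using setting.marked_group_transformation(2) g by auto
    then interpret action: marked_action A G m \<rho> p \<psi> \<theta> K
      using setting.marked_group_transformation(1) g setting.marked_setting_axioms
      by (intro marked_action.intro marked_action_axioms.intro) auto
    have "AE \<omega> in P. conf_prod (p_density m \<rho> p g) \<omega> = RN_deriv P (distr P Omega_M (act_conf g)) \<omega>"
      using P.RN_deriv_unique[OF action.distr_marked_poisson(1)[OF assms(14)]
          action.distr_marked_poisson(2)[OF assms(14), symmetric]] by simp
    then have "AE \<omega> in P. RN_deriv P (distr P Omega_M (act_conf g)) \<omega> = conf_prod (p_density m \<rho> p g) \<omega>"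
      by eventually_elim simp
    then show ?thesis
      using action.absolutely_continuous_action[OF assms(14)] action.absolutely_continuous_action_converse[OF assms(14)]
        action.distr_sigma_tilde by simp
  qed
  then show ?thesis
    unfolding quasiinvariant_def by blast
qed

end
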